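(* Let $1\le p,q\le\infty$ and $s>1$. Then the Gevrey-modulation space $\mathcal{GM}^s_{p,q}(\mathbb{R}^n)$ is an algebra under pointwise multiplication.
   Context: The Fourier transform is $\mathcal{F}f(\xi)=(2\pi)^{-n/2}\int_{\mathbb{R}^n}f(x)e^{-ix\cdot\xi}\,dx$, extended to tempered distributions. Fix a function $\rho\in C_0^\infty(\mathbb{R}^n)$ with $\rho:\mathbb{R}^n\to[0,1]$, $\operatorname{supp}\rho\subset[-1,1]^n$ and $\rho=1$ on $[-\tfrac12,\tfrac12]^n$. For $k\in\mathbb{Z}^n$ put $\rho_k(\xi)=\rho(\xi-k)$, $\sigma_k=\rho_k\big(\sum_{m\in\mathbb{Z}^n}\rho_m\big)^{-1}$ and $\Box_k f=\mathcal{F}^{-1}(\sigma_k\mathcal{F}f)$. For $1\le p,q\le\infty$ and $s>0$ the Gevrey-modulation space $\mathcal{GM}^s_{p,q}(\mathbb{R}^n)$ is the set of all $f\in L^p(\mathbb{R}^n)$ (complex-valued functions) with $$\|f\|_{\mathcal{GM}^s_{p,q}}=\Big(\sum_{k\in\mathbb{Z}^n}e^{q|k|^{1/s}}\|\Box_kf\|_{L^p}^q\Big)^{1/q}<\infty$$ (for $q=\infty$: $\sup_{k}e^{|k|^{1/s}}\|\Box_kf\|_{L^p}$), where $|k|$ is the Euclidean norm. "Algebra under pointwise multiplication" means: there is a constant $C_1>0$ such that for all $f,g$ in the space, $f\cdot g$ belongs to the space and its norm is at most $C_1\|f\|_{\mathcal{GM}^s_{p,q}}\|g\|_{\mathcal{GM}^s_{p,q}}$.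 *)

theory Defs
  imports "HOL-Analysis.Analysis" "HOL-Probability.Essential_Supremum"
begin

section \<open>Smooth functions and Schwartz functions\<close>

definition partial_deriv ::
    "'n::finite \<Rightarrow> (real^'n \<Rightarrow> 'b::real_normed_vector) \<Rightarrow> real^'n \<Rightarrow> 'b" where
  "partial_deriv i f x = frechet_derivative f (at x) (axis i 1)"

definition partial_derivs ::
    "'n::finite list \<Rightarrow> (real^'n \<Rightarrow> 'b::real_normed_vector) \<Rightarrow> real^'n \<Rightarrow> 'b" where
  "partial_derivs is f = foldr partial_deriv is f"

text \<open>Differentiability of every iterated partial derivative makes them all continuous, so this is
  the class of infinitely often continuously differentiable functions.\<close>

definition smooth :: "(real^'n::finite \<Rightarrow> 'b::real_normed_vector) \<Rightarrow> bool" where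
  "smooth f \<longleftrightarrow> (\<forall>is x. partial_derivs is f differentiable (at x))"

definition tsupport :: "(real^'n::finite \<Rightarrow> 'b::real_normed_vector) \<Rightarrow> (real^'n) set" where
  "tsupport f = closure (support_on UNIV f)"

definition schwartz :: "(real^'n::finite \<Rightarrow> complex) set" where
  "schwartz = {\<phi>. smooth \<phi> \<and>
     (\<forall>(\<beta> :: 'n \<Rightarrow> nat) is. bounded (range (\<lambda>x. (\<Prod>i\<in>UNIV. (x $ i) ^ \<beta> i) *\<^sub>R partial_derivs is \<phi> x)))}"

section \<open>The Fourier transform on functions and on tempered distributions\<close>

definition fourier :: "(real^'n::finite \<Rightarrow> complex) \<Rightarrow> real^'n \<Rightarrow> complex" where
  "fourier f \<xi> = complex_of_real ((2 * pi) powr (- (real CARD('n) / 2))) *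
     (\<integral>x. f x * exp (- \<i> * complex_of_real (x \<bullet> \<xi>)) \<partial>lebesgue)"

definition inv_fourier :: "(real^'n::finite \<Rightarrow> complex) \<Rightarrow> real^'n \<Rightarrow> complex" where
  "inv_fourier f x = complex_of_real ((2 * pi) powr (- (real CARD('n) / 2))) *
     (\<integral>\<xi>. f \<xi> * exp (\<i> * complex_of_real (x \<bullet> \<xi>)) \<partial>lebesgue)"

text \<open>A tempered distribution is represented by a functional of which only the values on
  \<^const>\<open>schwartz\<close> matter. The operations are the usual transposes. They preserve linearity and
  continuity (for a smooth multiplier of moderate growth), and their defining formulas do not
  refer to these properties, so neither is carried in the type.\<close>

type_synonym 'n functional = "(real^'n \<Rightarrow> complex) \<Rightarrow> complex"

definition dist_of :: "(real^'n::finite \<Rightarrow> complex) \<Rightarrow> 'n functional" where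
  "dist_of f = (\<lambda>\<phi>. \<integral>x. f x * \<phi> x \<partial>lebesgue)"

definition dist_fourier :: "'n::finite functional \<Rightarrow> 'n functional" where
  "dist_fourier T = (\<lambda>\<phi>. T (fourier \<phi>))"

definition dist_inv_fourier :: "'n::finite functional \<Rightarrow> 'n functional" where
  "dist_inv_fourier T = (\<lambda>\<phi>. T (inv_fourier \<phi>))"

definition dist_mult :: "(real^'n::finite \<Rightarrow> real) \<Rightarrow> 'n functional \<Rightarrow> 'n functional" where
  "dist_mult a T = (\<lambda>\<phi>. T (\<lambda>x. complex_of_real (a x) * \<phi> x))"

section \<open>Lebesgue spaces\<close>

text \<open>Used for exponents \<open>a > 0\<close> only.\<close>

definition ennreal_powr :: "ennreal \<Rightarrow> real \<Rightarrow> ennreal" where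
  "ennreal_powr x a = (if x = \<infinity> then \<infinity> else ennreal (enn2real x powr a))"

definition Lp_norm :: "ennreal \<Rightarrow> (real^'n::finite \<Rightarrow> complex) \<Rightarrow> ennreal" where
  "Lp_norm p f =
     (if p = \<infinity> then esssup lebesgue (\<lambda>x. ennreal (norm (f x)))
      else ennreal_powr (\<integral>\<^sup>+x. ennreal (norm (f x) powr enn2real p) \<partial>lebesgue) (1 / enn2real p))"

definition Lp :: "ennreal \<Rightarrow> (real^'n::finite \<Rightarrow> complex) set" where
  "Lp p = {f. f \<in> borel_measurable lebesgue \<and> Lp_norm p f < \<infinity>}"

text \<open>The \<open>L\<^sup>p\<close> norm of a tempered distribution: an \<open>L\<^sup>p\<close> function representing it is unique almost
  everywhere, so the infimum ranges over at most one value; it is \<open>\<infinity>\<close> if there is no such function.\<close>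

definition dist_Lp_norm :: "ennreal \<Rightarrow> 'n::finite functional \<Rightarrow> ennreal" where
  "dist_Lp_norm p T = Inf {Lp_norm p g | g. g \<in> Lp p \<and> (\<forall>\<phi>\<in>schwartz. T \<phi> = dist_of g \<phi>)}"

section \<open>Gevrey-modulation spaces\<close>

definition lattice_vec :: "int^'n::finite \<Rightarrow> real^'n" where
  "lattice_vec k = (\<chi> i. real_of_int (k $ i))"

definition sigma :: "(real^'n::finite \<Rightarrow> real) \<Rightarrow> int^'n \<Rightarrow> real^'n \<Rightarrow> real" where
  "sigma \<rho> k \<xi> = \<rho> (\<xi> - lattice_vec k) * inverse (\<Sum>\<^sub>\<infinity>m\<in>UNIV. \<rho> (\<xi> - lattice_vec m))"

definition Box :: "(real^'n::finite \<Rightarrow> real) \<Rightarrow> int^'n \<Rightarrow> (real^'n \<Rightarrow> complex) \<Rightarrow> 'n functional" where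
  "Box \<rho> k f = dist_inv_fourier (dist_mult (sigma \<rho> k) (dist_fourier (dist_of f)))"

definition GM_norm ::
    "(real^'n::finite \<Rightarrow> real) \<Rightarrow> real \<Rightarrow> ennreal \<Rightarrow> ennreal \<Rightarrow> (real^'n \<Rightarrow> complex) \<Rightarrow> ennreal" where
  "GM_norm \<rho> s p q f =
     (if q = \<infinity> then
        (SUP k. ennreal (exp (norm (lattice_vec k) powr (1 / s))) * dist_Lp_norm p (Box \<rho> k f))
      else
        ennreal_powr
          (\<Sum>\<^sub>\<infinity>k\<in>UNIV. ennreal (exp (enn2real q * norm (lattice_vec k) powr (1 / s))) *
             ennreal_powr (dist_Lp_norm p (Box \<rho> k f)) (enn2real q))
          (1 / enn2real q))"

definition GM ::
    "(real^'n::finite \<Rightarrow> real) \<Rightarrow> real \<Rightarrow> ennreal \<Rightarrow> ennreal \<Rightarrow> (real^'n \<Rightarrow> complex) set" where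
  "GM \<rho> s p q = {f \<in> Lp p. GM_norm \<rho> s p q f < \<infinity>}"

end

theory Submission
  imports Defs "HOL-Probability.Characteristic_Functions" "HOL-Probability.Sinc_Integral"
    "HOL-Real_Asymp.Real_Asymp"
begin

text \<open>The operator \<open>\<box>\<^sub>k\<close> is convolution with a rapidly decreasing kernel whose modulus does not depend
  on \<open>k\<close>. As \<open>\<box>\<^sub>k f\<close> is reproduced by convolution with another such kernel, both its \<open>L\<^sup>p\<close> norm and its
  supremum are bounded by the \<open>L\<^sup>p\<close> norm of the distribution \<open>\<box>\<^sub>k f\<close>. Elements of the space are therefore
  uniformly convergent series \<open>f = \<Sum>\<^sub>l \<box>\<^sub>l f\<close>, and \<open>\<box>\<^sub>k (\<box>\<^sub>l f \<sqdot> \<box>\<^sub>m g)\<close> vanishes, by the location of the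
  spectra, unless \<open>k - l - m\<close> is bounded. Since \<open>s > 1\<close>, the weight is better than submultiplicative:
  \<open>(x + y)\<^sup>r \<le> x\<^sup>r + y\<^sup>r - (1 - r) min(x, y)\<^sup>r\<close> for \<open>r = 1/s\<close>. The gain is a summable factor, which reduces
  the estimate to convolutions \<open>\<ell>\<^sup>1 * \<ell>\<^sup>q\<close> for every \<open>q\<close>.\<close>

text \<open>The norm of a block is an infimum over representing functions, so a bound by it must
  hold for each representative. Testing with the Schwartz function y ->
  \<open>FT (cut k) (y - x)\<close> recovers the value of the block at x from any representative.
  The multipliers act through the kernels \<open>FT a\<close> of compactly supported smooth symbols
  on the class \<open>uloc\<close>, so the location of spectra is expressed by integrals of kernels.
  Lattice sums are integrals over the counting measure: interchanging sums and integrals is Fubini's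
  theorem, and one mixture estimate serves both L^p and l^q. In a product of two blocks one enters
  through its supremum, the other through its L^p norm. After the weights are attached, the gain is
  put on either index in turn: the weighted norm with that index is bounded by the full norm, and
  the other weighted norm is kept as a sequence in l^q. With N = |k|^r, the estimate e^(-N) <=
  e^(-(1-r)N) makes the same gain responsible for the uniform convergence of the series.\<close>

section \<open>Lebesgue norms of nonnegative functions\<close>

lemma ennreal_powr_mono: "a > 0 \<Longrightarrow> x \<le> y \<Longrightarrow> ennreal_powr x a \<le> ennreal_powr y a"
  by (cases x; cases y) (auto simp: ennreal_powr_def top_unique intro!: ennreal_leI powr_mono2)

lemma ennreal_powr_powr: "ennreal_powr (ennreal_powr x a) b = ennreal_powr x (a * b)"
  by (cases x) (auto simp: ennreal_powr_def powr_powr)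

lemma ennreal_powr_one [simp]: "ennreal_powr x 1 = x"
  by (cases x) (auto simp: ennreal_powr_def)

lemma ennreal_powr_zero [simp]: "ennreal_powr 0 a = 0"
  by (auto simp: ennreal_powr_def)

lemma ennreal_powr_ennreal: "x \<ge> 0 \<Longrightarrow> ennreal_powr (ennreal x) a = ennreal (x powr a)"
  by (auto simp: ennreal_powr_def)

lemma ennreal_powr_top [simp]: "ennreal_powr top a = top"
  by (auto simp: ennreal_powr_def)

lemma ennreal_powr_eq_0_iff [simp]: "ennreal_powr x a = 0 \<longleftrightarrow> x = 0"
  by (cases x) (auto simp: ennreal_powr_def)

lemma ennreal_powr_mult: "ennreal_powr (x * y) a = ennreal_powr x a * ennreal_powr y a"
proof (cases "x = top \<or> y = top")
  case True
  then show ?thesis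
    by (cases "x = 0"; cases "y = 0") (auto simp: ennreal_mult_eq_top_iff ennreal_mult_top ennreal_top_mult)
next
  case False
  then obtain r t where "x = ennreal r" "y = ennreal t" "r \<ge> 0" "t \<ge> 0"
    by (metis ennreal_cases infinity_ennreal_def)
  then show ?thesis
    by (simp add: ennreal_mult[symmetric] ennreal_powr_ennreal powr_mult)
qed

lemma ennreal_powr_le_iff:
  assumes "a > 0" shows "ennreal_powr x a \<le> y \<longleftrightarrow> x \<le> ennreal_powr y (1 / a)"
  using ennreal_powr_mono[OF assms, of x "ennreal_powr y (1/a)"]
    ennreal_powr_mono[of "1/a" "ennreal_powr x a" y] assms
  by (auto simp: ennreal_powr_powr)

lemma borel_measurable_ennreal_powr [measurable]:
  assumes [measurable]: "u \<in> borel_measurable M"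
  shows "(\<lambda>x. ennreal_powr (u x) a) \<in> borel_measurable M"
  unfolding ennreal_powr_def by measurable

text \<open>One norm for two purposes: over \<open>lborel\<close> it is the L^p norm, over a
  counting measure the l^q norm. With values in \<open>ennreal\<close>, infinite norms need no
  separate treatment.\<close>

definition eLp :: "'a measure \<Rightarrow> ennreal \<Rightarrow> ('a \<Rightarrow> ennreal) \<Rightarrow> ennreal" where
  "eLp M p u = (if p = \<infinity> then esssup M u
     else ennreal_powr (\<integral>\<^sup>+x. ennreal_powr (u x) (enn2real p) \<partial>M) (1 / enn2real p))"

lemma enn2real_ge_one: "1 \<le> p \<Longrightarrow> p \<noteq> \<infinity> \<Longrightarrow> 1 \<le> enn2real p"
  by (cases p) auto

abbreviation pnorm :: "ennreal \<Rightarrow> ('a::euclidean_space \<Rightarrow> 'b::real_normed_vector) \<Rightarrow> ennreal" where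
  "pnorm p f \<equiv> eLp lborel p (\<lambda>x. ennreal (norm (f x)))"

text \<open>Removing the outer root turns a norm bound into a bound on an integral or an almost
  everywhere bound. Estimates are proved in this form, for both kinds of exponent.\<close>

lemma eLp_le_iff:
  assumes "1 \<le> p" and u: "u \<in> borel_measurable M"
  shows "eLp M p u \<le> S \<longleftrightarrow>
    (if p = \<infinity> then AE x in M. u x \<le> S
     else (\<integral>\<^sup>+x. ennreal_powr (u x) (enn2real p) \<partial>M) \<le> ennreal_powr S (enn2real p))"
proof (cases "p = \<infinity>")
  case True
  have "AE x in M. u x \<le> S" if "esssup M u \<le> S"
    using esssup_AE[of u M] that by (auto elim: order_trans)
  then show ?thesis
    using True u by (auto simp: eLp_def)
next
  case False
  then have "enn2real p > 0"
    using enn2real_ge_one[OF assms(1)] by simp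
  then show ?thesis
    using False ennreal_powr_le_iff[of "1 / enn2real p"] by (auto simp: eLp_def)
qed

lemma eLp_mono_AE:
  assumes p: "1 \<le> p" and u: "u \<in> borel_measurable M" and v: "v \<in> borel_measurable M"
    and le: "AE x in M. u x \<le> v x"
  shows "eLp M p u \<le> eLp M p v"
proof -
  \<comment> \<open>Trivial as it stands; rewritten with \<open>eLp_le_iff\<close> it becomes the
    information on \<open>v\<close> that its norm encodes. The same device recurs below.\<close>
  have *: "eLp M p v \<le> eLp M p v" by simp
  have "enn2real p > 0" if "p \<noteq> \<infinity>"
    using enn2real_ge_one[OF p that] by simp
  then have "AE x in M. ennreal_powr (u x) (enn2real p) \<le> ennreal_powr (v x) (enn2real p)" if "p \<noteq> \<infinity>"
    using le that by (auto intro: ennreal_powr_mono)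
  with * le show ?thesis
    unfolding eLp_le_iff[OF p u] eLp_le_iff[OF p v]
    by (auto split: if_splits intro: order_trans[OF nn_integral_mono_AE])
qed

lemma eLp_mono:
  assumes "1 \<le> p" "u \<in> borel_measurable M" "v \<in> borel_measurable M" "\<And>x. u x \<le> v x"
  shows "eLp M p u \<le> eLp M p v"
  using assms by (intro eLp_mono_AE) auto

text \<open>The tangent to t^p at \<open>c\<close>, arranged so that no subtraction in
  \<open>ennreal\<close> occurs. It is Young's inequality for t and c^(p-1) with the exponents p and
  p/(p-1).\<close>

lemma Young_tangent:
  fixes c p :: real and u :: ennreal
  assumes c: "c > 0" and p: "p \<ge> 1"
  shows "u * ennreal (p * c powr (p - 1)) \<le> ennreal_powr u p + ennreal ((p - 1) * c powr p)"
proof (cases u)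
  case (real t)
  have "t * (p * c powr (p - 1)) \<le> t powr p + (p - 1) * c powr p"
  proof (cases "p = 1")
    case False
    then have p1: "p > 1" using p by simp
    define q where "q = p / (p - 1)"
    have "t * c powr (p - 1) \<le> t powr p / p + (c powr (p - 1)) powr q / q"
      using p1 real c by (intro Youngs_inequality) (auto simp: q_def field_simps)
    also have "(c powr (p - 1)) powr q = c powr p"
      using p1 by (simp add: powr_powr q_def)
    also have "t powr p / p + c powr p / q = (t powr p + (p - 1) * c powr p) / p"
      using p1 by (simp add: q_def field_simps)
    finally show ?thesis using p1 by (simp add: field_simps)
  qed (use c real in auto)
  then show ?thesis
    using real c p by (simp add: ennreal_powr_ennreal flip: ennreal_mult'' ennreal_plus)
qed (auto simp: ennreal_powr_def)

text \<open>Jensen's inequality for a weight of mass at most \<open>V\<close>: the tangent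
  inequality is integrated against \<open>v\<close>, and the best point of contact is the mean
  I/V.\<close>

lemma nn_Jensen_powr:
  fixes p V :: real
  assumes [measurable]: "v \<in> borel_measurable N" "u \<in> borel_measurable N"
    and V: "V > 0" "(\<integral>\<^sup>+t. v t \<partial>N) \<le> ennreal V" and p: "p \<ge> 1"
  shows "ennreal_powr (\<integral>\<^sup>+t. v t * u t \<partial>N) p \<le>
    ennreal (V powr (p - 1)) * (\<integral>\<^sup>+t. v t * ennreal_powr (u t) p \<partial>N)"
proof -
  define I where "I = (\<integral>\<^sup>+t. v t * u t \<partial>N)"
  define R where "R = (\<integral>\<^sup>+t. v t * ennreal_powr (u t) p \<partial>N)"
  have tangent: "I * ennreal (p * c powr (p - 1)) \<le> R + ennreal ((p - 1) * c powr p * V)" if "c > 0" for c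
  proof -
    have "I * ennreal (p * c powr (p - 1)) = (\<integral>\<^sup>+t. v t * (u t * ennreal (p * c powr (p - 1))) \<partial>N)"
      unfolding I_def by (subst nn_integral_multc[symmetric]) (auto simp: mult.assoc)
    also have "\<dots> \<le> (\<integral>\<^sup>+t. v t * (ennreal_powr (u t) p + ennreal ((p - 1) * c powr p)) \<partial>N)"
      by (intro nn_integral_mono mult_left_mono Young_tangent) (use that p in auto)
    also have "\<dots> = R + (\<integral>\<^sup>+t. v t \<partial>N) * ennreal ((p - 1) * c powr p)"
      unfolding R_def by (simp add: distrib_left nn_integral_add nn_integral_multc)
    also have "\<dots> \<le> R + ennreal V * ennreal ((p - 1) * c powr p)"
      by (intro add_left_mono mult_right_mono V) auto
    finally show ?thesis using V p by (simp add: ennreal_mult'' mult.commute[of V] flip: ennreal_mult'')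
  qed
  show ?thesis
  proof (cases "R = top")
    case True
    then show ?thesis using V by (simp add: R_def[symmetric] ennreal_mult_top)
  next
    case R: False
    \<comment> \<open>The tangent at 1 already bounds \<open>I\<close> by a finite number, so that
      the mean can be formed.\<close>
    have "I \<noteq> top"
      using tangent[of 1] R p by (auto simp: ennreal_top_mult top_unique)
    then obtain i where i: "I = ennreal i" "i \<ge> 0" by (cases I) auto
    obtain r where r: "R = ennreal r" "r \<ge> 0" using R by (cases R) auto
    have "i powr p \<le> V powr (p - 1) * r"
    proof (cases "i = 0")
      case False
      define c where "c = i / V"
      have c: "c > 0" "i = c * V" using False i V by (auto simp: c_def)
      have cp: "c * c powr (p - 1) = c powr p"
        using c powr_add[of c 1 "p - 1"] by simp
      have Vp: "V * V powr (p - 1) = V powr p"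
        using V powr_add[of V 1 "p - 1"] by simp
      have "i * (p * c powr (p - 1)) \<le> r + (p - 1) * c powr p * V"
        using tangent[OF c(1)] i r V p
        by (simp add: ennreal_mult'[symmetric] ennreal_plus[symmetric] del: ennreal_plus)
      also have "i * (p * c powr (p - 1)) = p * c powr p * V"
        using cp by (simp add: c(2) algebra_simps)
      finally have "c powr p * V \<le> r" by (simp add: algebra_simps)
      then have "V powr (p - 1) * (c powr p * V) \<le> V powr (p - 1) * r"
        by (intro mult_left_mono) auto
      moreover have "i powr p = V powr (p - 1) * (c powr p * V)"
        using c V Vp by (simp add: c(2) powr_mult algebra_simps)
      ultimately show ?thesis by simp
    qed (use r V in auto)
    then show ?thesis
      using i r V unfolding I_def[symmetric] R_def[symmetric]
      by (simp add: ennreal_powr_ennreal flip: ennreal_mult)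
  qed
qed

text \<open>For the supremum norm the exceptional null set in x depends on t, and t may range over
  an uncountable space; Fubini's theorem exchanges the two quantifiers.\<close>

lemma (in pair_sigma_finite) AE_commute_nn:
  assumes [measurable]: "Measurable.pred (M1 \<Otimes>\<^sub>M M2) (\<lambda>(x, t). P x t)"
    and "\<And>t. t \<in> space M2 \<Longrightarrow> AE x in M1. P x t"
  shows "AE x in M1. AE t in M2. P x t"
proof (subst AE_commute)
  show "AE t in M2. AE x in M1. P x t"
    by (rule AE_I2) (rule assms(2))
qed simp

text \<open>Young's inequality for convolutions, on groups as well as on lattices, and Minkowski's
  inequality are both instances of this estimate.\<close>

lemma eLp_mixture_le:
  assumes M: "sigma_finite_measure M" and N: "sigma_finite_measure N" and p: "1 \<le> p"
    and v [measurable]: "v \<in> borel_measurable N"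
    and u [measurable]: "(\<lambda>(x, t). u x t) \<in> borel_measurable (M \<Otimes>\<^sub>M N)"
    and V: "(\<integral>\<^sup>+t. v t \<partial>N) \<le> ennreal V" and S: "\<And>t. t \<in> space N \<Longrightarrow> eLp M p (\<lambda>x. u x t) \<le> S"
  shows "eLp M p (\<lambda>x. \<integral>\<^sup>+t. v t * u x t \<partial>N) \<le> ennreal V * S"
proof -
  interpret M: sigma_finite_measure M by fact
  interpret N: sigma_finite_measure N by fact
  interpret pair_sigma_finite M N ..
  have ut [measurable]: "(\<lambda>x. u x t) \<in> borel_measurable M" if "t \<in> space N" for t
    using that by measurable
  have ux [measurable]: "(\<lambda>t. u x t) \<in> borel_measurable N" if "x \<in> space M" for x
    using that by measurable
  have meas [measurable]: "(\<lambda>x. \<integral>\<^sup>+t. v t * u x t \<partial>N) \<in> borel_measurable M"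
    by measurable
  show ?thesis
  proof (cases "V > 0")
    case False
    \<comment> \<open>For \<open>V\<close> at most 0 the number \<open>ennreal V\<close> is 0, so
      the weight vanishes almost everywhere. Jensen's inequality covers only positive
      \<open>V\<close>.\<close>
    then have "(\<integral>\<^sup>+t. v t \<partial>N) = 0" using V by (simp add: ennreal_neg)
    then have "AE t in N. v t = 0" by (subst (asm) nn_integral_0_iff_AE) auto
    then have "(\<integral>\<^sup>+t. v t * u x t \<partial>N) = 0" if "x \<in> space M" for x
      using that by (subst nn_integral_0_iff_AE) auto
    then show ?thesis
      by (subst eLp_le_iff[OF p meas]) (auto cong: nn_integral_cong)
  next
    case True
    show ?thesis
    proof (cases "p = \<infinity>")
      case p': True
      have "AE x in M. AE t in N. u x t \<le> S"
        using S p p' by (intro AE_commute_nn) (auto simp: eLp_le_iff)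
      moreover have "AE x in M. x \<in> space M" by simp
      ultimately have "AE x in M. (\<integral>\<^sup>+t. v t * u x t \<partial>N) \<le> ennreal V * S"
      proof eventually_elim
        case (elim x)
        have "(\<integral>\<^sup>+t. v t * u x t \<partial>N) \<le> (\<integral>\<^sup>+t. v t * S \<partial>N)"
          using elim by (intro nn_integral_mono_AE) (auto elim!: eventually_mono intro: mult_left_mono)
        also have "\<dots> \<le> ennreal V * S" by (simp add: nn_integral_multc mult_right_mono V)
        finally show ?case .
      qed
      then show ?thesis using p' by (subst eLp_le_iff[OF p meas]) simp
    next
      case p': False
      define r where "r = enn2real p"
      have r: "r \<ge> 1" using enn2real_ge_one[OF p p'] by (simp add: r_def)
      \<comment> \<open>Jensen's inequality is applied for fixed x; Tonelli's theorem then leaves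
        the norms of the members \<open>u x t\<close>, each at most \<open>S\<close>.\<close>
      have "(\<integral>\<^sup>+x. ennreal_powr (\<integral>\<^sup>+t. v t * u x t \<partial>N) r \<partial>M) \<le>
          (\<integral>\<^sup>+x. ennreal (V powr (r - 1)) * (\<integral>\<^sup>+t. v t * ennreal_powr (u x t) r \<partial>N) \<partial>M)"
        by (intro nn_integral_mono nn_Jensen_powr) (use True V r in auto)
      also have "\<dots> = ennreal (V powr (r - 1)) * (\<integral>\<^sup>+t. \<integral>\<^sup>+x. v t * ennreal_powr (u x t) r \<partial>M \<partial>N)"
        by (subst nn_integral_cmult) (auto intro!: arg_cong2[of _ _ _ _ "(*)"] Fubini'[symmetric])
      also have "\<dots> = ennreal (V powr (r - 1)) * (\<integral>\<^sup>+t. v t * (\<integral>\<^sup>+x. ennreal_powr (u x t) r \<partial>M) \<partial>N)"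
        by (intro arg_cong2[of _ _ _ _ "(*)"] refl nn_integral_cong nn_integral_cmult) auto
      also have "\<dots> \<le> ennreal (V powr (r - 1)) * (\<integral>\<^sup>+t. v t * ennreal_powr S r \<partial>N)"
        using S p p' unfolding r_def
        by (intro mult_left_mono nn_integral_mono) (auto simp: eLp_le_iff)
      also have "\<dots> \<le> ennreal (V powr (r - 1)) * (ennreal V * ennreal_powr S r)"
        by (intro mult_left_mono) (simp_all add: nn_integral_multc V mult_right_mono)
      also have "\<dots> = ennreal_powr (ennreal V * S) r"
        using True powr_add[of V "r - 1" 1]
        by (simp add: ennreal_powr_mult ennreal_powr_ennreal ennreal_mult mult.assoc)
      finally show ?thesis using p' by (simp add: eLp_le_iff[OF p meas] r_def)
    qed
  qed
qed

lemma eLp_cmult_le: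
  assumes p: "1 \<le> p" and [measurable]: "u \<in> borel_measurable M"
  shows "eLp M p (\<lambda>x. c * u x) \<le> c * eLp M p u"
proof -
  have *: "eLp M p u \<le> eLp M p u" by simp
  show ?thesis
  proof (cases "p = \<infinity>")
    case True
    then have "AE x in M. u x \<le> eLp M p u"
      using * eLp_le_iff[OF p assms(2), of "eLp M p u"] by simp
    then have "AE x in M. c * u x \<le> c * eLp M p u"
      by eventually_elim (rule mult_left_mono, auto)
    then show ?thesis
      by (subst eLp_le_iff[OF p]) (use True in simp_all)
  next
    case False
    then have "(\<integral>\<^sup>+x. ennreal_powr (u x) (enn2real p) \<partial>M) \<le> ennreal_powr (eLp M p u) (enn2real p)"
      using * eLp_le_iff[OF p assms(2), of "eLp M p u"] by simp
    then show ?thesis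
      by (subst eLp_le_iff[OF p])
        (use False in \<open>simp_all add: ennreal_powr_mult nn_integral_cmult mult_left_mono\<close>)
  qed
qed

section \<open>Countable sums as integrals, and Minkowski's inequality\<close>

abbreviation counting :: "'a measure" where
  "counting \<equiv> count_space UNIV"

lemma sigma_finite_count_space_UNIV: "sigma_finite_measure (count_space (UNIV :: 'a::countable set))"
  by (rule sigma_finite_measure_count_space)

lemma borel_measurable_count_space_pair2:
  fixes u :: "'a \<Rightarrow> 'i::countable \<Rightarrow> 'b::topological_space"
  assumes "\<And>t. (\<lambda>x. u x t) \<in> borel_measurable M"
  shows "(\<lambda>(x, t). u x t) \<in> borel_measurable (M \<Otimes>\<^sub>M counting)"
  using measurable_pair_measure_countable1[of "UNIV :: 'i set" "\<lambda>(t, x). u x t" M borel] assms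
  by (subst measurable_pair_swap_iff) (simp add: case_prod_unfold)

text \<open>Each summand is written as \<open>B t\<close> times a function of norm at most 1, where
  \<open>B t\<close> slightly exceeds its norm. This is a mixture with weight \<open>B\<close>,
  whose mass exceeds the right-hand side by at most \<open>e\<close>.\<close>

lemma eLp_Minkowski_countable:
  fixes u :: "'a \<Rightarrow> 'i::countable \<Rightarrow> ennreal"
  assumes M: "sigma_finite_measure M" and p: "1 \<le> p"
    and u [measurable]: "\<And>t. (\<lambda>x. u x t) \<in> borel_measurable M"
  shows "eLp M p (\<lambda>x. \<integral>\<^sup>+t. u x t \<partial>counting) \<le> (\<integral>\<^sup>+t. eLp M p (\<lambda>x. u x t) \<partial>counting)"
    (is "?L \<le> ?R")
proof (cases "?R = top")
  case False
  have ex: "\<exists>w::'i \<Rightarrow> real. (\<forall>t. w t > 0) \<and> (\<integral>\<^sup>+t. ennreal (w t) \<partial>counting) \<le> ennreal e"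
    if "e > 0" for e
  proof -
    \<comment> \<open>A geometric series of sum \<open>e\<close>, carried over to the index type by
      \<open>to_nat\<close>.\<close>
    define h where "h n = e * (1/2) ^ Suc n" for n
    have h: "h n > 0" for n using that by (simp add: h_def)
    have sums: "h sums e"
      unfolding h_def using sums_mult[OF power_half_series, of e] by (simp only: mult_1_right)
    have "(\<integral>\<^sup>+t. ennreal (h (to_nat (t::'i))) \<partial>counting)
        = (\<integral>\<^sup>+n. ennreal (h n) \<partial>count_space (range (to_nat :: 'i \<Rightarrow> nat)))"
      by (rule nn_integral_bij_count_space) (simp add: bij_betw_def)
    also have "\<dots> \<le> (\<integral>\<^sup>+n. ennreal (h n) \<partial>counting)"
      by (subst nn_integral_count_space_indicator) (auto intro!: nn_integral_mono split: split_indicator)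
    also have "\<dots> = ennreal (suminf h)"
      unfolding nn_integral_count_space_nat
      by (rule suminf_ennreal2) (use h sums_summable[OF sums] in \<open>auto intro: less_imp_le\<close>)
    also have "suminf h = e" using sums by (simp add: sums_iff)
    finally show ?thesis using h by (intro exI[of _ "\<lambda>t. h (to_nat t)"]) simp
  qed
  obtain R where R: "?R = ennreal R" "R \<ge> 0" using False by (cases ?R) auto
  have "?L \<le> ennreal R + ennreal e" if e: "e > 0" for e :: real
  proof -
    obtain w :: "'i \<Rightarrow> real" where w: "\<And>t. w t > 0" "(\<integral>\<^sup>+t. ennreal (w t) \<partial>counting) \<le> ennreal e"
      using ex[OF e] by blast
    define A where "A t = eLp M p (\<lambda>x. u x t)" for t
    have A: "A t \<noteq> top" for t
      using nn_integral_ge_point[of t UNIV A] False by (auto simp: A_def top_unique)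
    \<comment> \<open>The summand \<open>w t\<close> keeps \<open>B t\<close> away from 0 when the
      norm vanishes, so that division by it is possible.\<close>
    define B where "B t = A t + ennreal (w t)" for t
    have B: "B t \<noteq> 0" "B t \<noteq> top" "A t \<le> B t" for t
      using A[of t] w(1)[of t] by (auto simp: B_def)
    have eq: "(\<integral>\<^sup>+t. u x t \<partial>counting) = (\<integral>\<^sup>+t. B t * (u x t / B t) \<partial>counting)" for x
    proof (rule nn_integral_cong)
      show "u x t = B t * (u x t / B t)" for t
        unfolding ennreal_times_divide mult.commute[of "B t"]
        using mult_divide_eq_ennreal[OF B(1,2)] by (rule sym)
    qed
    have "eLp M p (\<lambda>x. u x t / B t) \<le> inverse (B t) * A t" for t
      using eLp_cmult_le[OF p u, of "inverse (B t)" t] by (simp add: divide_ennreal_def mult.commute A_def)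
    also have "inverse (B t) * A t \<le> inverse (B t) * B t" for t
      using B by (intro mult_left_mono) auto
    also have "inverse (B t) * B t = 1" for t
      using B(1,2)[of t] by (metis divide_ennreal_def ennreal_divide_self infinity_ennreal_def less_top mult.commute)
    finally have le1: "eLp M p (\<lambda>x. u x t / B t) \<le> 1" for t .
    have sumB: "(\<integral>\<^sup>+t. B t \<partial>counting) \<le> ennreal (R + e)"
      using w(2) R e unfolding B_def by (subst nn_integral_add) (auto simp: A_def[symmetric] add_left_mono)
    have "?L \<le> ennreal (R + e) * 1"
      unfolding eq by (rule eLp_mixture_le[OF M sigma_finite_count_space_UNIV p _ _ sumB])
        (auto intro!: borel_measurable_count_space_pair2 le1)
    then show ?thesis using R e by simp
  qed
  then have "?L \<le> ennreal R" by (rule ennreal_le_epsilon)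
  then show ?thesis unfolding R(1) .
qed simp

section \<open>Smooth functions\<close>

text \<open>The recursion strips the derivative taken first. Closure properties then follow by
  induction on the order, since the derivative of a sum or product is built from functions of lower
  order.\<close>

primrec smooth_upto :: "nat \<Rightarrow> (real^'n::finite \<Rightarrow> 'b::real_normed_vector) \<Rightarrow> bool" where
  "smooth_upto 0 f \<longleftrightarrow> (\<forall>x. f differentiable (at x))"
| "smooth_upto (Suc N) f \<longleftrightarrow> (\<forall>x. f differentiable (at x)) \<and> (\<forall>i. smooth_upto N (partial_deriv i f))"

lemma partial_derivs_snoc: "partial_derivs (js @ [i]) f = partial_derivs js (partial_deriv i f)"
  by (simp add: partial_derivs_def)

lemma partial_derivs_Nil [simp]: "partial_derivs [] f = f"
  and partial_derivs_Cons: "partial_derivs (i # js) f = partial_deriv i (partial_derivs js f)"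
  by (simp_all add: partial_derivs_def)

lemma smooth_upto_iff:
  "smooth_upto N f \<longleftrightarrow> (\<forall>js x. length js \<le> N \<longrightarrow> partial_derivs js f differentiable (at x))"
proof (induction N arbitrary: f)
  case (Suc N)
  show ?case
  proof safe
    fix js :: "'a list" and x
    assume *: "smooth_upto (Suc N) f" "length js \<le> Suc N"
    show "partial_derivs js f differentiable (at x)"
    proof (cases js rule: rev_cases)
      case (snoc ks i)
      then show ?thesis using * Suc by (simp add: partial_derivs_snoc)
    qed (use * in auto)
  next
    assume *: "\<forall>js x. length js \<le> Suc N \<longrightarrow> partial_derivs js f differentiable (at x)"
    have "f differentiable (at x)" for x using *[rule_format, of "[]"] by simp
    moreover have "smooth_upto N (partial_deriv i f)" for i
      unfolding Suc using * by (auto simp flip: partial_derivs_snoc)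
    ultimately show "smooth_upto (Suc N) f" by simp
  qed
qed simp

lemma smooth_iff_smooth_upto: "smooth f \<longleftrightarrow> (\<forall>N. smooth_upto N f)"
  unfolding smooth_def smooth_upto_iff by auto

lemma smooth_upto_mono: "smooth_upto (Suc N) f \<Longrightarrow> smooth_upto N f"
  unfolding smooth_upto_iff by auto

lemma smooth_upto_differentiable: "smooth_upto N f \<Longrightarrow> f differentiable (at x)"
  by (cases N) auto

lemma smooth_differentiable: "smooth f \<Longrightarrow> f differentiable (at x)"
  unfolding smooth_iff_smooth_upto using smooth_upto_differentiable by blast

lemma smooth_partial_deriv: "smooth f \<Longrightarrow> smooth (partial_deriv i f)"
  unfolding smooth_iff_smooth_upto by (metis smooth_upto.simps(2))

lemma smooth_continuous_on: "smooth f \<Longrightarrow> continuous_on S f"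
  by (meson smooth_differentiable continuous_at_imp_continuous_on differentiable_imp_continuous_within)

lemma partial_deriv_eq: "(f has_derivative D) (at x) \<Longrightarrow> partial_deriv i f x = D (axis i 1)"
  unfolding partial_deriv_def using frechet_derivative_at by metis

lemma differentiable_has_derivative: "f differentiable (at x) \<Longrightarrow> (f has_derivative frechet_derivative f (at x)) (at x)"
  using frechet_derivative_works by blast

lemma smooth_upto_bounded_linear:
  assumes "bounded_linear h"
  shows "smooth_upto N f \<Longrightarrow> smooth_upto N (\<lambda>x. h (f x))"
proof (induction N arbitrary: f)
  case 0
  then show ?case
    using bounded_linear.has_derivative[OF assms] by (auto simp: differentiable_def) blast
next
  case (Suc N)
  have D: "((\<lambda>x. h (f x)) has_derivative (\<lambda>v. h (frechet_derivative f (at x) v))) (at x)" for x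
    using Suc.prems by (intro bounded_linear.has_derivative[OF assms] differentiable_has_derivative) simp
  have "partial_deriv i (\<lambda>x. h (f x)) = (\<lambda>x. h (partial_deriv i f x))" for i
    using partial_deriv_eq[OF D] by (auto simp: partial_deriv_def)
  then show ?case using Suc differentiableI[OF D] by auto
qed

lemma smooth_upto_add: "smooth_upto N f \<Longrightarrow> smooth_upto N g \<Longrightarrow> smooth_upto N (\<lambda>x. f x + g x)"
proof (induction N arbitrary: f g)
  case (Suc N)
  have D: "((\<lambda>x. f x + g x) has_derivative (\<lambda>v. frechet_derivative f (at x) v + frechet_derivative g (at x) v)) (at x)" for x
    using Suc.prems by (intro has_derivative_add differentiable_has_derivative) auto
  have "partial_deriv i (\<lambda>x. f x + g x) = (\<lambda>x. partial_deriv i f x + partial_deriv i g x)" for i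
    using partial_deriv_eq[OF D] by (auto simp: partial_deriv_def)
  then show ?case using Suc differentiableI[OF D] by auto
qed auto

lemma smooth_upto_mult:
  fixes f g :: "real^'n::finite \<Rightarrow> 'b::real_normed_algebra"
  shows "smooth_upto N f \<Longrightarrow> smooth_upto N g \<Longrightarrow> smooth_upto N (\<lambda>x. f x * g x)"
proof (induction N arbitrary: f g)
  case (Suc N)
  have D: "((\<lambda>x. f x * g x) has_derivative
      (\<lambda>v. f x * frechet_derivative g (at x) v + frechet_derivative f (at x) v * g x)) (at x)" for x
    using Suc.prems by (intro has_derivative_mult differentiable_has_derivative) auto
  have "partial_deriv i (\<lambda>x. f x * g x) = (\<lambda>x. f x * partial_deriv i g x + partial_deriv i f x * g x)" for i
    using partial_deriv_eq[OF D] by (auto simp: partial_deriv_def)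
  moreover have "smooth_upto N f" "smooth_upto N g"
    using Suc.prems smooth_upto_mono by blast+
  ultimately show ?case using Suc differentiableI[OF D] by (auto intro!: smooth_upto_add)
qed (auto simp: differentiable_mult)

lemma smooth_upto_const: "smooth_upto N (\<lambda>x. c)"
proof (induction N arbitrary: c)
  case (Suc N)
  have "partial_deriv i (\<lambda>x. c) = (\<lambda>x. 0)" for i :: 'a
    using partial_deriv_eq[OF has_derivative_const] by fastforce
  then show ?case using Suc by simp
qed simp

text \<open>The derivative -(1/f) f' (1/f) contains 1/f itself, but with one order of smoothness
  less, so the induction closes with \<open>f\<close> fixed.\<close>

lemma smooth_upto_inverse:
  fixes f :: "real^'n::finite \<Rightarrow> real"
  assumes "\<And>x. f x \<noteq> 0"
  shows "smooth_upto N f \<Longrightarrow> smooth_upto N (\<lambda>x. inverse (f x))"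
proof (induction N)
  case 0
  then show ?case using assms by (auto intro!: differentiable_inverse)
next
  case (Suc N)
  have D: "((\<lambda>x. inverse (f x)) has_derivative
      (\<lambda>v. - (inverse (f x) * frechet_derivative f (at x) v * inverse (f x)))) (at x)" for x
    using Suc.prems assms by (intro Deriv.has_derivative_inverse differentiable_has_derivative) auto
  have *: "partial_deriv i (\<lambda>x. inverse (f x)) = (\<lambda>x. (- 1) * (inverse (f x) * partial_deriv i f x * inverse (f x)))" for i
    using partial_deriv_eq[OF D] by (auto simp: partial_deriv_def)
  have "smooth_upto N (\<lambda>x. inverse (f x))" using Suc smooth_upto_mono by blast
  then have "smooth_upto N (partial_deriv i (\<lambda>x. inverse (f x)))" for i
    unfolding * using Suc.prems by (intro smooth_upto_mult smooth_upto_const) auto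
  then show ?case using differentiableI[OF D] by auto
qed

lemma smooth_upto_affine:
  fixes f :: "real^'n::finite \<Rightarrow> 'b::real_normed_vector"
  shows "smooth_upto N f \<Longrightarrow> smooth_upto N (\<lambda>x. f (c *\<^sub>R x + a))"
proof (induction N arbitrary: f)
  case (0 f)
  have "(f \<circ> (\<lambda>x. c *\<^sub>R x + a)) differentiable (at x)" for x
    using 0 by (intro differentiable_chain_at derivative_intros) auto
  then show ?case by (simp add: o_def)
next
  case (Suc N)
  have D: "((\<lambda>x. f (c *\<^sub>R x + a)) has_derivative (\<lambda>v. frechet_derivative f (at (c *\<^sub>R x + a)) (c *\<^sub>R v))) (at x)" for x
  proof -
    have "((\<lambda>x. c *\<^sub>R x + a) has_derivative (\<lambda>v. c *\<^sub>R v)) (at x)"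
      by (auto intro!: derivative_eq_intros)
    then show ?thesis
      by (rule has_derivative_compose) (use Suc.prems in \<open>auto intro: differentiable_has_derivative\<close>)
  qed
  have "frechet_derivative f (at y) (c *\<^sub>R v) = c *\<^sub>R frechet_derivative f (at y) v" for y v
    using Suc.prems by (intro linear_cmul linear_frechet_derivative) simp
  then have *: "partial_deriv i (\<lambda>x. f (c *\<^sub>R x + a)) = (\<lambda>x. c *\<^sub>R partial_deriv i f (c *\<^sub>R x + a))" for i
    using partial_deriv_eq[OF D] by (auto simp: partial_deriv_def)
  have "smooth_upto N (partial_deriv i (\<lambda>x. f (c *\<^sub>R x + a)))" for i
    unfolding * by (rule smooth_upto_bounded_linear[OF bounded_linear_scaleR_right]) (use Suc in simp)
  then show ?case using differentiableI[OF D] by auto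
qed

lemma partial_deriv_cong_open:
  assumes "open U" "x \<in> U" "\<And>y. y \<in> U \<Longrightarrow> f y = g y" "g differentiable (at x)"
  shows "f differentiable (at x)" "partial_deriv i f x = partial_deriv i g x"
proof -
  have "(g has_derivative frechet_derivative g (at x)) (at x)"
    using assms(4) by (rule differentiable_has_derivative)
  then have D: "(f has_derivative frechet_derivative g (at x)) (at x)"
    using assms by (metis has_derivative_transform_within_open)
  then show "f differentiable (at x)" by (auto simp: differentiable_def)
  show "partial_deriv i f x = partial_deriv i g x"
    using partial_deriv_eq[OF D] by (simp add: partial_deriv_def)
qed

text \<open>Serves the locally finite sum \<open>total\<close>, which agrees on each ball with a
  finite sum of translates of \<open>\<rho>\<close>.\<close>

lemma smooth_upto_local:
  assumes "\<And>x. \<exists>U g. open U \<and> x \<in> U \<and> smooth_upto N g \<and> (\<forall>y\<in>U. f y = g y)"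
  shows "smooth_upto N f"
  using assms
proof (induction N arbitrary: f)
  case 0
  show ?case
  proof (simp, intro allI)
    fix x
    obtain U g where "open U" "x \<in> U" "smooth_upto 0 g" "\<forall>y\<in>U. f y = g y" using 0 by blast
    then show "f differentiable (at x)" by (intro partial_deriv_cong_open(1)[of U x f g]) auto
  qed
next
  case (Suc N)
  have "f differentiable (at x)" for x
  proof -
    obtain U g where "open U" "x \<in> U" "smooth_upto (Suc N) g" "\<forall>y\<in>U. f y = g y" using Suc.prems by blast
    then show ?thesis by (intro partial_deriv_cong_open(1)[of U x f g]) auto
  qed
  moreover have "smooth_upto N (partial_deriv i f)" for i
  proof (rule Suc.IH)
    fix x
    obtain U g where U: "open U" "x \<in> U" "smooth_upto (Suc N) g" "\<forall>y\<in>U. f y = g y" using Suc.prems by blast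
    then have "partial_deriv i f y = partial_deriv i g y" if "y \<in> U" for y
      using that by (intro partial_deriv_cong_open(2)[of U]) auto
    then show "\<exists>U h. open U \<and> x \<in> U \<and> smooth_upto N h \<and> (\<forall>y\<in>U. partial_deriv i f y = h y)"
      using U by (intro exI[of _ U] exI[of _ "partial_deriv i g"]) auto
  qed
  ultimately show ?case by simp
qed

lemma smooth_const: "smooth (\<lambda>x. k)"
  and smooth_add: "smooth f \<Longrightarrow> smooth g \<Longrightarrow> smooth (\<lambda>x. f x + g x)"
  and smooth_affine: "smooth f \<Longrightarrow> smooth (\<lambda>x. f (c *\<^sub>R x + a))"
  and smooth_of_real: "smooth h \<Longrightarrow> smooth (\<lambda>x. complex_of_real (h x))"
  by (simp_all add: smooth_iff_smooth_upto smooth_upto_const smooth_upto_add smooth_upto_affine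
        smooth_upto_bounded_linear[OF bounded_linear_of_real])

lemma smooth_mult:
  fixes f g :: "real^'n::finite \<Rightarrow> 'b::real_normed_algebra"
  shows "smooth f \<Longrightarrow> smooth g \<Longrightarrow> smooth (\<lambda>x. f x * g x)"
  by (simp add: smooth_iff_smooth_upto smooth_upto_mult)

lemma smooth_inverse:
  fixes f :: "real^'n::finite \<Rightarrow> real"
  shows "smooth f \<Longrightarrow> (\<And>x. f x \<noteq> 0) \<Longrightarrow> smooth (\<lambda>x. inverse (f x))"
  by (simp add: smooth_iff_smooth_upto smooth_upto_inverse)

lemma smooth_sum: "finite A \<Longrightarrow> (\<And>i. i \<in> A \<Longrightarrow> smooth (f i)) \<Longrightarrow> smooth (\<lambda>x. \<Sum>i\<in>A. f i x)"
  by (induction A rule: finite_induct) (auto intro: smooth_const smooth_add)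

lemma smooth_local:
  assumes "\<And>x. \<exists>U g. open U \<and> x \<in> U \<and> smooth g \<and> (\<forall>y\<in>U. f y = g y)"
  shows "smooth f"
  unfolding smooth_iff_smooth_upto
proof
  fix N
  have "\<exists>U g. open U \<and> x \<in> U \<and> smooth_upto N g \<and> (\<forall>y\<in>U. f y = g y)" for x
    using assms[of x] unfolding smooth_iff_smooth_upto by blast
  then show "smooth_upto N f" by (rule smooth_upto_local)
qed

section \<open>Smoothness of exponentials and coordinate functions\<close>

lemma has_derivative_exp_inner:
  "((\<lambda>x. K * exp (c * complex_of_real (x \<bullet> y))) has_derivative
    (\<lambda>v. K * c * complex_of_real (v \<bullet> y) * exp (c * complex_of_real (x \<bullet> y)))) (at x)"
proof -
  have "((\<lambda>v. complex_of_real (v \<bullet> y)) has_derivative (\<lambda>v. complex_of_real (v \<bullet> y))) (at x)"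
    by (intro bounded_linear_imp_has_derivative bounded_linear_compose[OF bounded_linear_of_real] bounded_linear_inner_left)
  moreover have "((\<lambda>z. K * exp (c * z)) has_field_derivative (K * (c * exp (c * z)))) (at z)" for z
    by (rule DERIV_cmult DERIV_chain'[OF _ DERIV_exp, THEN DERIV_cong] DERIV_cmult_Id | simp)+
  ultimately have "((\<lambda>x. K * exp (c * complex_of_real (x \<bullet> y))) has_derivative
      (\<lambda>v. (K * (c * exp (c * complex_of_real (x \<bullet> y)))) * complex_of_real (v \<bullet> y))) (at x)"
    unfolding has_field_derivative_def by (rule has_derivative_compose)
  then show ?thesis by (simp add: mult_ac)
qed

lemma smooth_exp_inner: "smooth (\<lambda>x::real^'n::finite. exp (c * complex_of_real (x \<bullet> y)))"
proof -
  \<comment> \<open>The factor \<open>K\<close> makes the class closed under differentiation: every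
    derivative only multiplies it by a number.\<close>
  have "smooth_upto N (\<lambda>x::real^'n. K * exp (c * complex_of_real (x \<bullet> y)))" for N K
  proof (induction N arbitrary: K)
    case 0
    show ?case by (simp only: smooth_upto.simps differentiableI[OF has_derivative_exp_inner] simp_thms)
  next
    case (Suc N)
    have "partial_deriv i (\<lambda>x. K * exp (c * complex_of_real (x \<bullet> y)))
        = (\<lambda>x. (K * c * complex_of_real (axis i 1 \<bullet> y)) * exp (c * complex_of_real (x \<bullet> y)))" for i :: 'n
      using partial_deriv_eq[OF has_derivative_exp_inner] by (rule ext)
    then show ?case
      by (simp only: smooth_upto.simps differentiableI[OF has_derivative_exp_inner] simp_thms Suc)
  qed
  from this[of _ 1] show ?thesis by (simp add: smooth_iff_smooth_upto)
qed

lemma has_derivative_coord: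
  "((\<lambda>x. complex_of_real (x $ i)) has_derivative (\<lambda>v. complex_of_real (v $ i))) (at (x :: real^'n::finite))"
  by (intro bounded_linear_imp_has_derivative bounded_linear_compose[OF bounded_linear_of_real] bounded_linear_vec_nth)

lemma smooth_coord: "smooth (\<lambda>x::real^'n::finite. complex_of_real (x $ i))"
  unfolding smooth_iff_smooth_upto
proof
  fix N
  have "partial_deriv j (\<lambda>x::real^'n. complex_of_real (x $ i)) = (\<lambda>x. complex_of_real (axis j 1 $ i))" for j :: 'n
    using partial_deriv_eq[OF has_derivative_coord] by (rule ext)
  then show "smooth_upto N (\<lambda>x::real^'n. complex_of_real (x $ i))"
    by (cases N) (simp_all only: smooth_upto.simps differentiableI[OF has_derivative_coord] simp_thms smooth_upto_const)
qed

text \<open>A bound on the points with \<open>a x \<noteq> 0\<close> is the same as compact support,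
  and it avoids closures.\<close>

definition test_function :: "(real^'n::finite \<Rightarrow> complex) \<Rightarrow> bool" where
  "test_function a \<longleftrightarrow> smooth a \<and> (\<exists>R. \<forall>x. a x \<noteq> 0 \<longrightarrow> norm x \<le> R)"

lemma test_function_smooth: "test_function a \<Longrightarrow> smooth a"
  by (simp add: test_function_def)

lemma test_function_mult:
  assumes "test_function a" "smooth g" shows "test_function (\<lambda>x. a x * g x)"
  using assms unfolding test_function_def by (auto intro: smooth_mult)

lemma test_function_add:
  assumes "test_function a" "test_function b" shows "test_function (\<lambda>x. a x + b x)"
proof -
  obtain R S where "\<And>x. a x \<noteq> 0 \<Longrightarrow> norm x \<le> R" "\<And>x. b x \<noteq> 0 \<Longrightarrow> norm x \<le> S"
    using assms unfolding test_function_def by blast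
  then have "norm x \<le> max R S" if "a x + b x \<noteq> 0" for x
  proof -
    have "a x \<noteq> 0 \<or> b x \<noteq> 0" using that by auto
    then show ?thesis using \<open>\<And>x. a x \<noteq> 0 \<Longrightarrow> norm x \<le> R\<close> \<open>\<And>x. b x \<noteq> 0 \<Longrightarrow> norm x \<le> S\<close>
      by fastforce
  qed
  then show ?thesis using assms unfolding test_function_def by (auto intro: smooth_add)
qed

lemma test_function_partial_deriv:
  assumes "test_function a" shows "test_function (partial_deriv i a)"
proof -
  obtain R where R: "\<And>x. a x \<noteq> 0 \<Longrightarrow> norm x \<le> R" using assms unfolding test_function_def by blast
  have "partial_deriv i a x = 0" if "norm x > R" for x
  proof -
    have "partial_deriv i a x = partial_deriv i (\<lambda>x. 0) x"
    proof (rule partial_deriv_cong_open(2)[of "{x. norm x > R}"])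
      show "open {x :: real^'a. norm x > R}" by (intro open_Collect_less continuous_intros)
      show "a y = 0" if "y \<in> {x. norm x > R}" for y using that R[of y] by force
    qed (use that in auto)
    also have "\<dots> = 0" using partial_deriv_eq[OF has_derivative_const] by fastforce
    finally show ?thesis .
  qed
  then have "\<forall>x. partial_deriv i a x \<noteq> 0 \<longrightarrow> norm x \<le> R" by (meson linorder_not_less)
  then show ?thesis using assms smooth_partial_deriv unfolding test_function_def by blast
qed

lemma test_function_affine:
  assumes "test_function a" "c \<noteq> 0" shows "test_function (\<lambda>x. a (c *\<^sub>R x + y))"
proof -
  obtain R where R: "\<And>x. a x \<noteq> 0 \<Longrightarrow> norm x \<le> R" using assms unfolding test_function_def by blast
  have "norm x \<le> (R + norm y) / \<bar>c\<bar>" if "a (c *\<^sub>R x + y) \<noteq> 0" for x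
  proof -
    have "\<bar>c\<bar> * norm x = norm ((c *\<^sub>R x + y) - y)" by simp
    also have "\<dots> \<le> norm (c *\<^sub>R x + y) + norm y" by (rule norm_triangle_ineq4)
    also have "\<dots> \<le> R + norm y" using R[OF that] by simp
    finally show ?thesis using assms by (simp add: field_simps)
  qed
  then show ?thesis using assms unfolding test_function_def by (auto intro: smooth_affine)
qed

lemma test_function_bounded:
  assumes "test_function a" obtains B where "\<And>x. norm (a x) \<le> B"
proof -
  obtain R where R: "\<And>x. a x \<noteq> 0 \<Longrightarrow> norm x \<le> R" using assms unfolding test_function_def by blast
  have "bounded (a ` cball 0 R)"
    using assms by (intro compact_imp_bounded compact_continuous_image smooth_continuous_on) (auto simp: test_function_def)
  then obtain B where "\<And>x. x \<in> cball 0 R \<Longrightarrow> norm (a x) \<le> B" unfolding bounded_iff by fast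
  then have "norm (a x) \<le> max B 0" for x by (cases "a x = 0") (auto simp: R le_max_iff_disj)
  then show thesis using that by blast
qed

lemma test_function_measurable [measurable_dest]: "test_function a \<Longrightarrow> a \<in> borel_measurable borel"
  by (auto simp: test_function_def intro!: borel_measurable_continuous_onI smooth_continuous_on)

lemma test_function_integrable:
  assumes "test_function a" shows "integrable lborel a"
proof -
  obtain R where R: "\<And>x. a x \<noteq> 0 \<Longrightarrow> norm x \<le> R" using assms unfolding test_function_def by blast
  have "integrable lborel (\<lambda>x. indicator (cball 0 R) x *\<^sub>R a x)"
    using assms by (intro borel_integrable_compact smooth_continuous_on) (auto simp: test_function_def)
  also have "(\<lambda>x. indicator (cball 0 R) x *\<^sub>R a x) = a"
  proof
    fix x show "indicator (cball 0 R) x *\<^sub>R a x = a x"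
      using R[of x] by (cases "a x = 0") auto
  qed
  finally show ?thesis .
qed

section \<open>Affine changes of variables\<close>

lemma nn_integral_lborel_affine:
  fixes t :: "'a::euclidean_space"
  assumes [measurable]: "f \<in> borel_measurable borel" and c: "c \<noteq> 0"
  shows "(\<integral>\<^sup>+x. f x \<partial>lborel) = ennreal (\<bar>c\<bar> ^ DIM('a)) * (\<integral>\<^sup>+x. f (t + c *\<^sub>R x) \<partial>lborel)"
  by (subst lborel_affine[OF c, of t]) (simp add: nn_integral_density nn_integral_distr nn_integral_cmult)

lemma integrable_lborel_affine:
  fixes f :: "'a::euclidean_space \<Rightarrow> 'b::{banach, second_countable_topology}"
  assumes f: "integrable lborel f" and c: "c \<noteq> 0"
  shows "integrable lborel (\<lambda>x. f (t + c *\<^sub>R x))"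
proof -
  have [measurable]: "f \<in> borel_measurable borel" using f by auto
  show ?thesis
    using f nn_integral_lborel_affine[OF _ c, of "\<lambda>x. ennreal (norm (f x))" t] c
    by (auto simp: integrable_iff_bounded ennreal_mult_less_top)
qed

lemma integral_lborel_affine:
  fixes f :: "'a::euclidean_space \<Rightarrow> 'b::{banach, second_countable_topology}"
  assumes c: "c \<noteq> 0" and [measurable]: "f \<in> borel_measurable borel"
  shows "(\<integral>x. f x \<partial>lborel) = (\<bar>c\<bar> ^ DIM('a)) *\<^sub>R (\<integral>x. f (t + c *\<^sub>R x) \<partial>lborel)"
  by (subst lborel_affine[OF c, of t]) (simp add: integral_density integral_distr)

lemma nn_integral_lborel_shift:
  fixes t :: "'a::euclidean_space"
  assumes "f \<in> borel_measurable borel"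
  shows "(\<integral>\<^sup>+x. f (x + t) \<partial>lborel) = (\<integral>\<^sup>+x. f x \<partial>lborel)" "(\<integral>\<^sup>+x. f (t - x) \<partial>lborel) = (\<integral>\<^sup>+x. f x \<partial>lborel)"
  using nn_integral_lborel_affine[OF assms, of 1 t] nn_integral_lborel_affine[OF assms, of "-1" t]
  by (simp_all add: add.commute)

lemma integral_lborel_shift:
  fixes f :: "'a::euclidean_space \<Rightarrow> 'b::{banach, second_countable_topology}"
  assumes "f \<in> borel_measurable borel"
  shows "(\<integral>x. f (x + t) \<partial>lborel) = (\<integral>x. f x \<partial>lborel)" "(\<integral>x. f (t - x) \<partial>lborel) = (\<integral>x. f x \<partial>lborel)"
  using integral_lborel_affine[OF _ assms, of 1 t] integral_lborel_affine[OF _ assms, of "-1" t]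
  by (simp_all add: add.commute)

lemma integrable_lborel_shift:
  fixes f :: "'a::euclidean_space \<Rightarrow> 'b::{banach, second_countable_topology}"
  assumes "integrable lborel f"
  shows "integrable lborel (\<lambda>x. f (x + t))" "integrable lborel (\<lambda>x. f (t - x))"
proof -
  have "(\<lambda>x. f (x + t)) = (\<lambda>x. f (t + 1 *\<^sub>R x))" "(\<lambda>x. f (t - x)) = (\<lambda>x. f (t + (-1) *\<^sub>R x))"
    by (simp_all add: add.commute)
  then show "integrable lborel (\<lambda>x. f (x + t))" "integrable lborel (\<lambda>x. f (t - x))"
    using assms by (simp_all only: integrable_lborel_affine zero_neq_one neg_equal_0_iff_equal simp_thms)
qed

section \<open>A product weight\<close>

lemma prod_Basis_vec: "(\<Prod>b\<in>(Basis :: (real^'n::finite) set). F (x \<bullet> b)) = (\<Prod>i\<in>UNIV. F (x $ i))"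
proof -
  have "(Basis :: (real^'n) set) = (\<lambda>i. axis i 1) ` UNIV" by (auto simp: Basis_vec_def)
  then have "(\<Prod>b\<in>(Basis :: (real^'n) set). F (x \<bullet> b)) = (\<Prod>b\<in>(\<lambda>i. axis i 1) ` UNIV. F (x \<bullet> b))"
    by (rule arg_cong)
  also have "\<dots> = (\<Prod>i\<in>UNIV. F (x \<bullet> axis i 1))"
    by (subst prod.reindex) (auto simp: inj_def axis_eq_axis)
  finally show ?thesis by (simp add: inner_axis)
qed

text \<open>A product, so that its integrability reduces to dimension one. Its inverse is a
  polynomial, so that decay like \<open>wt\<close> can be read off from derivatives of the
  symbol.\<close>

definition wt :: "real^'n::finite \<Rightarrow> real" where
  "wt x = (\<Prod>i\<in>UNIV. inverse (1 + (x $ i)\<^sup>2))"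

lemma wt_pos [simp]: "wt x > 0"
  unfolding wt_def by (intro prod_pos) (simp add: add_pos_nonneg)

lemma wt_nonneg [simp]: "0 \<le> wt x"
  by (simp add: less_imp_le)

lemma wt_le_1: "wt x \<le> 1"
  unfolding wt_def by (intro prod_le_1) (simp add: inverse_le_1_iff add_pos_nonneg)

lemma continuous_on_wt: "continuous_on S wt"
  unfolding wt_def by (intro continuous_intros) (metis add_pos_nonneg less_irrefl zero_le_power2 zero_less_one)

lemma measurable_wt [measurable]: "wt \<in> borel_measurable borel"
  by (intro borel_measurable_continuous_onI continuous_on_wt)

text \<open>Peetre's inequality, with a factor 2 from each coordinate. It controls the tails of a
  smeared indicator function in the uniqueness theorem.\<close>

lemma wt_Peetre: "wt x * wt y \<le> 2 ^ CARD('n) * wt (x + y :: real^'n::finite)"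
proof -
  have "inverse (1 + a\<^sup>2) * inverse (1 + b\<^sup>2) \<le> 2 * inverse (1 + (a + b)\<^sup>2)" for a b :: real
  proof -
    have "1 + (a + b)\<^sup>2 \<le> 2 * ((1 + a\<^sup>2) * (1 + b\<^sup>2))"
      using sum_squares_bound[of a b] zero_le_square[of "a * b"]
      by (simp add: power2_eq_square algebra_simps)
    then have "inverse (2 * ((1 + a\<^sup>2) * (1 + b\<^sup>2))) \<le> inverse (1 + (a + b)\<^sup>2)"
      by (intro le_imp_inverse_le) (auto simp: add_pos_nonneg)
    then show ?thesis by simp
  qed
  then have "wt x * wt y \<le> (\<Prod>i\<in>UNIV. 2 * inverse (1 + ((x + y) $ i)\<^sup>2))"
    unfolding wt_def prod.distrib[symmetric] by (intro prod_mono) (auto simp: vector_add_component)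
  then show ?thesis by (simp add: wt_def prod.distrib)
qed

lemma wt_scale: assumes "\<bar>e\<bar> \<le> 1" shows "wt x \<le> wt (e *\<^sub>R x)"
proof -
  have "(e * a)\<^sup>2 \<le> a\<^sup>2" for a using assms by (simp add: power_mult_distrib mult_left_le_one_le abs_square_le_1)
  then show ?thesis unfolding wt_def
    by (intro prod_mono) (auto intro!: le_imp_inverse_le simp: add_pos_nonneg)
qed

lemma wt_lower: assumes "norm x \<le> R" shows "inverse (1 + R\<^sup>2) ^ CARD('n) \<le> wt (x :: real^'n::finite)"
proof -
  have "(x $ i)\<^sup>2 \<le> R\<^sup>2" for i
    using component_le_norm_cart[of x i] assms by (intro abs_le_square_iff[THEN iffD1]) linarith
  then have "(\<Prod>i\<in>(UNIV :: 'n set). inverse (1 + R\<^sup>2)) \<le> wt x"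
    unfolding wt_def by (intro prod_mono) (auto intro!: le_imp_inverse_le simp: add_pos_nonneg)
  then show ?thesis by simp
qed

lemma integrable_Cauchy_kernel: "integrable lborel (\<lambda>x::real. inverse (1 + x\<^sup>2))"
  using integrable_inverse_1_plus_square by (simp add: set_integrable_def einterval_def)

lemma integrable_wt: "integrable lborel (wt :: real^'n::finite \<Rightarrow> real)"
proof (rule integrableI_bounded)
  have "(\<integral>\<^sup>+x. ennreal (norm (wt (x :: real^'n))) \<partial>lborel)
      = (\<integral>\<^sup>+x. (\<Prod>b\<in>(Basis :: (real^'n) set). ennreal (inverse (1 + (x \<bullet> b)\<^sup>2))) \<partial>lborel)"
    unfolding prod_Basis_vec[where F = "\<lambda>t. ennreal (inverse (1 + t\<^sup>2))"]
    by (intro nn_integral_cong) (simp add: wt_def prod_ennreal prod_nonneg)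
  also have "\<dots> = (\<Prod>b\<in>(Basis :: (real^'n) set). (\<integral>\<^sup>+t. ennreal (inverse (1 + t\<^sup>2)) \<partial>lborel))"
    by (rule nn_integral_lborel_prod) auto
  also have "\<dots> < top"
    using integrable_Cauchy_kernel by (auto simp: integrable_iff_bounded ennreal_prod_eq_top power_less_top_ennreal)
  finally show "(\<integral>\<^sup>+x. ennreal (norm (wt (x :: real^'n))) \<partial>lborel) < \<infinity>" by simp
qed simp

section \<open>The Fourier transform of test functions\<close>

abbreviation mexp :: "real \<Rightarrow> complex" where
  "mexp t \<equiv> exp (- \<i> * complex_of_real t)"

text \<open>It carries no normalising factor and uses Borel measure; powers of 2 pi enter only
  through inversion and are cancelled in \<open>Bx\<close>.\<close>

definition FT :: "(real^'n::finite \<Rightarrow> complex) \<Rightarrow> real^'n \<Rightarrow> complex" where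
  "FT a x = (\<integral>\<xi>. a \<xi> * mexp (x \<bullet> \<xi>) \<partial>lborel)"

lemma norm_exp_i [simp]: "norm (mexp t) = 1" "norm (exp (- (\<i> * complex_of_real t))) = 1"
  "norm (iexp t) = 1"
  by (simp_all add: norm_exp_eq_Re)

lemma FT_bound: assumes "integrable lborel a" shows "norm (FT a x) \<le> (\<integral>\<xi>. norm (a \<xi>) \<partial>lborel)"
  unfolding FT_def using integral_norm_bound[of lborel "\<lambda>\<xi>. a \<xi> * mexp (x \<bullet> \<xi>)"]
  by (simp add: norm_mult)

lemma integrable_FT_integrand:
  assumes "integrable lborel a" shows "integrable lborel (\<lambda>\<xi>. a \<xi> * mexp (x \<bullet> \<xi>))"
  by (rule Bochner_Integration.integrable_bound[OF assms]) (use assms in \<open>auto simp: norm_mult\<close>)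

lemma test_function_coord: "test_function a \<Longrightarrow> test_function (\<lambda>\<xi>. - \<i> * complex_of_real (\<xi> $ i) * a \<xi>)"
  using test_function_mult[OF _ smooth_mult[OF smooth_const smooth_coord], of a "- \<i>" i]
  by (simp only: mult_ac)

text \<open>The candidate derivative is the transform of \<open>a\<close> times the linear term of
  the exponential. As \<open>a\<close> has bounded support, the Taylor remainder is quadratic in v,
  uniformly in the frequency.\<close>

lemma FT_has_derivative:
  fixes a :: "real^'n::finite \<Rightarrow> complex"
  assumes a: "test_function a"
  shows "(FT a has_derivative (\<lambda>v. \<Sum>i\<in>UNIV. (v $ i) *\<^sub>R FT (\<lambda>\<xi>. - \<i> * complex_of_real (\<xi> $ i) * a \<xi>) x)) (at x)"
    (is "(_ has_derivative ?D) _")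
proof -
  have [measurable]: "a \<in> borel_measurable borel" using a by measurable
  define e where "e \<xi> = mexp (x \<bullet> \<xi>)" for \<xi> :: "real^'n"
  obtain R where R: "\<And>\<xi>. a \<xi> \<noteq> 0 \<Longrightarrow> norm \<xi> \<le> R" using a unfolding test_function_def by blast
  \<comment> \<open>On the support of \<open>a\<close> one has |v . xi| <= |v| R; this gives the
    square of \<open>R\<close>. The Taylor factor 1/2 is dropped.\<close>
  define K where "K = (\<integral>\<xi>. R\<^sup>2 * norm (a \<xi>) \<partial>lborel)"
  have D: "?D v = (\<integral>\<xi>. - \<i> * complex_of_real (v \<bullet> \<xi>) * a \<xi> * e \<xi> \<partial>lborel)" for v
  proof -
    have "?D v = (\<Sum>i\<in>UNIV. (\<integral>\<xi>. (v $ i) *\<^sub>R (- \<i> * complex_of_real (\<xi> $ i) * a \<xi> * e \<xi>) \<partial>lborel))"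
      by (simp add: FT_def e_def)
    also have "\<dots> = (\<integral>\<xi>. (\<Sum>i\<in>UNIV. (v $ i) *\<^sub>R (- \<i> * complex_of_real (\<xi> $ i) * a \<xi> * e \<xi>)) \<partial>lborel)"
      unfolding e_def
      by (rule Bochner_Integration.integral_sum[symmetric])
        (intro integrable_scaleR_right integrable_FT_integrand test_function_integrable test_function_coord a)
    also have "\<dots> = (\<integral>\<xi>. - \<i> * complex_of_real (v \<bullet> \<xi>) * a \<xi> * e \<xi> \<partial>lborel)"
      by (intro Bochner_Integration.integral_cong refl)
        (simp add: inner_vec_def sum_distrib_left sum_distrib_right scaleR_conv_of_real mult_ac)
    finally show ?thesis .
  qed
  have bound: "norm (FT a (x + v) - FT a x - ?D v) \<le> K * (norm v)\<^sup>2" for v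
  proof -
    have int: "integrable lborel (\<lambda>\<xi>. - \<i> * complex_of_real (v \<bullet> \<xi>) * a \<xi> * e \<xi>)"
    proof (rule Bochner_Integration.integrable_bound)
      show "integrable lborel (\<lambda>\<xi>. (norm v * R) * norm (a \<xi>))"
        using test_function_integrable[OF a] by simp
      have "\<bar>v \<bullet> \<xi>\<bar> * norm (a \<xi>) \<le> norm v * R * norm (a \<xi>)" for \<xi>
      proof (cases "a \<xi> = 0")
        case False
        then have "\<bar>v \<bullet> \<xi>\<bar> \<le> norm v * R"
          using Cauchy_Schwarz_ineq2[of v \<xi>] mult_left_mono[OF R, of \<xi> "norm v"] by auto
        then show ?thesis by (simp add: mult_right_mono)
      qed simp
      then show "AE \<xi> in lborel. norm (- \<i> * complex_of_real (v \<bullet> \<xi>) * a \<xi> * e \<xi>) \<le> norm ((norm v * R) * norm (a \<xi>))"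
        by (auto simp: norm_mult e_def intro: order_trans[OF _ abs_ge_self])
    qed (unfold e_def, measurable)
    have "FT a (x + v) - FT a x - ?D v = (\<integral>\<xi>. a \<xi> * mexp ((x + v) \<bullet> \<xi>) - a \<xi> * e \<xi>
        - (- \<i> * complex_of_real (v \<bullet> \<xi>) * a \<xi> * e \<xi>) \<partial>lborel)"
      unfolding D unfolding FT_def e_def
      by (simp only: Bochner_Integration.integral_diff Bochner_Integration.integrable_diff int[unfolded e_def]
          integrable_FT_integrand[OF test_function_integrable[OF a]])
    also have "norm \<dots> \<le> (\<integral>\<xi>. (norm v)\<^sup>2 * (R\<^sup>2 * norm (a \<xi>)) \<partial>lborel)"
    proof (rule Bochner_Integration.integral_norm_bound_integral)
      show "integrable lborel (\<lambda>\<xi>. a \<xi> * mexp ((x + v) \<bullet> \<xi>) - a \<xi> * e \<xi>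
        - (- \<i> * complex_of_real (v \<bullet> \<xi>) * a \<xi> * e \<xi>))"
        unfolding e_def
        by (intro Bochner_Integration.integrable_diff int[unfolded e_def]
            integrable_FT_integrand[OF test_function_integrable[OF a]])
      show "integrable lborel (\<lambda>\<xi>. (norm v)\<^sup>2 * (R\<^sup>2 * norm (a \<xi>)))"
        using test_function_integrable[OF a] by simp
      fix \<xi>
      \<comment> \<open>The integrand is \<open>a \<xi> * e \<xi>\<close> times the exponential of
        -i(v . xi) minus its Taylor polynomial of degree one, which \<open>iexp_approx1\<close>
        estimates.\<close>
      have "a \<xi> * mexp ((x + v) \<bullet> \<xi>) - a \<xi> * e \<xi> - (- \<i> * complex_of_real (v \<bullet> \<xi>) * a \<xi> * e \<xi>)
          = a \<xi> * e \<xi> * (iexp (- (v \<bullet> \<xi>)) - (\<Sum>k\<le>1. (\<i> * (- (v \<bullet> \<xi>)))^k / fact k))"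
      proof -
        have "mexp ((x + v) \<bullet> \<xi>) = e \<xi> * iexp (- (v \<bullet> \<xi>))"
          unfolding e_def exp_add[symmetric] by (simp add: inner_add_left algebra_simps)
        then show ?thesis by (simp only:) (simp add: algebra_simps)
      qed
      also have "norm \<dots> \<le> norm (a \<xi>) * (\<bar>v \<bullet> \<xi>\<bar>\<^sup>2 / 2)"
      proof -
        have "norm (iexp (- (v \<bullet> \<xi>)) - (\<Sum>k\<le>1. (\<i> * (- (v \<bullet> \<xi>)))^k / fact k)) \<le> \<bar>v \<bullet> \<xi>\<bar>\<^sup>2 / 2"
          using iexp_approx1[of "- (v \<bullet> \<xi>)" 1] by (simp only: Suc_1 fact_2 abs_minus_cancel)
        then show ?thesis
          unfolding norm_mult[of "a \<xi> * e \<xi>"] norm_mult[of "a \<xi>"] unfolding e_def norm_exp_i mult_1_right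
          by (rule mult_left_mono) simp
      qed
      also have "\<dots> \<le> (norm v)\<^sup>2 * (R\<^sup>2 * norm (a \<xi>))"
      proof (cases "a \<xi> = 0")
        case False
        then have "\<bar>v \<bullet> \<xi>\<bar> \<le> norm v * R"
          using Cauchy_Schwarz_ineq2[of v \<xi>] mult_left_mono[OF R, of \<xi> "norm v"] by auto
        then have "\<bar>v \<bullet> \<xi>\<bar>\<^sup>2 \<le> (norm v * R)\<^sup>2" by (intro power_mono) auto
        then have "\<bar>v \<bullet> \<xi>\<bar>\<^sup>2 / 2 \<le> (norm v)\<^sup>2 * R\<^sup>2"
          using zero_le_power2[of "\<bar>v \<bullet> \<xi>\<bar>"] unfolding power_mult_distrib by linarith
        then have "norm (a \<xi>) * (\<bar>v \<bullet> \<xi>\<bar>\<^sup>2 / 2) \<le> norm (a \<xi>) * ((norm v)\<^sup>2 * R\<^sup>2)"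
          by (rule mult_left_mono) simp
        then show ?thesis by (simp only: mult_ac)
      qed simp
      finally show "norm (a \<xi> * mexp ((x + v) \<bullet> \<xi>) - a \<xi> * e \<xi>
        - (- \<i> * complex_of_real (v \<bullet> \<xi>) * a \<xi> * e \<xi>)) \<le> (norm v)\<^sup>2 * (R\<^sup>2 * norm (a \<xi>))" .
    qed
    finally show ?thesis by (simp add: K_def mult_ac)
  qed
  show ?thesis
    unfolding has_derivative_at
  proof
    show "bounded_linear ?D"
      by (rule bounded_linear_sum) (rule bounded_linear_scaleR_const[OF bounded_linear_vec_nth])
    define G where "G v = FT a (x + v) - FT a x - ?D v" for v
    have G: "norm (norm (G v) / norm v) \<le> K * norm v" if "v \<noteq> 0" for v
    proof -
      have "norm (G v) \<le> K * norm v * norm v"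
        using bound[of v] unfolding G_def power2_eq_square mult.assoc .
      then show ?thesis using that by (simp add: divide_le_eq)
    qed
    have "((\<lambda>v::real^'n. K * norm v) \<longlongrightarrow> 0) (at 0)"
      by (rule tendsto_mult_right_zero[OF tendsto_norm_zero[OF tendsto_ident_at]])
    then have "((\<lambda>v. norm (G v) / norm v) \<longlongrightarrow> 0) (at 0)"
      by (rule Lim_null_comparison[rotated]) (use G in \<open>auto simp: eventually_at_filter simp del: norm_divide\<close>)
    then show "(\<lambda>v. norm (FT a (x + v) - FT a x - ?D v) / norm v) \<midarrow>0\<rightarrow> 0"
      unfolding G_def .
  qed
qed

lemma partial_deriv_FT:
  assumes "test_function a"
  shows "partial_deriv i (FT a) = FT (\<lambda>\<xi>. - \<i> * complex_of_real (\<xi> $ i) * a \<xi>)"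
proof
  fix x
  have "partial_deriv i (FT a) x = (\<Sum>j\<in>UNIV. axis i 1 $ j *\<^sub>R FT (\<lambda>\<xi>. - \<i> * complex_of_real (\<xi> $ j) * a \<xi>) x)"
    by (rule partial_deriv_eq[OF FT_has_derivative[OF assms]])
  also have "\<dots> = FT (\<lambda>\<xi>. - \<i> * complex_of_real (\<xi> $ i) * a \<xi>) x"
    by (simp add: axis_def if_distrib[of "\<lambda>t. t *\<^sub>R _"] cong: if_cong)
  finally show "partial_deriv i (FT a) x = FT (\<lambda>\<xi>. - \<i> * complex_of_real (\<xi> $ i) * a \<xi>) x" .
qed

text \<open>Differentiation stays inside the class of transforms of test functions, so an iterated
  derivative inherits every property of the class without an explicit formula.\<close>

lemma partial_derivs_FT:
  assumes "test_function a" shows "\<exists>b. test_function b \<and> partial_derivs js (FT a) = FT b"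
proof (induction js)
  case Nil
  then show ?case using assms by auto
next
  case (Cons j js)
  then obtain b where "test_function b" "partial_derivs js (FT a) = FT b" by blast
  then show ?case
    using partial_deriv_FT[of b j] test_function_coord[of b j] by (auto simp only: partial_derivs_Cons)
qed

lemma smooth_FT: assumes "test_function a" shows "smooth (FT a)"
  unfolding smooth_def
proof (intro allI)
  fix js x
  obtain b where "test_function b" "partial_derivs js (FT a) = FT b"
    using partial_derivs_FT[OF assms] by blast
  then show "partial_derivs js (FT a) differentiable (at x)"
    using differentiableI[OF FT_has_derivative] by simp
qed

lemma FT_continuous_on: "test_function a \<Longrightarrow> continuous_on S (FT a)"
  by (intro smooth_continuous_on smooth_FT)

lemma FT_measurable: "test_function a \<Longrightarrow> FT a \<in> borel_measurable borel"
  by (intro borel_measurable_continuous_onI FT_continuous_on)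

section \<open>Integration by parts\<close>

text \<open>By translation invariance already the difference quotients have integral zero.\<close>

lemma integral_partial_deriv_zero:
  fixes b :: "real^'n::finite \<Rightarrow> complex"
  assumes b: "test_function b"
  shows "(\<integral>\<xi>. partial_deriv i b \<xi> \<partial>lborel) = 0"
proof -
  define e :: "real^'n" where "e = axis i 1"
  define c where "c = partial_deriv i b"
  have e: "norm e = 1" by (simp add: e_def)
  have c: "test_function c" unfolding c_def by (rule test_function_partial_deriv[OF b])
  obtain B where B: "\<And>x. norm (c x) \<le> B" using test_function_bounded[OF c] by blast
  obtain R where R: "\<And>\<xi>. b \<xi> \<noteq> 0 \<Longrightarrow> norm \<xi> \<le> R" using b unfolding test_function_def by blast
  have [measurable]: "b \<in> borel_measurable borel" "c \<in> borel_measurable borel" using b c by measurable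
  have Db: "(b has_derivative frechet_derivative b (at \<xi>)) (at \<xi>)" for \<xi>
    by (intro differentiable_has_derivative smooth_differentiable test_function_smooth b)
  have De: "frechet_derivative b (at \<xi>) (t *\<^sub>R e) = t *\<^sub>R c \<xi>" for \<xi> t
    using linear_cmul[OF has_derivative_linear[OF Db]] by (simp add: c_def partial_deriv_def e_def)
  \<comment> \<open>The mean value inequality bounds the difference quotients uniformly, since the
    partial derivative is itself a bounded test function.\<close>
  have lip: "norm (b (\<xi> + t *\<^sub>R e) - b \<xi>) \<le> B * \<bar>t\<bar>" for \<xi> t
  proof -
    have D: "((\<lambda>t. b (\<xi> + t *\<^sub>R e)) has_derivative (\<lambda>s. s *\<^sub>R c (\<xi> + t *\<^sub>R e))) (at t)" for t
    proof -
      have "((\<lambda>t. \<xi> + t *\<^sub>R e) has_derivative (\<lambda>s. s *\<^sub>R e)) (at t)"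
        by (auto intro!: derivative_eq_intros)
      from has_derivative_compose[OF this Db] show ?thesis by (simp add: De)
    qed
    have "norm (b (\<xi> + t *\<^sub>R e) - b (\<xi> + 0 *\<^sub>R e)) \<le> B * norm (t - 0)"
    proof (rule differentiable_bound[of UNIV "\<lambda>t. b (\<xi> + t *\<^sub>R e)" "\<lambda>t s. s *\<^sub>R c (\<xi> + t *\<^sub>R e)"])
      show "((\<lambda>t. b (\<xi> + t *\<^sub>R e)) has_derivative (\<lambda>s. s *\<^sub>R c (\<xi> + x *\<^sub>R e))) (at x within UNIV)" for x
        using D[of x] by simp
      show "onorm (\<lambda>s. s *\<^sub>R c (\<xi> + x *\<^sub>R e)) \<le> B" for x
        by (rule onorm_bound) (use B[of "\<xi> + x *\<^sub>R e"] order_trans[OF norm_ge_zero B] in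
            \<open>auto simp: mult.commute[of B] intro!: mult_left_mono\<close>)
    qed auto
    then show ?thesis by simp
  qed
  define s where "s n \<xi> = real (Suc n) *\<^sub>R (b (\<xi> + inverse (real (Suc n)) *\<^sub>R e) - b \<xi>)" for n \<xi>
  have [measurable]: "s n \<in> borel_measurable borel" for n unfolding s_def by measurable
  have lim: "(\<lambda>n. s n \<xi>) \<longlonglongrightarrow> c \<xi>" for \<xi>
  proof -
    define v where "v n = inverse (real (Suc n)) *\<^sub>R e" for n
    have nv: "norm (v n) = inverse (real (Suc n))" for n by (simp add: v_def e)
    have "v n \<noteq> 0" for n using nv[of n] by auto
    moreover have "v \<longlonglongrightarrow> 0"
      unfolding v_def using tendsto_scaleR[OF LIMSEQ_inverse_real_of_nat tendsto_const, of e] by simp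
    ultimately have v: "filterlim v (at 0) sequentially" by (simp add: filterlim_at)
    have "(\<lambda>h. norm (b (\<xi> + h) - b \<xi> - frechet_derivative b (at \<xi>) h) / norm h) \<midarrow>0\<rightarrow> 0"
      using Db[of \<xi>] unfolding has_derivative_at by blast
    from filterlim_compose[OF this v]
    have "(\<lambda>n. norm (b (\<xi> + v n) - b \<xi> - frechet_derivative b (at \<xi>) (v n)) / norm (v n)) \<longlonglongrightarrow> 0" .
    also have "(\<lambda>n. norm (b (\<xi> + v n) - b \<xi> - frechet_derivative b (at \<xi>) (v n)) / norm (v n)) = (\<lambda>n. norm (s n \<xi> - c \<xi>))"
    proof
      fix n
      have "s n \<xi> - c \<xi> = real (Suc n) *\<^sub>R (b (\<xi> + v n) - b \<xi> - frechet_derivative b (at \<xi>) (v n))"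
        unfolding v_def De s_def scaleR_diff_right scaleR_scaleR by simp
      then show "norm (b (\<xi> + v n) - b \<xi> - frechet_derivative b (at \<xi>) (v n)) / norm (v n) = norm (s n \<xi> - c \<xi>)"
        by (simp only: nv norm_scaleR divide_inverse inverse_inverse_eq abs_of_nat) (rule mult.commute)
    qed
    finally show ?thesis
      using tendsto_norm_zero_iff LIM_zero_iff by blast
  qed
  \<comment> \<open>The dominating function: shifts have length at most 1, so beyond radius
    \<open>R + 1\<close> both values of \<open>b\<close> in the quotient vanish.\<close>
  have bound: "norm (s n \<xi>) \<le> B * indicator (cball 0 (R + 1)) \<xi>" for n \<xi>
  proof (cases "norm \<xi> \<le> R + 1")
    case True
    have "real (Suc n) * norm (b (\<xi> + inverse (real (Suc n)) *\<^sub>R e) - b \<xi>) \<le> real (Suc n) * (B * \<bar>inverse (real (Suc n))\<bar>)"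
      by (intro mult_left_mono lip) simp
    also have "\<dots> = B" by simp
    finally show ?thesis using True by (simp add: s_def)
  next
    case False
    have "norm \<xi> \<le> norm (\<xi> + inverse (real (Suc n)) *\<^sub>R e) + norm (inverse (real (Suc n)) *\<^sub>R e)"
      by (metis add_diff_cancel_right' norm_triangle_ineq4)
    also have "norm (inverse (real (Suc n)) *\<^sub>R e) \<le> 1" by (simp add: e inverse_le_1_iff)
    finally have "\<not> norm (\<xi> + inverse (real (Suc n)) *\<^sub>R e) \<le> R" "\<not> norm \<xi> \<le> R" using False by auto
    then have "s n \<xi> = 0" unfolding s_def using R by (metis diff_self scaleR_zero_right)
    then show ?thesis using False by simp
  qed
  have "(\<lambda>n. \<integral>\<xi>. s n \<xi> \<partial>lborel) \<longlonglongrightarrow> (\<integral>\<xi>. c \<xi> \<partial>lborel)"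
  proof (rule integral_dominated_convergence[where w = "\<lambda>\<xi>. B * indicator (cball 0 (R + 1)) \<xi>"])
    show "integrable lborel (\<lambda>\<xi>::real^'n. B * indicator (cball 0 (R + 1)) \<xi>)"
      using emeasure_lborel_cball_finite by (intro integrable_mult_right integrable_real_indicator) auto
  qed (use lim bound in auto)
  moreover have "(\<integral>\<xi>. s n \<xi> \<partial>lborel) = 0" for n
    unfolding s_def using integral_lborel_shift(1)[of b] test_function_integrable[OF b]
    by (simp add: integrable_lborel_shift)
  ultimately have "(\<lambda>n. 0) \<longlonglongrightarrow> (\<integral>\<xi>. c \<xi> \<partial>lborel)" by simp
  from LIMSEQ_unique[OF this tendsto_const] show ?thesis by (simp add: c_def)
qed

text \<open>Integration by parts: \<open>a\<close> times the exponential is a test function, so its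
  derivative has integral zero, and the product rule splits that integral into the two
  sides.\<close>

lemma FT_partial_deriv:
  fixes a :: "real^'n::finite \<Rightarrow> complex"
  assumes a: "test_function a"
  shows "FT (partial_deriv i a) x = \<i> * complex_of_real (x $ i) * FT a x"
proof -
  define E where "E \<xi> = mexp (\<xi> \<bullet> x)" for \<xi> :: "real^'n"
  have E': "E \<xi> = mexp (x \<bullet> \<xi>)" for \<xi> by (simp add: E_def inner_commute)
  have test: "test_function (\<lambda>\<xi>. a \<xi> * E \<xi>)"
    unfolding E_def by (intro test_function_mult a smooth_exp_inner)
  have "partial_deriv i (\<lambda>\<xi>. a \<xi> * E \<xi>) \<xi> = partial_deriv i a \<xi> * E \<xi> - \<i> * complex_of_real (x $ i) * (a \<xi> * E \<xi>)" for \<xi>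
  proof -
    have "((\<lambda>\<xi>. 1 * E \<xi>) has_derivative (\<lambda>v. 1 * (- \<i>) * complex_of_real (v \<bullet> x) * E \<xi>)) (at \<xi>)"
      unfolding E_def by (rule has_derivative_exp_inner)
    then have "((\<lambda>\<xi>. a \<xi> * E \<xi>) has_derivative
        (\<lambda>v. a \<xi> * (1 * (- \<i>) * complex_of_real (v \<bullet> x) * E \<xi>) + frechet_derivative a (at \<xi>) v * E \<xi>)) (at \<xi>)"
      using has_derivative_mult[OF differentiable_has_derivative[OF smooth_differentiable[OF test_function_smooth[OF a]]]]
      by (simp only: mult_1_left)
    from partial_deriv_eq[OF this, of i] show ?thesis
      by (simp add: partial_deriv_def inner_axis' algebra_simps)
  qed
  then have "0 = (\<integral>\<xi>. partial_deriv i a \<xi> * E \<xi> - \<i> * complex_of_real (x $ i) * (a \<xi> * E \<xi>) \<partial>lborel)"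
    using integral_partial_deriv_zero[OF test, of i] by simp
  also have "\<dots> = FT (partial_deriv i a) x - \<i> * complex_of_real (x $ i) * FT a x"
    unfolding FT_def E'
    by (subst Bochner_Integration.integral_diff[OF
          integrable_FT_integrand[OF test_function_integrable[OF test_function_partial_deriv[OF a]]]
          integrable_mult_right[OF integrable_FT_integrand[OF test_function_integrable[OF a]]]]) simp
  finally show ?thesis by simp
qed

lemma FT_cmult: "FT (\<lambda>\<xi>. k * a \<xi>) x = k * FT a x"
  unfolding FT_def by (simp add: mult.assoc)

lemma FT_add: "integrable lborel a \<Longrightarrow> integrable lborel b \<Longrightarrow> FT (\<lambda>\<xi>. a \<xi> + b \<xi>) x = FT a x + FT b x"
  unfolding FT_def distrib_right by (intro Bochner_Integration.integral_add integrable_FT_integrand)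

lemma test_function_cmult: "test_function a \<Longrightarrow> test_function (\<lambda>\<xi>. k * a \<xi>)"
  using test_function_mult[OF _ smooth_const, of a k] by (simp only: mult.commute)

lemma coord_FT:
  assumes a: "test_function a"
  shows "\<exists>b. test_function b \<and> (\<forall>x. complex_of_real (x $ i) * FT a x = FT b x)"
proof (intro exI conjI allI)
  show "test_function (\<lambda>\<xi>. - \<i> * partial_deriv i a \<xi>)"
    by (intro test_function_cmult test_function_partial_deriv a)
  show "complex_of_real (x $ i) * FT a x = FT (\<lambda>\<xi>. - \<i> * partial_deriv i a \<xi>) x" for x
    unfolding FT_cmult FT_partial_deriv[OF a] by (simp add: mult.assoc[symmetric])
qed

lemma coord_power_FT:
  assumes a: "test_function a"
  shows "\<exists>b. test_function b \<and> (\<forall>x. complex_of_real ((x $ i) ^ m) * FT a x = FT b x)"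
proof (induction m)
  case 0
  show ?case using a by auto
next
  case (Suc m)
  then obtain b where b: "test_function b" "\<And>x. complex_of_real ((x $ i) ^ m) * FT a x = FT b x" by blast
  obtain c where "test_function c" "\<And>x. complex_of_real (x $ i) * FT b x = FT c x"
    using coord_FT[OF b(1)] by blast
  then show ?case using b(2) by (intro exI[of _ c]) (simp add: mult.assoc flip: b(2))
qed

text \<open>If each factor keeps the class of transforms of test functions, so does the product. The
  applications are monomials and the inverse of \<open>wt\<close>.\<close>

lemma prod_FT:
  fixes F :: "'n::finite \<Rightarrow> real^'n \<Rightarrow> real"
  assumes step: "\<And>i a. test_function a \<Longrightarrow> \<exists>b. test_function b \<and> (\<forall>x. complex_of_real (F i x) * FT a x = FT b x)"
    and a: "test_function a"
  shows "\<exists>b. test_function b \<and> (\<forall>x. complex_of_real (\<Prod>i\<in>UNIV. F i x) * FT a x = FT b x)"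
proof -
  have "\<exists>b. test_function b \<and> (\<forall>x. complex_of_real (\<Prod>i\<in>S. F i x) * FT a x = FT b x)" for S :: "'n set"
  proof (induction S rule: infinite_finite_induct)
    case (insert i S)
    then obtain b where b: "test_function b" "\<And>x. complex_of_real (\<Prod>i\<in>S. F i x) * FT a x = FT b x" by blast
    obtain c where "test_function c" "\<And>x. complex_of_real (F i x) * FT b x = FT c x"
      using step[OF b(1)] by blast
    then show ?case using insert by (intro exI[of _ c]) (simp add: mult.assoc flip: b(2))
  qed (use a in auto)
  then show ?thesis .
qed

text \<open>A monomial times a derivative of \<open>FT a\<close> is again the transform of a test
  function, and such a transform is bounded by the L^1 norm of its symbol.\<close>

lemma FT_schwartz:
  assumes a: "test_function a" shows "FT a \<in> schwartz"
  unfolding schwartz_def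
proof (intro CollectI conjI allI smooth_FT a)
  fix \<beta> :: "'a \<Rightarrow> nat" and js
  obtain b where b: "test_function b" "partial_derivs js (FT a) = FT b"
    using partial_derivs_FT[OF a] by blast
  obtain c where c: "test_function c" "\<And>x. complex_of_real (\<Prod>i\<in>UNIV. (x $ i) ^ \<beta> i) * FT b x = FT c x"
    using prod_FT[of "\<lambda>i x. (x $ i) ^ \<beta> i" b] coord_power_FT b(1) by blast
  then have "norm ((\<Prod>i\<in>UNIV. (x $ i) ^ \<beta> i) *\<^sub>R partial_derivs js (FT a) x) \<le> (\<integral>\<xi>. norm (c \<xi>) \<partial>lborel)" for x
    using FT_bound[OF test_function_integrable[OF c(1)], of x] by (simp only: scaleR_conv_of_real b(2))
  then show "bounded (range (\<lambda>x. (\<Prod>i\<in>UNIV. (x $ i) ^ \<beta> i) *\<^sub>R partial_derivs js (FT a) x))"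
    by (auto simp: bounded_iff)
qed

text \<open>Dividing by \<open>wt\<close> is multiplying by a polynomial, and this is done twice. Of
  the two factors \<open>wt\<close>, one secures integrability while the other is spent in Peetre's
  inequality.\<close>

lemma FT_decay:
  assumes a: "test_function a"
  obtains C where "C \<ge> 0" "\<And>x. norm (FT a x) \<le> C * (wt x)\<^sup>2"
proof -
  have step: "\<exists>c. test_function c \<and> (\<forall>x. complex_of_real (inverse (wt x)) * FT b x = FT c x)"
    if b: "test_function b" for b :: "real^'a \<Rightarrow> complex"
  proof -
    have "\<exists>c. test_function c \<and> (\<forall>x. complex_of_real (1 + (x $ i)\<^sup>2) * FT d x = FT c x)"
      if d: "test_function d" for i :: 'a and d
    proof -
      obtain c where c: "test_function c" "\<And>x. complex_of_real ((x $ i)\<^sup>2) * FT d x = FT c x"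
        using coord_power_FT[OF d] by blast
      show ?thesis
        by (intro exI[of _ "\<lambda>\<xi>. d \<xi> + c \<xi>"] conjI allI test_function_add d c)
          (use c in \<open>simp add: FT_add test_function_integrable d distrib_right\<close>)
    qed
    from prod_FT[of "\<lambda>i x. 1 + (x $ i)\<^sup>2", OF this b] show ?thesis
      by (simp add: wt_def prod_inversef[symmetric] o_def)
  qed
  obtain b where b: "test_function b" "\<And>x. complex_of_real (inverse (wt x)) * FT a x = FT b x" using step[OF a] by blast
  obtain c where c: "test_function c" "\<And>x. complex_of_real (inverse (wt x)) * FT b x = FT c x" using step[OF b(1)] by blast
  show thesis
  proof
    show "0 \<le> (\<integral>\<xi>. norm (c \<xi>) \<partial>lborel)" by simp
    fix x :: "real^'a"
    have w: "wt x \<noteq> 0" using wt_pos[of x] by linarith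
    have "FT a x = complex_of_real ((wt x)\<^sup>2) * FT c x"
      using w by (simp add: c(2)[symmetric] b(2)[symmetric] power2_eq_square field_simps)
    then have "norm (FT a x) = (wt x)\<^sup>2 * norm (FT c x)" by (simp add: norm_mult norm_power)
    also have "\<dots> \<le> (wt x)\<^sup>2 * (\<integral>\<xi>. norm (c \<xi>) \<partial>lborel)"
      by (intro mult_left_mono FT_bound test_function_integrable c) simp
    finally show "norm (FT a x) \<le> (\<integral>\<xi>. norm (c \<xi>) \<partial>lborel) * (wt x)\<^sup>2" by (simp add: mult.commute)
  qed
qed

lemma FT_integrable:
  fixes a :: "real^'n::finite \<Rightarrow> complex"
  assumes a: "test_function a" shows "integrable lborel (FT a)"
proof -
  obtain C where C: "C \<ge> 0" "\<And>x. norm (FT a x) \<le> C * (wt x)\<^sup>2" using FT_decay[OF a] by blast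
  show ?thesis
  proof (rule Bochner_Integration.integrable_bound)
    show "integrable lborel (\<lambda>x :: real^'n. C * wt x)" by (intro integrable_mult_right integrable_wt)
    have "norm (FT a x) \<le> norm (C * wt x)" for x
    proof -
      have "C * (wt x)\<^sup>2 \<le> C * wt x"
        unfolding power2_eq_square using C wt_le_1[of x] by (intro mult_left_mono mult_left_le) auto
      then show ?thesis using C(2)[of x] C(1) by (simp add: abs_mult less_imp_le)
    qed
    then show "AE x in lborel. norm (FT a x) \<le> norm (C * wt x)" by simp
  qed (use FT_measurable[OF a] in simp)
qed

section \<open>Fubini's theorem\<close>

lemma Fubini_swap:
  fixes f :: "'a \<Rightarrow> 'b \<Rightarrow> complex"
  assumes M: "sigma_finite_measure M" and N: "sigma_finite_measure N"
    and [measurable]: "(\<lambda>(x, y). f x y) \<in> borel_measurable (M \<Otimes>\<^sub>M N)"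
    and fin: "(\<integral>\<^sup>+x. \<integral>\<^sup>+y. ennreal (norm (f x y)) \<partial>N \<partial>M) < \<infinity>"
  shows "(\<integral>x. \<integral>y. f x y \<partial>N \<partial>M) = (\<integral>y. \<integral>x. f x y \<partial>M \<partial>N)"
proof -
  interpret M: sigma_finite_measure M by fact
  interpret N: sigma_finite_measure N by fact
  interpret pair_sigma_finite M N ..
  have "integrable (M \<Otimes>\<^sub>M N) (\<lambda>(x, y). f x y)"
  proof (rule integrableI_bounded)
    have "(\<integral>\<^sup>+z. ennreal (norm (case z of (x, y) \<Rightarrow> f x y)) \<partial>(M \<Otimes>\<^sub>M N))
        = (\<integral>\<^sup>+x. \<integral>\<^sup>+y. ennreal (norm (f x y)) \<partial>N \<partial>M)"
      by (subst N.nn_integral_fst[symmetric]) auto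
    then show "(\<integral>\<^sup>+z. ennreal (norm (case z of (x, y) \<Rightarrow> f x y)) \<partial>(M \<Otimes>\<^sub>M N)) < \<infinity>"
      using fin by simp
  qed simp
  then show ?thesis by (rule Fubini_integral[symmetric])
qed

lemma nn_integral_norm_finite:
  fixes f :: "'a \<Rightarrow> 'b::{banach, second_countable_topology}"
  shows "integrable M f \<Longrightarrow> (\<integral>\<^sup>+x. ennreal (norm (f x)) \<partial>M) < \<infinity>"
  by (simp add: integrable_iff_bounded)

lemma Fubini_swap_product_bound:
  fixes f :: "'a::euclidean_space \<Rightarrow> 'b::euclidean_space \<Rightarrow> complex"
    and u :: "'a \<Rightarrow> 'c::{banach, second_countable_topology}"
    and v :: "'b \<Rightarrow> 'd::{banach, second_countable_topology}"
  assumes [measurable]: "(\<lambda>(x, y). f x y) \<in> borel_measurable (borel \<Otimes>\<^sub>M borel)"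
    and u: "integrable lborel u" and v: "integrable lborel v"
    and le: "\<And>x y. norm (f x y) \<le> norm (u x) * norm (v y)"
  shows "(\<integral>x. \<integral>y. f x y \<partial>lborel \<partial>lborel) = (\<integral>y. \<integral>x. f x y \<partial>lborel \<partial>lborel)"
proof (rule Fubini_swap)
  have [measurable]: "u \<in> borel_measurable borel" "v \<in> borel_measurable borel" using u v by auto
  have "(\<integral>\<^sup>+x. \<integral>\<^sup>+y. ennreal (norm (f x y)) \<partial>lborel \<partial>lborel) \<le> (\<integral>\<^sup>+x. \<integral>\<^sup>+y. ennreal (norm (u x)) * ennreal (norm (v y)) \<partial>lborel \<partial>lborel)"
    using le by (intro nn_integral_mono) (simp add: ennreal_mult[symmetric])
  also have "\<dots> = (\<integral>\<^sup>+x. ennreal (norm (u x)) \<partial>lborel) * (\<integral>\<^sup>+y. ennreal (norm (v y)) \<partial>lborel)"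
    by (simp add: nn_integral_cmult nn_integral_multc)
  also have "\<dots> < \<infinity>"
    using nn_integral_norm_finite[OF u] nn_integral_norm_finite[OF v] by (simp add: ennreal_mult_less_top)
  finally show "(\<integral>\<^sup>+x. \<integral>\<^sup>+y. ennreal (norm (f x y)) \<partial>lborel \<partial>lborel) < \<infinity>" .
qed (auto intro: lborel.sigma_finite_measure_axioms)

section \<open>Fourier inversion\<close>

lemma integral_lborel_prod:
  fixes F :: "'a::euclidean_space \<Rightarrow> real \<Rightarrow> complex"
  assumes int: "\<And>b. b \<in> Basis \<Longrightarrow> integrable lborel (F b)"
  shows "(\<integral>x. (\<Prod>b\<in>Basis. F b (x \<bullet> b)) \<partial>lborel) = (\<Prod>b\<in>Basis. \<integral>t. F b t \<partial>lborel)"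
proof -
  interpret product_sigma_finite "\<lambda>_::'a. lborel :: real measure"
    by (simp add: product_sigma_finite_def lborel.sigma_finite_measure_axioms)
  have [measurable]: "F b \<in> borel_measurable borel" if "b \<in> Basis" for b using int[OF that] by auto
  have "(\<integral>x. (\<Prod>b\<in>Basis. F b (x \<bullet> b)) \<partial>lborel)
      = (\<integral>x. (\<Prod>b\<in>Basis. F b (x \<bullet> b)) \<partial>distr (\<Pi>\<^sub>M b\<in>Basis. lborel) borel (\<lambda>f. \<Sum>b\<in>Basis. f b *\<^sub>R b))"
    by (subst lborel_eq) (rule refl)
  also have "\<dots> = (\<integral>x. (\<Prod>b\<in>Basis. F b (x b)) \<partial>(\<Pi>\<^sub>M b\<in>Basis. lborel))"
    by (subst integral_distr) (auto intro!: Bochner_Integration.integral_cong prod.cong)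
  also have "\<dots> = (\<Prod>b\<in>Basis. \<integral>t. F b t \<partial>lborel)"
    by (rule product_integral_prod) (use int in auto)
  finally show ?thesis .
qed

section \<open>Gaussians and their Fourier transform\<close>

definition gauss :: "'a::euclidean_space \<Rightarrow> real" where
  "gauss x = exp (- (norm x)\<^sup>2 / 2)"

lemma gauss_bounds: "0 < gauss x" "gauss x \<le> 1"
  by (simp_all add: gauss_def)

lemma measurable_gauss [measurable]: "gauss \<in> borel_measurable borel"
  unfolding gauss_def by measurable

lemma gauss_prod: "gauss (x :: 'a::euclidean_space) = (\<Prod>b\<in>Basis. gauss (x \<bullet> b))"
proof -
  have "(norm x)\<^sup>2 = (\<Sum>b\<in>Basis. (x \<bullet> b)\<^sup>2)"
    unfolding power2_norm_eq_inner by (subst euclidean_inner) (simp add: power2_eq_square)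
  then have "- (norm x)\<^sup>2 / 2 = (\<Sum>b\<in>Basis. - (x \<bullet> b)\<^sup>2 / 2)"
    by (simp add: sum_divide_distrib sum_negf)
  then show ?thesis by (simp add: gauss_def exp_sum)
qed

lemma integrable_gauss_real: "integrable lborel (gauss :: real \<Rightarrow> real)"
proof -
  have "integrable lborel (\<lambda>x. sqrt (2 * pi) * std_normal_density x)"
    by (intro integrable_mult_right) simp
  also have "(\<lambda>x. sqrt (2 * pi) * std_normal_density x) = gauss"
    by (simp add: std_normal_density_def gauss_def fun_eq_iff)
  finally show ?thesis .
qed

text \<open>This is the characteristic function of the standard normal distribution at
  \<open>- s\<close>, freed of the normalisation of the density.\<close>

lemma gauss_fourier_real:
  "(\<integral>t. complex_of_real (gauss t) * mexp (s * t) \<partial>lborel) = complex_of_real (sqrt (2 * pi) * gauss s)"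
proof -
  have "complex_of_real (gauss s) = char std_normal_distribution (- s)"
    by (simp add: char_std_normal_distribution gauss_def)
  also have "\<dots> = (\<integral>t. std_normal_density t *\<^sub>R iexp (- s * t) \<partial>lborel)"
    unfolding char_def by (subst integral_density) auto
  also have "\<dots> = (\<integral>t. complex_of_real (1 / sqrt (2 * pi)) * (complex_of_real (gauss t) * mexp (s * t)) \<partial>lborel)"
    by (intro Bochner_Integration.integral_cong refl)
      (simp add: std_normal_density_def gauss_def scaleR_conv_of_real)
  also have "\<dots> = complex_of_real (1 / sqrt (2 * pi)) * (\<integral>t. complex_of_real (gauss t) * mexp (s * t) \<partial>lborel)"
    by simp
  finally show ?thesis by (simp add: field_simps)
qed

lemma gauss_fourier:
  "(\<integral>x. complex_of_real (gauss x) * mexp (y \<bullet> x) \<partial>lborel)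
    = complex_of_real (sqrt (2 * pi) ^ DIM('a) * gauss (y :: 'a::euclidean_space))"
proof -
  have "mexp (y \<bullet> x) = (\<Prod>b\<in>Basis. mexp ((y \<bullet> b) * (x \<bullet> b)))" for x
  proof -
    have "- \<i> * complex_of_real (y \<bullet> x) = (\<Sum>b\<in>Basis. - \<i> * complex_of_real ((y \<bullet> b) * (x \<bullet> b)))"
      by (subst euclidean_inner) (simp only: of_real_sum sum_distrib_left)
    then show ?thesis by (simp only: exp_sum finite_Basis)
  qed
  then have "(\<integral>x. complex_of_real (gauss x) * mexp (y \<bullet> x) \<partial>lborel)
      = (\<integral>x. (\<Prod>b\<in>Basis. complex_of_real (gauss (x \<bullet> b)) * mexp ((y \<bullet> b) * (x \<bullet> b))) \<partial>lborel)"
    by (subst gauss_prod) (simp only: prod.distrib of_real_prod)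
  also have "\<dots> = (\<Prod>b\<in>Basis. complex_of_real (sqrt (2 * pi) * gauss (y \<bullet> b)))"
  proof (subst integral_lborel_prod)
    show "complex_integrable lborel (\<lambda>t. complex_of_real (gauss t) * mexp ((y \<bullet> b) * t))" for b
      by (rule Bochner_Integration.integrable_bound[OF integrable_gauss_real]) (auto simp: norm_mult)
  qed (simp only: gauss_fourier_real)
  also have "\<dots> = complex_of_real (sqrt (2 * pi) ^ DIM('a) * gauss y)"
    by (subst (2) gauss_prod) (simp add: prod.distrib)
  finally show ?thesis .
qed

lemma integrable_gauss: "integrable lborel (gauss :: 'a::euclidean_space \<Rightarrow> real)"
proof (rule integrableI_bounded)
  have "(\<integral>\<^sup>+x. ennreal (norm (gauss (x :: 'a))) \<partial>lborel) = (\<integral>\<^sup>+x. (\<Prod>b\<in>(Basis :: 'a set). ennreal (gauss (x \<bullet> b))) \<partial>lborel)"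
  proof (intro nn_integral_cong)
    fix x :: 'a
    have "norm (gauss x) = gauss x" using gauss_bounds(1)[of x] by simp
    also have "ennreal (gauss x) = (\<Prod>b\<in>(Basis :: 'a set). ennreal (gauss (x \<bullet> b)))"
      by (subst prod_ennreal) (simp_all add: less_imp_le gauss_bounds flip: gauss_prod)
    finally show "ennreal (norm (gauss x)) = (\<Prod>b\<in>(Basis :: 'a set). ennreal (gauss (x \<bullet> b)))" .
  qed
  also have "\<dots> = (\<Prod>b\<in>(Basis :: 'a set). (\<integral>\<^sup>+t. ennreal (gauss (t :: real)) \<partial>lborel))"
    by (rule nn_integral_lborel_prod) auto
  also have "\<dots> < top"
    using nn_integral_norm_finite[OF integrable_gauss_real] gauss_bounds(1)[where 'a = real]
    by (auto simp: power_less_top_ennreal less_imp_le)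
  finally show "(\<integral>\<^sup>+x. ennreal (norm (gauss (x :: 'a))) \<partial>lborel) < \<infinity>" by simp
qed simp

lemma gauss_integral: "(\<integral>x. complex_of_real (gauss (x :: 'a)) \<partial>lborel) = complex_of_real (sqrt (2 * pi) ^ DIM('a::euclidean_space))"
  using gauss_fourier[of "0 :: 'a"] by (simp add: gauss_def)

text \<open>Convolving \<open>a\<close> with a dilated Gaussian amounts to multiplying \<open>FT a\<close> by a Gaussian.\<close>

lemma FT_inversion:
  fixes a :: "real^'n::finite \<Rightarrow> complex"
  assumes a: "test_function a"
  shows "(\<integral>x. FT a x * iexp (x \<bullet> \<xi>) \<partial>lborel) = complex_of_real ((2 * pi) ^ CARD('n)) * a \<xi>"
proof -
  define K where "K = complex_of_real (sqrt (2 * pi) ^ CARD('n))"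
  define g where "g x = complex_of_real (gauss x)" for x :: "real^'n"
  have [measurable]: "g \<in> borel_measurable borel" unfolding g_def by measurable
  have [measurable]: "a \<in> borel_measurable borel" "FT a \<in> borel_measurable borel"
    using test_function_measurable[OF a] FT_measurable[OF a] by auto
  have g: "integrable lborel g" unfolding g_def using integrable_gauss by (intro integrable_of_real)
  have ga: "integrable lborel (\<lambda>y. a (\<xi> + e *\<^sub>R y))" if "e \<noteq> 0" for e
    by (rule integrable_lborel_affine[OF test_function_integrable[OF a] that])
  have regularised: "K * (\<integral>y. a (\<xi> + e *\<^sub>R y) * g y \<partial>lborel)
      = (\<integral>x. g (e *\<^sub>R x) * (FT a x * iexp (x \<bullet> \<xi>)) \<partial>lborel)"
    if e: "e > 0" for e
  proof -
    have Kg: "K * g y = (\<integral>z. g z * mexp (y \<bullet> z) \<partial>lborel)" for y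
      unfolding K_def g_def gauss_fourier by simp
    have "K * (\<integral>y. a (\<xi> + e *\<^sub>R y) * g y \<partial>lborel) = (\<integral>y. a (\<xi> + e *\<^sub>R y) * (K * g y) \<partial>lborel)"
      by (subst integral_mult_right_zero[symmetric]) (simp only: mult_ac)
    also have "\<dots> = (\<integral>y. \<integral>z. a (\<xi> + e *\<^sub>R y) * (g z * mexp (y \<bullet> z)) \<partial>lborel \<partial>lborel)"
      unfolding Kg by simp
    also have "\<dots> = (\<integral>z. \<integral>y. a (\<xi> + e *\<^sub>R y) * (g z * mexp (y \<bullet> z)) \<partial>lborel \<partial>lborel)"
      by (rule Fubini_swap_product_bound[OF _ ga[of e] g]) (use e in \<open>auto simp: norm_mult\<close>)
    also have "\<dots> = (\<integral>z. g z * (\<integral>y. a (\<xi> + e *\<^sub>R y) * mexp (y \<bullet> z) \<partial>lborel) \<partial>lborel)"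
      by (subst integral_mult_right_zero[symmetric]) (simp only: mult_ac)
    \<comment> \<open>The substitution u = xi + e y turns the inner integral into
      \<open>FT a\<close> at z/e with Jacobian e^(-n). Passing to x = z/e afterwards removes the
      Jacobian again.\<close>
    also have "\<dots> = (\<integral>z. g z * ((FT a (inverse e *\<^sub>R z) * iexp ((inverse e *\<^sub>R z) \<bullet> \<xi>)) /\<^sub>R e ^ CARD('n)) \<partial>lborel)"
    proof (intro Bochner_Integration.integral_cong refl arg_cong2[of _ _ _ _ "(*)"])
      fix z :: "real^'n"
      define w where "w = inverse e *\<^sub>R z"
      have "FT a w * iexp (w \<bullet> \<xi>) = (\<integral>u. a u * mexp (w \<bullet> (u - \<xi>)) \<partial>lborel)"
        unfolding FT_def
        by (subst integral_mult_left_zero[symmetric])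
          (simp add: mult.assoc exp_add[symmetric] inner_diff_right algebra_simps)
      also have "\<dots> = e ^ CARD('n) *\<^sub>R (\<integral>y. a (\<xi> + e *\<^sub>R y) * mexp (w \<bullet> (e *\<^sub>R y)) \<partial>lborel)"
        using e by (subst integral_lborel_affine[of e _ \<xi>]) auto
      also have "(\<lambda>y. w \<bullet> (e *\<^sub>R y)) = (\<lambda>y. y \<bullet> z)"
        using e by (simp add: w_def inner_commute fun_eq_iff mult.assoc[symmetric])
      finally show "(\<integral>y. a (\<xi> + e *\<^sub>R y) * mexp (y \<bullet> z) \<partial>lborel)
          = (FT a w * iexp (w \<bullet> \<xi>)) /\<^sub>R e ^ CARD('n)"
        using e by simp
    qed
    also have "\<dots> = (\<integral>x. g (e *\<^sub>R x) * (FT a x * iexp (x \<bullet> \<xi>)) \<partial>lborel)"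
      using e by (subst integral_lborel_affine[of e _ 0]) (auto simp: scaleR_scaleR)
    finally show ?thesis .
  qed
  define e where "e n = inverse (real (Suc n))" for n
  have e: "e n > 0" "e \<longlonglongrightarrow> 0" for n
    unfolding e_def using LIMSEQ_inverse_real_of_nat by auto
  obtain B where B: "\<And>x. norm (a x) \<le> B" using test_function_bounded[OF a] by blast
  \<comment> \<open>The limit e -> 0 by dominated convergence: here because \<open>a\<close> is
    bounded and continuous and \<open>g\<close> integrable, on the other side because the Gaussian
    tends to 1 and \<open>FT a\<close> is integrable.\<close>
  have "(\<lambda>n. \<integral>y. a (\<xi> + e n *\<^sub>R y) * g y \<partial>lborel) \<longlonglongrightarrow> (\<integral>y. a \<xi> * g y \<partial>lborel)"
  proof (rule integral_dominated_convergence[where w = "\<lambda>y. B * norm (g y)"])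
    show "AE y in lborel. (\<lambda>n. a (\<xi> + e n *\<^sub>R y) * g y) \<longlonglongrightarrow> a \<xi> * g y"
    proof (intro AE_I2 tendsto_mult tendsto_const)
      fix y
      have "(\<lambda>n. \<xi> + e n *\<^sub>R y) \<longlonglongrightarrow> \<xi> + 0 *\<^sub>R y" by (intro tendsto_intros e)
      then show "(\<lambda>n. a (\<xi> + e n *\<^sub>R y)) \<longlonglongrightarrow> a \<xi>"
        using smooth_continuous_on[OF test_function_smooth[OF a], of UNIV]
        by (auto simp: continuous_on_eq_continuous_at intro!: isCont_tendsto_compose[of \<xi> a])
    qed
  qed (use g B in \<open>auto simp: norm_mult intro!: mult_right_mono\<close>)
  then have "(\<lambda>n. K * (\<integral>y. a (\<xi> + e n *\<^sub>R y) * g y \<partial>lborel)) \<longlonglongrightarrow> K * (\<integral>y. a \<xi> * g y \<partial>lborel)"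
    by (rule tendsto_mult_left)
  moreover have "(\<lambda>n. \<integral>x. g (e n *\<^sub>R x) * (FT a x * iexp (x \<bullet> \<xi>)) \<partial>lborel)
      \<longlonglongrightarrow> (\<integral>x. FT a x * iexp (x \<bullet> \<xi>) \<partial>lborel)"
  proof (rule integral_dominated_convergence[where w = "\<lambda>x. norm (FT a x)"])
    show "AE x in lborel. (\<lambda>n. g (e n *\<^sub>R x) * (FT a x * iexp (x \<bullet> \<xi>)))
        \<longlonglongrightarrow> FT a x * iexp (x \<bullet> \<xi>)"
    proof (intro AE_I2)
      fix x :: "real^'n"
      have "(\<lambda>n. complex_of_real (exp (- (norm (e n *\<^sub>R x))\<^sup>2 / 2))) \<longlonglongrightarrow> complex_of_real (exp (- (norm (0 *\<^sub>R x))\<^sup>2 / 2))"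
        by (intro tendsto_intros e) simp
      then have "(\<lambda>n. g (e n *\<^sub>R x)) \<longlonglongrightarrow> 1" by (simp add: g_def gauss_def)
      from tendsto_mult[OF this tendsto_const]
      show "(\<lambda>n. g (e n *\<^sub>R x) * (FT a x * iexp (x \<bullet> \<xi>))) \<longlonglongrightarrow> FT a x * iexp (x \<bullet> \<xi>)"
        by simp
    qed
    have "norm (g x) \<le> 1" for x
      using gauss_bounds[of x] by (simp add: g_def)
    then show "AE x in lborel. norm (g (e n *\<^sub>R x) * (FT a x * iexp (x \<bullet> \<xi>))) \<le> norm (FT a x)" for n
      by (auto simp: norm_mult intro!: mult_left_le_one_le)
  qed (use FT_integrable[OF a] in auto)
  ultimately have A: "K * (\<integral>y. a \<xi> * g y \<partial>lborel) = (\<integral>x. FT a x * iexp (x \<bullet> \<xi>) \<partial>lborel)"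
    unfolding regularised[OF e(1)] by (rule LIMSEQ_unique)
  have B: "(\<integral>y. a \<xi> * g y \<partial>lborel) = a \<xi> * K"
  proof -
    have "(\<integral>y. g y \<partial>lborel) = K"
      unfolding g_def K_def gauss_integral by simp
    then show ?thesis by simp
  qed
  have C: "K * K = complex_of_real ((2 * pi) ^ CARD('n))"
    by (simp only: K_def of_real_mult[symmetric] power_mult_distrib[symmetric] real_sqrt_mult_self) simp
  show ?thesis
    unfolding A[symmetric] B C[symmetric] by (simp only: mult_ac)
qed

section \<open>Convolutions of band-limited kernels\<close>

text \<open>The multiplication formula: Fubini's theorem moves the transform from the kernel to
  \<open>g\<close>, and the translation by \<open>x\<close> becomes a modulation.\<close>

lemma integral_FT_mult:
  fixes a g :: "real^'n::finite \<Rightarrow> complex"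
  assumes a: "test_function a" and g: "integrable lborel g"
  shows "(\<integral>y. FT a (y - x) * g y \<partial>lborel) = (\<integral>\<xi>. a \<xi> * iexp (x \<bullet> \<xi>) * FT g \<xi> \<partial>lborel)"
proof -
  have [measurable]: "a \<in> borel_measurable borel" "g \<in> borel_measurable borel"
    using test_function_measurable[OF a] g by auto
  have "(\<integral>y. FT a (y - x) * g y \<partial>lborel)
      = (\<integral>y. \<integral>\<xi>. a \<xi> * mexp ((y - x) \<bullet> \<xi>) * g y \<partial>lborel \<partial>lborel)"
    unfolding FT_def by simp
  also have "\<dots> = (\<integral>\<xi>. \<integral>y. a \<xi> * mexp ((y - x) \<bullet> \<xi>) * g y \<partial>lborel \<partial>lborel)"
    by (rule Fubini_swap_product_bound[OF _ g test_function_integrable[OF a]]) (auto simp: norm_mult)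
  also have "\<dots> = (\<integral>\<xi>. \<integral>y. (a \<xi> * iexp (x \<bullet> \<xi>)) * (g y * mexp (\<xi> \<bullet> y)) \<partial>lborel \<partial>lborel)"
    by (intro Bochner_Integration.integral_cong refl)
      (simp add: inner_diff_left inner_commute algebra_simps exp_add[symmetric] exp_diff)
  also have "\<dots> = (\<integral>\<xi>. a \<xi> * iexp (x \<bullet> \<xi>) * FT g \<xi> \<partial>lborel)"
    unfolding FT_def by (subst integral_mult_right_zero) (rule refl)
  finally show ?thesis .
qed

text \<open>Fourier inversion after the reflection y -> z - y, which supplies the sign in the
  exponent and the modulation by z.\<close>

lemma FT_FT:
  fixes b :: "real^'n::finite \<Rightarrow> complex"
  assumes b: "test_function b"
  shows "FT (\<lambda>y. FT b (z - y)) \<xi> = complex_of_real ((2 * pi) ^ CARD('n)) * b \<xi> * mexp (z \<bullet> \<xi>)"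
proof -
  have [measurable]: "FT b \<in> borel_measurable borel" by (rule FT_measurable[OF b])
  have "FT (\<lambda>y. FT b (z - y)) \<xi> = (\<integral>y. FT b y * mexp (\<xi> \<bullet> (z - y)) \<partial>lborel)"
    unfolding FT_def[of "\<lambda>y. FT b (z - y)"]
    using integral_lborel_shift(2)[of "\<lambda>y. FT b y * mexp (\<xi> \<bullet> (z - y))" z] by simp
  also have "\<dots> = (\<integral>y. mexp (z \<bullet> \<xi>) * (FT b y * iexp (y \<bullet> \<xi>)) \<partial>lborel)"
    by (intro Bochner_Integration.integral_cong refl)
      (simp add: inner_diff_right inner_commute algebra_simps exp_add[symmetric])
  also have "\<dots> = mexp (z \<bullet> \<xi>) * (complex_of_real ((2 * pi) ^ CARD('n)) * b \<xi>)"
    by (subst integral_mult_right_zero) (simp only: FT_inversion[OF b])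
  finally show ?thesis by (simp only: mult_ac)
qed

text \<open>The multiplication formula leaves the transform of the second kernel, which inversion
  evaluates. Composition of multipliers thus multiplies symbols.\<close>

lemma FT_convolution:
  fixes a b :: "real^'n::finite \<Rightarrow> complex"
  assumes a: "test_function a" and b: "test_function b"
  shows "(\<integral>y. FT a (y - x) * FT b (z - y) \<partial>lborel)
    = complex_of_real ((2 * pi) ^ CARD('n)) * FT (\<lambda>\<xi>. a \<xi> * b \<xi>) (z - x)"
proof -
  have "(\<integral>y. FT a (y - x) * FT b (z - y) \<partial>lborel)
      = (\<integral>\<xi>. a \<xi> * iexp (x \<bullet> \<xi>) * FT (\<lambda>y. FT b (z - y)) \<xi> \<partial>lborel)"
    by (intro integral_FT_mult a integrable_lborel_shift FT_integrable b)
  also have "\<dots> = (\<integral>\<xi>. complex_of_real ((2 * pi) ^ CARD('n)) * ((a \<xi> * b \<xi>) * mexp ((z - x) \<bullet> \<xi>)) \<partial>lborel)"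
    by (intro Bochner_Integration.integral_cong refl)
      (simp add: FT_FT[OF b] inner_diff_left algebra_simps exp_diff exp_minus field_simps)
  also have "\<dots> = complex_of_real ((2 * pi) ^ CARD('n)) * FT (\<lambda>\<xi>. a \<xi> * b \<xi>) (z - x)"
    unfolding FT_def by (rule integral_mult_right_zero)
  finally show ?thesis .
qed

lemma FT_reflect:
  fixes b :: "real^'n::finite \<Rightarrow> complex"
  assumes b: "test_function b" shows "FT (\<lambda>\<xi>. b (- \<xi>)) x = FT b (- x)"
proof -
  have [measurable]: "b \<in> borel_measurable borel" using test_function_measurable[OF b] .
  show ?thesis
    unfolding FT_def
    using integral_lborel_shift(2)[of "\<lambda>\<xi>. b (- \<xi>) * mexp (x \<bullet> \<xi>)" 0] by simp
qed

text \<open>The product of functions with spectra in the supports of \<open>b\<close> and \<open>c\<close> has its spectrum in the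
  sum of these supports.\<close>

lemma FT_triple_zero:
  fixes a b c :: "real^'n::finite \<Rightarrow> complex"
  assumes a: "test_function a" and b: "test_function b" and c: "test_function c"
    and zero: "\<And>\<xi> \<eta>. a \<xi> * b \<eta> * c (\<xi> - \<eta>) = 0"
  shows "(\<integral>y. FT a (y - x) * (FT b (z - y) * FT c (w - y)) \<partial>lborel) = 0"
proof -
  have b': "test_function (\<lambda>\<eta>. b (- \<eta>))"
    using test_function_affine[OF b, of "-1" 0] by simp
  have [measurable]: "FT b \<in> borel_measurable borel" "FT c \<in> borel_measurable borel"
    using FT_measurable b c by blast+
  have intc: "integrable lborel (\<lambda>y. FT c (w - y))"
    by (rule integrable_lborel_shift(2)[OF FT_integrable[OF c]])
  have int: "integrable lborel (\<lambda>y. FT b (z - y) * FT c (w - y))"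
    by (rule Bochner_Integration.integrable_bound[OF
          integrable_mult_right[OF integrable_norm[OF intc], of "\<integral>\<xi>. norm (b \<xi>) \<partial>lborel"]])
      (use FT_bound[OF test_function_integrable[OF b]] in \<open>auto simp: norm_mult intro!: mult_right_mono\<close>)
  \<comment> \<open>The transform of a product as a convolution of transforms. The symbol
    \<open>b\<close> is reflected to bring \<open>FT b (z - y)\<close> into the form required by the
    multiplication formula.\<close>
  have FT_product: "FT (\<lambda>y. FT b (z - y) * FT c (w - y)) \<xi>
      = (\<integral>\<eta>. b (- \<eta>) * iexp (z \<bullet> \<eta>) * FT (\<lambda>y. FT c (w - y)) (\<xi> + \<eta>) \<partial>lborel)" for \<xi>
  proof -
    define g where "g y = FT c (w - y) * mexp (\<xi> \<bullet> y)" for y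
    have g: "integrable lborel g"
      unfolding g_def by (rule integrable_FT_integrand[OF intc])
    have "FT (\<lambda>y. FT b (z - y) * FT c (w - y)) \<xi> = (\<integral>y. FT (\<lambda>\<eta>. b (- \<eta>)) (y - z) * g y \<partial>lborel)"
      unfolding FT_reflect[OF b] g_def FT_def[of "\<lambda>y. FT b (z - y) * FT c (w - y)"] by (simp add: mult.assoc)
    also have "\<dots> = (\<integral>\<eta>. b (- \<eta>) * iexp (z \<bullet> \<eta>) * FT g \<eta> \<partial>lborel)"
      by (rule integral_FT_mult[OF b' g])
    also have "FT g = (\<lambda>\<eta>. FT (\<lambda>y. FT c (w - y)) (\<xi> + \<eta>))"
    proof
      fix \<eta>
      have "mexp (\<xi> \<bullet> y) * mexp (\<eta> \<bullet> y)
          = mexp ((\<xi> + \<eta>) \<bullet> y)" for y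
        unfolding exp_add[symmetric] by (simp add: inner_add_left algebra_simps)
      then show "FT g \<eta> = FT (\<lambda>y. FT c (w - y)) (\<xi> + \<eta>)"
        unfolding FT_def[of g] FT_def[of "\<lambda>y. FT c (w - y)"] g_def mult.assoc by simp
    qed
    finally show ?thesis .
  qed
  \<comment> \<open>By \<open>FT_FT\<close> the last factor is a multiple of
    \<open>c (\<xi> + \<eta>)\<close>, so \<open>zero\<close> applies with the second variable
    negated.\<close>
  have "a \<xi> * (b (- \<eta>) * K * FT (\<lambda>y. FT c (w - y)) (\<xi> + \<eta>)) = 0" for \<xi> \<eta> K
    using zero[of \<xi> "- \<eta>"] by (auto simp: FT_FT[OF c])
  then have "a \<xi> * FT (\<lambda>y. FT b (z - y) * FT c (w - y)) \<xi> = 0" for \<xi>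
    unfolding FT_product integral_mult_right_zero[symmetric] by (simp only: integral_zero)
  then have "a \<xi> * K * FT (\<lambda>y. FT b (z - y) * FT c (w - y)) \<xi> = 0" for \<xi> K
    by (metis mult.commute mult.left_commute mult_zero_right)
  then show ?thesis
    unfolding integral_FT_mult[OF a int] by (simp only: integral_zero)
qed

section \<open>Fourier multipliers\<close>

text \<open>A common domain for all Fourier multipliers: it contains every \<open>L\<^sup>p\<close> space.\<close>

definition uloc :: "(real^'n::finite \<Rightarrow> complex) \<Rightarrow> bool" where
  "uloc f \<longleftrightarrow> f \<in> borel_measurable borel \<and>
     (\<exists>C::real. \<forall>x. (\<integral>\<^sup>+y. ennreal (norm (f y) * wt (y - x)) \<partial>lborel) \<le> ennreal C)"

text \<open>Up to the factor \<open>(2\<pi>)\<^sup>n\<close>, this is the Fourier multiplier with symbol \<open>a\<close>.\<close>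

definition filt :: "(real^'n::finite \<Rightarrow> complex) \<Rightarrow> (real^'n \<Rightarrow> complex) \<Rightarrow> real^'n \<Rightarrow> complex" where
  "filt a f x = (\<integral>y. f y * FT a (y - x) \<partial>lborel)"

lemma uloc_measurable: "uloc f \<Longrightarrow> f \<in> borel_measurable borel"
  by (simp add: uloc_def)

lemma FT_bound_wt:
  assumes "test_function a"
  obtains C where "C \<ge> 0" "\<And>x. norm (FT a x) \<le> C * wt x"
proof -
  obtain C where C: "C \<ge> 0" "\<And>x. norm (FT a x) \<le> C * (wt x)\<^sup>2" using FT_decay[OF assms] by blast
  have "C * (wt x)\<^sup>2 \<le> C * wt x" for x :: "real^'a"
    unfolding power2_eq_square using C wt_le_1[of x] by (intro mult_left_mono mult_left_le) auto
  then show thesis using that C by (meson order_trans)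
qed

lemma uloc_nn_bound:
  assumes f: "uloc f" and a: "test_function a"
  obtains C :: real where "C \<ge> 0" "\<And>x. (\<integral>\<^sup>+y. ennreal (norm (f y) * norm (FT a (y - x))) \<partial>lborel) \<le> ennreal C"
proof -
  have [measurable]: "f \<in> borel_measurable borel" by (rule uloc_measurable[OF f])
  obtain C where C: "\<And>x. (\<integral>\<^sup>+y. ennreal (norm (f y) * wt (y - x)) \<partial>lborel) \<le> ennreal C"
    using f unfolding uloc_def by blast
  obtain K where K: "K \<ge> 0" "\<And>x. norm (FT a x) \<le> K * wt x" using FT_bound_wt[OF a] by blast
  have "(\<integral>\<^sup>+y. ennreal (norm (f y) * norm (FT a (y - x))) \<partial>lborel) \<le> ennreal (K * max C 0)" for x
  proof -
    have "(\<integral>\<^sup>+y. ennreal (norm (f y) * norm (FT a (y - x))) \<partial>lborel)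
        \<le> (\<integral>\<^sup>+y. ennreal K * ennreal (norm (f y) * wt (y - x)) \<partial>lborel)"
    proof (rule nn_integral_mono)
      fix y
      have "norm (f y) * norm (FT a (y - x)) \<le> norm (f y) * (K * wt (y - x))"
        by (intro mult_left_mono K) simp
      then show "ennreal (norm (f y) * norm (FT a (y - x))) \<le> ennreal K * ennreal (norm (f y) * wt (y - x))"
        using K by (simp add: ennreal_mult[symmetric] mult_ac)
    qed
    also have "\<dots> = ennreal K * (\<integral>\<^sup>+y. ennreal (norm (f y) * wt (y - x)) \<partial>lborel)"
      by (rule nn_integral_cmult) simp
    also have "\<dots> \<le> ennreal K * ennreal (max C 0)"
      by (intro mult_left_mono order_trans[OF C]) auto
    finally show ?thesis using K by (simp add: ennreal_mult)
  qed
  then show thesis using that[of "K * max C 0"] K by simp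
qed

lemma filt_integrable:
  assumes f: "uloc f" and a: "test_function a"
  shows "integrable lborel (\<lambda>y. f y * FT a (y - x))"
proof (rule integrableI_bounded)
  have [measurable]: "f \<in> borel_measurable borel" "FT a \<in> borel_measurable borel"
    using uloc_measurable[OF f] FT_measurable[OF a] by auto
  show "(\<lambda>y. f y * FT a (y - x)) \<in> borel_measurable lborel" by measurable
  obtain C where "\<And>x. (\<integral>\<^sup>+y. ennreal (norm (f y) * norm (FT a (y - x))) \<partial>lborel) \<le> ennreal C"
    using uloc_nn_bound[OF f a] by blast
  from order_le_less_trans[OF this ennreal_less_top]
  show "(\<integral>\<^sup>+y. ennreal (norm (f y * FT a (y - x))) \<partial>lborel) < \<infinity>" by (simp add: norm_mult)
qed

lemma filt_measurable:
  assumes f: "uloc f" and a: "test_function a"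
  shows "filt a f \<in> borel_measurable borel"
proof -
  have [measurable]: "f \<in> borel_measurable borel" "FT a \<in> borel_measurable borel"
    using uloc_measurable[OF f] FT_measurable[OF a] by auto
  have "(\<lambda>x. \<integral>y. f y * FT a (y - x) \<partial>lborel) \<in> borel_measurable lborel"
    by (rule lborel.borel_measurable_lebesgue_integral) measurable
  then show ?thesis by (simp add: filt_def[abs_def])
qed

lemma norm_filt_le:
  assumes f: "uloc f" and a: "test_function a"
  shows "ennreal (norm (filt a f x)) \<le> (\<integral>\<^sup>+y. ennreal (norm (f y) * norm (FT a (y - x))) \<partial>lborel)"
  unfolding filt_def using integral_norm_bound_ennreal[OF filt_integrable[OF f a]] by (simp add: norm_mult)

lemma filt_bounded:
  assumes f: "uloc f" and a: "test_function a"
  obtains C where "\<And>x. norm (filt a f x) \<le> C"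
proof -
  obtain C where C: "C \<ge> 0" "\<And>x. (\<integral>\<^sup>+y. ennreal (norm (f y) * norm (FT a (y - x))) \<partial>lborel) \<le> ennreal C"
    using uloc_nn_bound[OF f a] by blast
  have "norm (filt a f x) \<le> C" for x
    using order_trans[OF norm_filt_le[OF f a] C(2)] C(1) by (simp add: ennreal_le_iff)
  then show thesis using that by blast
qed

lemma nn_integral_wt_shift:
  "(\<integral>\<^sup>+y. ennreal (wt (y - x :: real^'n::finite)) \<partial>lborel) = (\<integral>\<^sup>+y. ennreal (wt (y :: real^'n)) \<partial>lborel)"
  using nn_integral_lborel_shift(1)[of "\<lambda>y. ennreal (wt y)" "- x"] by simp

lemma nn_integral_wt: "(\<integral>\<^sup>+y. ennreal (wt (y :: real^'n::finite)) \<partial>lborel) = ennreal (\<integral>y. wt (y :: real^'n) \<partial>lborel)"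
  by (rule nn_integral_eq_integral[OF integrable_wt]) simp

lemma uloc_bounded:
  assumes [measurable]: "f \<in> borel_measurable borel" and C: "\<And>x. norm (f x) \<le> C"
  shows "uloc f"
proof -
  have "(\<integral>\<^sup>+y. ennreal (norm (f y) * wt (y - x)) \<partial>lborel) \<le> (\<integral>\<^sup>+y. ennreal C * ennreal (wt (y - x)) \<partial>lborel)" for x
    using C order_trans[OF norm_ge_zero C]
    by (intro nn_integral_mono) (simp add: ennreal_mult[symmetric] mult_right_mono)
  also have "(\<integral>\<^sup>+y. ennreal C * ennreal (wt (y - x)) \<partial>lborel) = ennreal (C * (\<integral>y. wt (y :: real^'a) \<partial>lborel))" for x :: "real^'a"
  proof -
    have "(\<integral>\<^sup>+y. ennreal C * ennreal (wt (y - x)) \<partial>lborel) = ennreal C * ennreal (\<integral>y. wt (y :: real^'a) \<partial>lborel)"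
      by (subst nn_integral_cmult) (simp_all add: nn_integral_wt_shift nn_integral_wt)
    then show ?thesis using order_trans[OF norm_ge_zero C] by (simp add: ennreal_mult)
  qed
  finally show ?thesis using assms(1) unfolding uloc_def by blast
qed

lemma uloc_diff:
  assumes f: "uloc f" and g: "uloc g" shows "uloc (\<lambda>x. f x - g x)"
proof -
  have [measurable]: "f \<in> borel_measurable borel" "g \<in> borel_measurable borel"
    using uloc_measurable f g by blast+
  obtain C where C: "\<And>x. (\<integral>\<^sup>+y. ennreal (norm (f y) * wt (y - x)) \<partial>lborel) \<le> ennreal C"
    using f unfolding uloc_def by blast
  obtain D where D: "\<And>x. (\<integral>\<^sup>+y. ennreal (norm (g y) * wt (y - x)) \<partial>lborel) \<le> ennreal D"
    using g unfolding uloc_def by blast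
  have "(\<integral>\<^sup>+y. ennreal (norm (f y - g y) * wt (y - x)) \<partial>lborel) \<le> ennreal (max C 0 + max D 0)" for x
  proof -
    have "(\<integral>\<^sup>+y. ennreal (norm (f y - g y) * wt (y - x)) \<partial>lborel)
        \<le> (\<integral>\<^sup>+y. ennreal (norm (f y) * wt (y - x)) + ennreal (norm (g y) * wt (y - x)) \<partial>lborel)"
      by (intro nn_integral_mono)
        (simp add: ennreal_plus[symmetric] distrib_right[symmetric] mult_right_mono norm_triangle_ineq4 del: ennreal_plus)
    also have "\<dots> \<le> ennreal (max C 0) + ennreal (max D 0)"
      by (subst nn_integral_add) (auto intro!: add_mono order_trans[OF C] order_trans[OF D])
    also have "\<dots> = ennreal (max C 0 + max D 0)" by simp
    finally show ?thesis .
  qed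
  then show ?thesis unfolding uloc_def by (intro conjI exI[of _ "max C 0 + max D 0"]) auto
qed

lemma filt_diff: "uloc f \<Longrightarrow> uloc g \<Longrightarrow> test_function a \<Longrightarrow> filt a (\<lambda>x. f x - g x) x = filt a f x - filt a g x"
  unfolding filt_def left_diff_distrib by (intro Bochner_Integration.integral_diff filt_integrable)

lemma filt_cmult: "filt a (\<lambda>x. k * f x) x = k * filt a f x"
  unfolding filt_def mult.assoc by (rule integral_mult_right_zero)

text \<open>The transpose of a multiplier is convolution of \<open>\<phi>\<close> with the reflected
  kernel. Absolute convergence comes from the bound in \<open>uloc_nn_bound\<close>, which is
  uniform in the centre.\<close>

lemma filt_pairing:
  assumes f: "uloc f" and a: "test_function a" and \<phi>: "integrable lborel \<phi>"
  shows "(\<integral>y. filt a f y * \<phi> y \<partial>lborel) = (\<integral>x. f x * (\<integral>y. FT a (x - y) * \<phi> y \<partial>lborel) \<partial>lborel)"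
proof -
  have [measurable]: "f \<in> borel_measurable borel" "FT a \<in> borel_measurable borel" "\<phi> \<in> borel_measurable borel"
    using uloc_measurable[OF f] FT_measurable[OF a] \<phi> by auto
  obtain C where C: "C \<ge> 0" "\<And>x. (\<integral>\<^sup>+y. ennreal (norm (f y) * norm (FT a (y - x))) \<partial>lborel) \<le> ennreal C"
    using uloc_nn_bound[OF f a] by blast
  have "(\<integral>y. filt a f y * \<phi> y \<partial>lborel) = (\<integral>y. \<integral>x. f x * FT a (x - y) * \<phi> y \<partial>lborel \<partial>lborel)"
    unfolding filt_def by simp
  also have "\<dots> = (\<integral>x. \<integral>y. f x * FT a (x - y) * \<phi> y \<partial>lborel \<partial>lborel)"
  proof (rule Fubini_swap)
    have "(\<integral>\<^sup>+y. \<integral>\<^sup>+x. ennreal (norm (f x * FT a (x - y) * \<phi> y)) \<partial>lborel \<partial>lborel)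
        = (\<integral>\<^sup>+y. (\<integral>\<^sup>+x. ennreal (norm (f x) * norm (FT a (x - y))) \<partial>lborel) * ennreal (norm (\<phi> y)) \<partial>lborel)"
      by (subst nn_integral_multc[symmetric]) (auto simp: norm_mult ennreal_mult)
    also have "\<dots> \<le> (\<integral>\<^sup>+y. ennreal C * ennreal (norm (\<phi> y)) \<partial>lborel)"
      by (intro nn_integral_mono mult_right_mono C) auto
    also have "\<dots> < \<infinity>"
      using nn_integral_norm_finite[OF \<phi>] by (simp add: nn_integral_cmult ennreal_mult_less_top)
    finally show "(\<integral>\<^sup>+y. \<integral>\<^sup>+x. ennreal (norm (f x * FT a (x - y) * \<phi> y)) \<partial>lborel \<partial>lborel) < \<infinity>" .
  qed (auto intro: lborel.sigma_finite_measure_axioms)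
  also have "\<dots> = (\<integral>x. f x * (\<integral>y. FT a (x - y) * \<phi> y \<partial>lborel) \<partial>lborel)"
    by (subst integral_mult_right_zero[symmetric]) (simp only: mult.assoc)
  finally show ?thesis .
qed

lemma filt_filt:
  fixes f :: "real^'n::finite \<Rightarrow> complex"
  assumes f: "uloc f" and a: "test_function a" and b: "test_function b"
  shows "filt b (filt a f) x = complex_of_real ((2 * pi) ^ CARD('n)) * filt (\<lambda>\<xi>. b \<xi> * a \<xi>) f x"
proof -
  have "integrable lborel (\<lambda>y. FT b (y - x))"
    using integrable_lborel_shift(1)[OF FT_integrable[OF b], of "- x"] by simp
  then have "filt b (filt a f) x = (\<integral>z. f z * (\<integral>y. FT a (z - y) * FT b (y - x) \<partial>lborel) \<partial>lborel)"
    unfolding filt_def[of b] by (rule filt_pairing[OF f a])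
  also have "\<dots> = (\<integral>z. complex_of_real ((2 * pi) ^ CARD('n)) * (f z * FT (\<lambda>\<xi>. b \<xi> * a \<xi>) (z - x)) \<partial>lborel)"
    using FT_convolution[OF b a] by (simp only: mult.commute[of "FT a _"]) (simp only: mult_ac)
  also have "\<dots> = complex_of_real ((2 * pi) ^ CARD('n)) * filt (\<lambda>\<xi>. b \<xi> * a \<xi>) f x"
    unfolding filt_def by (rule integral_mult_right_zero)
  finally show ?thesis .
qed

section \<open>Multipliers on Lebesgue spaces\<close>

lemma eLp_shift:
  assumes p: "1 \<le> p" and [measurable]: "u \<in> borel_measurable borel"
  shows "eLp lborel p (\<lambda>x. u (x + t)) \<le> eLp lborel p (u :: 'a::euclidean_space \<Rightarrow> ennreal)"
proof -
  have *: "eLp lborel p u \<le> eLp lborel p u" by simp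
  show ?thesis
  proof (cases "p = \<infinity>")
    case True
    then have "AE x in lborel. u x \<le> eLp lborel p u"
      using * eLp_le_iff[OF p, of u lborel "eLp lborel p u"] by simp
    then have "AE x in distr lborel borel ((+) t). u x \<le> eLp lborel p u"
      by (simp only: lborel_distr_plus)
    then have "AE x in lborel. u (t + x) \<le> eLp lborel p u"
      by (subst (asm) AE_distr_iff) auto
    then show ?thesis
      using True by (subst eLp_le_iff[OF p]) (auto simp: add.commute)
  next
    case False
    then have "(\<integral>\<^sup>+x. ennreal_powr (u x) (enn2real p) \<partial>lborel) \<le> ennreal_powr (eLp lborel p u) (enn2real p)"
      using * eLp_le_iff[OF p, of u lborel "eLp lborel p u"] by simp
    then show ?thesis
      by (subst eLp_le_iff[OF p])
        (use False nn_integral_lborel_shift(1)[of "\<lambda>x. ennreal_powr (u x) (enn2real p)" t] in simp_all)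
  qed
qed

text \<open>With y = x + t the integral is a mixture of translates of |f| with weights |h(t)|. It is
  stated for absolute values so that it can also be applied blockwise after the triangle
  inequality.\<close>

lemma eLp_filt_abs:
  fixes f :: "real^'n::finite \<Rightarrow> complex"
  assumes p: "1 \<le> p" and [measurable]: "f \<in> borel_measurable borel" "h \<in> borel_measurable borel"
    and V: "(\<integral>\<^sup>+t. ennreal (norm (h t)) \<partial>lborel) \<le> ennreal V"
  shows "eLp lborel p (\<lambda>x. \<integral>\<^sup>+y. ennreal (norm (f y) * norm (h (y - x))) \<partial>lborel)
    \<le> ennreal V * pnorm p f"
proof -
  have "(\<integral>\<^sup>+y. ennreal (norm (f y) * norm (h (y - x))) \<partial>lborel)
      = (\<integral>\<^sup>+t. ennreal (norm (h t)) * ennreal (norm (f (x + t))) \<partial>lborel)" for x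
    using nn_integral_lborel_shift(1)[of "\<lambda>y. ennreal (norm (f y) * norm (h (y - x)))" x, symmetric]
    by (simp add: ennreal_mult mult.commute add.commute)
  then show ?thesis
    using eLp_shift[OF p, of "\<lambda>x. ennreal (norm (f x))"]
    by (simp only:) (intro eLp_mixture_le p V lborel.sigma_finite_measure_axioms, auto)
qed

lemma eLp_filt:
  fixes f :: "real^'n::finite \<Rightarrow> complex"
  assumes p: "1 \<le> p" and f: "uloc f" and a: "test_function a"
  shows "pnorm p (filt a f)
    \<le> ennreal (\<integral>t. norm (FT a t) \<partial>lborel) * pnorm p f"
proof -
  have [measurable]: "f \<in> borel_measurable borel" "FT a \<in> borel_measurable borel" "filt a f \<in> borel_measurable borel"
    using uloc_measurable[OF f] FT_measurable[OF a] filt_measurable[OF f a] by auto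
  have "pnorm p (filt a f)
      \<le> eLp lborel p (\<lambda>x. \<integral>\<^sup>+y. ennreal (norm (f y) * norm (FT a (y - x))) \<partial>lborel)"
    by (intro eLp_mono p norm_filt_le f a) measurable
  also have "\<dots> \<le> ennreal (\<integral>t. norm (FT a t) \<partial>lborel) * pnorm p f"
    using FT_integrable[OF a] by (intro eLp_filt_abs p) (auto simp: nn_integral_eq_integral)
  finally show ?thesis .
qed

text \<open>Jensen's inequality with the weight \<open>wt\<close>, which is then estimated by 1
  inside the remaining integral. In effect every L^p embeds into \<open>uloc\<close>.\<close>

lemma nn_integral_wt_le_eLp:
  fixes f :: "real^'n::finite \<Rightarrow> complex"
  assumes p: "1 \<le> p" and [measurable]: "f \<in> borel_measurable borel"
  shows "(\<integral>\<^sup>+y. ennreal (norm (f y) * wt (y - x)) \<partial>lborel)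
    \<le> ennreal (max 1 (\<integral>y. wt (y :: real^'n) \<partial>lborel)) * pnorm p f"
proof -
  define S where "S = pnorm p f"
  \<comment> \<open>Being at least 1, \<open>V\<close> may enter Jensen's inequality, and V^(r-1)
    may be replaced by V^r.\<close>
  define V where "V = max 1 (\<integral>y. wt (y :: real^'n) \<partial>lborel)"
  have V: "V \<ge> 1" "(\<integral>\<^sup>+y. ennreal (wt (y - x)) \<partial>lborel) \<le> ennreal V"
    unfolding V_def nn_integral_wt_shift nn_integral_wt by (auto intro: ennreal_leI)
  have eq: "(\<integral>\<^sup>+y. ennreal (norm (f y) * wt (y - x)) \<partial>lborel) = (\<integral>\<^sup>+y. ennreal (wt (y - x)) * ennreal (norm (f y)) \<partial>lborel)"
    by (simp add: ennreal_mult mult.commute)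
  have S: "S \<le> S" by simp
  have "(\<integral>\<^sup>+y. ennreal (wt (y - x)) * ennreal (norm (f y)) \<partial>lborel) \<le> ennreal V * S"
  proof (cases "p = \<infinity>")
    case True
    then have "AE y in lborel. ennreal (norm (f y)) \<le> S"
      using S eLp_le_iff[OF p, of "\<lambda>x. ennreal (norm (f x))" lborel S] by (simp add: S_def)
    then have "(\<integral>\<^sup>+y. ennreal (wt (y - x)) * ennreal (norm (f y)) \<partial>lborel) \<le> (\<integral>\<^sup>+y. ennreal (wt (y - x)) * S \<partial>lborel)"
      by (intro nn_integral_mono_AE) (auto elim!: eventually_mono intro: mult_left_mono)
    also have "\<dots> \<le> ennreal V * S" by (simp add: nn_integral_multc mult_right_mono V)
    finally show ?thesis .
  next
    case False
    define r where "r = enn2real p"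
    have r: "r \<ge> 1" using enn2real_ge_one[OF p False] by (simp add: r_def)
    have "ennreal_powr (\<integral>\<^sup>+y. ennreal (wt (y - x)) * ennreal (norm (f y)) \<partial>lborel) r
        \<le> ennreal (V powr (r - 1)) * (\<integral>\<^sup>+y. ennreal (wt (y - x)) * ennreal_powr (ennreal (norm (f y))) r \<partial>lborel)"
      by (rule nn_Jensen_powr) (use V r in auto)
    also have "\<dots> \<le> ennreal (V powr (r - 1)) * (\<integral>\<^sup>+y. 1 * ennreal_powr (ennreal (norm (f y))) r \<partial>lborel)"
      by (intro mult_left_mono nn_integral_mono mult_right_mono) (auto simp: wt_le_1)
    also have "\<dots> \<le> ennreal (V powr r) * ennreal_powr S r"
      using False V r S eLp_le_iff[OF p, of "\<lambda>x. ennreal (norm (f x))" lborel S]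
      by (intro mult_mono ennreal_leI powr_mono) (auto simp: S_def r_def)
    also have "\<dots> = ennreal_powr (ennreal V * S) r"
      using V by (simp add: ennreal_powr_mult ennreal_powr_ennreal)
    finally show ?thesis
      using ennreal_powr_le_iff[of r] r by (simp add: ennreal_powr_powr)
  qed
  then show ?thesis by (simp add: eq S_def V_def)
qed

lemma uloc_Lp:
  fixes f :: "real^'n::finite \<Rightarrow> complex"
  assumes p: "1 \<le> p" and m: "f \<in> borel_measurable borel" and fin: "pnorm p f < \<infinity>"
  shows "uloc f"
proof -
  obtain S where "pnorm p f = ennreal S" "S \<ge> 0"
    using fin by (cases "pnorm p f") auto
  then show ?thesis
    using nn_integral_wt_le_eLp[OF p m] m unfolding uloc_def
    by (intro conjI exI[of _ "max 1 (\<integral>y. wt (y :: real^'n) \<partial>lborel) * S"]) (auto simp: ennreal_mult)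
qed

text \<open>A Bernstein inequality: band-limiting makes the supremum controllable by any L^p norm.
  The decay constant \<open>C\<close> is a parameter because the kernels of all \<open>cut k\<close>
  share it.\<close>

lemma norm_filt_le_eLp:
  fixes f :: "real^'n::finite \<Rightarrow> complex"
  assumes p: "1 \<le> p" and f: "uloc f" and a: "test_function a" and C: "C \<ge> 0" "\<And>x. norm (FT a x) \<le> C * wt x"
  shows "ennreal (norm (filt a f x))
    \<le> ennreal (C * max 1 (\<integral>y. wt (y :: real^'n) \<partial>lborel)) * pnorm p f"
proof -
  have [measurable]: "f \<in> borel_measurable borel" by (rule uloc_measurable[OF f])
  have "ennreal (norm (filt a f x)) \<le> (\<integral>\<^sup>+y. ennreal (norm (f y) * norm (FT a (y - x))) \<partial>lborel)"
    by (rule norm_filt_le[OF f a])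
  also have "\<dots> \<le> (\<integral>\<^sup>+y. ennreal C * ennreal (norm (f y) * wt (y - x)) \<partial>lborel)"
  proof (rule nn_integral_mono)
    fix y
    have "norm (f y) * norm (FT a (y - x)) \<le> norm (f y) * (C * wt (y - x))"
      by (intro mult_left_mono C) simp
    then show "ennreal (norm (f y) * norm (FT a (y - x))) \<le> ennreal C * ennreal (norm (f y) * wt (y - x))"
      using C by (simp add: ennreal_mult[symmetric] mult_ac)
  qed
  also have "\<dots> = ennreal C * (\<integral>\<^sup>+y. ennreal (norm (f y) * wt (y - x)) \<partial>lborel)"
    by (rule nn_integral_cmult) simp
  also have "\<dots> \<le> ennreal C * (ennreal (max 1 (\<integral>y. wt (y :: real^'n) \<partial>lborel)) * pnorm p f)"
    by (intro mult_left_mono nn_integral_wt_le_eLp p) auto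
  finally show ?thesis using C by (simp add: ennreal_mult mult.assoc)
qed

section \<open>Uniqueness\<close>

text \<open>Boxes are stable under intersection and generate the Borel sets, and
  \<open>total\<close> handles complements; hence the integrals over all Borel sets vanish.\<close>

lemma AE_zero_if_box_integrals_zero_real:
  fixes h :: "'a::euclidean_space \<Rightarrow> real"
  assumes h: "integrable lborel h" and total: "(\<integral>x. h x \<partial>lborel) = 0"
    and box: "\<And>a b. (LINT x:box a b|lborel. h x) = 0"
  shows "AE x in lborel. h x = 0"
proof -
  let ?G = "range (\<lambda>(a, b). box a b :: 'a set)"
  have seth: "set_integrable lborel A h" if "A \<in> sets lborel" for A
    using integrable_mult_indicator[OF that h] by (simp add: set_integrable_def)
  have borel: "sigma_sets UNIV ?G = sets lborel"
    by (subst sets_lborel, subst borel_eq_box, subst sets_measure_of) (auto simp: case_prod_unfold)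
  have zero: "(LINT x:A|lborel. h x) = 0" if "A \<in> sigma_sets UNIV ?G" for A
  proof (rule sigma_sets_induct_disjoint[of ?G UNIV A])
    show "Int_stable ?G" by (auto simp: Int_stable_def box_Int_box)
    show "A \<in> sigma_sets UNIV ?G" by fact
    show "(LINT x:{}|lborel. h x) = 0" by (simp add: set_lebesgue_integral_def)
    show "(LINT x:UNIV - B|lborel. h x) = 0" if "B \<in> sigma_sets UNIV ?G" "(LINT x:B|lborel. h x) = 0" for B
    proof -
      have B: "B \<in> sets lborel" using that borel by simp
      have "(LINT x:UNIV - B|lborel. h x) + (LINT x:B|lborel. h x) = (LINT x:(UNIV - B) \<union> B|lborel. h x)"
        using B by (intro set_integral_Un[symmetric] seth) auto
      also have "\<dots> = 0" using total by (simp add: set_lebesgue_integral_def)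
      finally show ?thesis using that by simp
    qed
    show "(LINT x:(\<Union>i. F i)|lborel. h x) = 0"
      if F: "disjoint_family F" "range F \<subseteq> sigma_sets UNIV ?G" "\<And>i. (LINT x:F i|lborel. h x) = 0" for F :: "nat \<Rightarrow> 'a set"
    proof -
      have "F i \<in> sets lborel" for i using F(2) borel by auto
      moreover have "F i \<inter> F j = {}" if "i \<noteq> j" for i j using F(1) that by (auto simp: disjoint_family_on_def)
      ultimately have "(LINT x:(\<Union>i. F i)|lborel. h x) = (\<Sum>i. LINT x:F i|lborel. h x)"
        by (intro lebesgue_integral_countable_add seth sets.countable_UN) auto
      then show ?thesis by (simp add: F)
    qed
  qed (use box in auto)
  show ?thesis
    by (rule density_unique_real[OF h integrable_zero]) (use zero borel in \<open>simp add: set_lebesgue_integral_def\<close>)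
qed

text \<open>Cutting off to the cubes \<open>Q N\<close> makes \<open>h\<close> integrable, and since
  a cube meets a box in a box, the hypotheses survive. Real and imaginary parts are treated
  separately.\<close>

lemma AE_zero_if_box_integrals_zero:
  fixes h :: "'a::euclidean_space \<Rightarrow> complex"
  assumes [measurable]: "h \<in> borel_measurable borel"
    and loc: "\<And>a b. integrable lborel (\<lambda>x. h x * indicator (box a b) x)"
    and zero: "\<And>a b. (\<integral>x. h x * indicator (box a b) x \<partial>lborel) = 0"
  shows "AE x in lborel. h x = 0"
proof -
  define Q :: "nat \<Rightarrow> 'a set" where "Q N = box (- (\<Sum>b\<in>Basis. real N *\<^sub>R b)) (\<Sum>b\<in>Basis. real N *\<^sub>R b)" for N
  have "AE x in lborel. h x * indicator (Q N) x = 0" for N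
  proof -
    have int: "(\<integral>x. (h x * indicator (Q N) x) * indicator (box a b) x \<partial>lborel) = 0" for a b
    proof -
      have "Q N \<inter> box a b \<in> range (\<lambda>(a, b). box a b :: 'a set)" by (auto simp: Q_def box_Int_box)
      then obtain c d where "Q N \<inter> box a b = box c d" by auto
      then have "(\<integral>x. (h x * indicator (Q N) x) * indicator (box a b) x \<partial>lborel) = (\<integral>x. h x * indicator (box c d) x \<partial>lborel)"
        by (simp add: mult.assoc flip: indicator_inter_arith)
      then show ?thesis by (simp add: zero)
    qed
    have I: "integrable lborel (\<lambda>x. h x * indicator (Q N) x)" by (simp add: Q_def loc)
    have I2: "integrable lborel (\<lambda>x. (h x * indicator (Q N) x) * indicator (box a b) x)" for a b
      by (rule Bochner_Integration.integrable_bound[OF I]) (auto simp: norm_mult Q_def split: split_indicator)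
    have Iz: "(\<integral>x. h x * indicator (Q N) x \<partial>lborel) = 0" by (simp add: Q_def zero)
    have part: "AE x in lborel. L (h x * indicator (Q N) x) = 0" if L: "bounded_linear L" for L :: "complex \<Rightarrow> real"
    proof (rule AE_zero_if_box_integrals_zero_real)
      show "integrable lborel (\<lambda>x. L (h x * indicator (Q N) x))" by (rule integrable_bounded_linear[OF L I])
      show "(\<integral>x. L (h x * indicator (Q N) x) \<partial>lborel) = 0"
        using integral_bounded_linear[OF L I] by (simp add: Iz linear_0[OF bounded_linear.linear[OF L]])
      show "(LINT x:box a b|lborel. L (h x * indicator (Q N) x)) = 0" for a b
      proof -
        have "(LINT x:box a b|lborel. L (h x * indicator (Q N) x)) = (\<integral>x. L ((h x * indicator (Q N) x) * indicator (box a b) x) \<partial>lborel)"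
          unfolding set_lebesgue_integral_def
          by (intro Bochner_Integration.integral_cong refl) (simp add: linear_0[OF bounded_linear.linear[OF L]] split: split_indicator)
        also have "\<dots> = L (\<integral>x. (h x * indicator (Q N) x) * indicator (box a b) x \<partial>lborel)"
          by (rule integral_bounded_linear[OF L I2])
        finally show ?thesis by (simp add: int linear_0[OF bounded_linear.linear[OF L]])
      qed
    qed
    show ?thesis
      using part[OF bounded_linear_Re] part[OF bounded_linear_Im]
    proof eventually_elim
      case (elim x)
      then show ?case by (intro complex_eqI) auto
    qed
  qed
  then have "AE x in lborel. \<forall>N. h x * indicator (Q N) x = 0" unfolding AE_all_countable by blast
  then show ?thesis
  proof eventually_elim
    case (elim x)
    obtain N where N: "norm x < real N" using reals_Archimedean2 by blast
    have "x \<in> Q N"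
      unfolding Q_def mem_box
    proof
      fix b :: 'a assume b: "b \<in> Basis"
      have "\<bar>x \<bullet> b\<bar> \<le> norm x" using b by (rule Basis_le_norm)
      moreover have "(\<Sum>b\<in>Basis. real N *\<^sub>R b) \<bullet> b = real N" using b by simp
      ultimately show "- (\<Sum>b\<in>Basis. real N *\<^sub>R b) \<bullet> b < x \<bullet> b \<and> x \<bullet> b < (\<Sum>b\<in>Basis. real N *\<^sub>R b) \<bullet> b"
        using N unfolding inner_minus_left by linarith
    qed
    then show ?case using elim[rule_format, of N] by simp
  qed
qed

lemma uloc_integrable_wt:
  assumes "uloc f" shows "integrable lborel (\<lambda>y. complex_of_real (wt y) * f y)"
proof (rule integrableI_bounded)
  have [measurable]: "f \<in> borel_measurable borel" by (rule uloc_measurable[OF assms])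
  show "(\<lambda>y. complex_of_real (wt y) * f y) \<in> borel_measurable lborel" by measurable
  obtain C where "\<And>x. (\<integral>\<^sup>+y. ennreal (norm (f y) * wt (y - x)) \<partial>lborel) \<le> ennreal C"
    using assms unfolding uloc_def by blast
  from order_le_less_trans[OF this[of 0] ennreal_less_top]
  show "(\<integral>\<^sup>+y. ennreal (norm (complex_of_real (wt y) * f y)) \<partial>lborel) < \<infinity>"
    by (simp add: norm_mult mult.commute)
qed

lemma FT_dilation:
  fixes a :: "real^'n::finite \<Rightarrow> complex"
  assumes a: "test_function a" and e: "e > 0"
  shows "FT a u = e ^ CARD('n) *\<^sub>R FT (\<lambda>\<xi>. a (e *\<^sub>R \<xi>)) (e *\<^sub>R u)"
proof -
  have [measurable]: "a \<in> borel_measurable borel" by (rule test_function_measurable[OF a])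
  show ?thesis
    unfolding FT_def using e by (subst integral_lborel_affine[of e _ 0]) (simp_all add: inner_commute)
qed

text \<open>The dilations of one kernel form an approximate identity; it is moved onto the indicator function
  of a box, where the limit exists outside the boundary.\<close>

lemma filt_zero_imp_AE_zero:
  fixes D a :: "real^'n::finite \<Rightarrow> complex"
  assumes D: "uloc D" and a: "test_function a" and a0: "a 0 \<noteq> 0"
    and zero: "\<And>b x. test_function b \<Longrightarrow> filt b D x = 0"
  shows "AE x in lborel. D x = 0"
proof (rule AE_zero_if_box_integrals_zero)
  show meas [measurable]: "D \<in> borel_measurable borel" by (rule uloc_measurable[OF D])
  fix l u :: "real^'n"
  define B where "B = box l u"
  define \<Phi> where "\<Phi> = FT a"
  have [measurable]: "\<Phi> \<in> borel_measurable borel" unfolding \<Phi>_def by (rule FT_measurable[OF a])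
  have [measurable]: "B \<in> sets borel" by (simp add: B_def)
  obtain R where R: "\<And>x. x \<in> B \<Longrightarrow> norm x \<le> R"
    using bounded_box[of l u] unfolding B_def bounded_iff by blast
  obtain C where C: "C \<ge> 0" "\<And>x. norm (\<Phi> x) \<le> C * (wt x)\<^sup>2"
    unfolding \<Phi>_def using FT_decay[OF a] by blast
  \<comment> \<open>A lower bound for \<open>wt\<close> on the box, so that the indicator function
    is at most \<open>wt / cB\<close> and inherits the weight estimates.\<close>
  define cB where "cB = inverse (1 + R\<^sup>2) ^ CARD('n)"
  have cB: "cB > 0" "\<And>x. x \<in> B \<Longrightarrow> cB \<le> wt x"
    unfolding cB_def by (auto intro!: zero_less_power wt_lower R simp: add_pos_nonneg)
  have intB: "integrable lborel (indicator B :: real^'n \<Rightarrow> complex)"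
  proof -
    have "integrable lborel (\<lambda>x. complex_of_real (indicator B x))"
      unfolding B_def by (intro integrable_of_real integrable_real_indicator) (use emeasure_lborel_box_finite in auto)
    also have "(\<lambda>x. complex_of_real (indicator B x)) = indicator B" by (auto split: split_indicator)
    finally show ?thesis .
  qed
  have ind_le: "indicator B x \<le> wt x / cB" for x
    using cB by (auto simp: field_simps indicator_def less_imp_le)
  have intDB: "integrable lborel (\<lambda>x. D x * indicator B x)"
  proof (rule Bochner_Integration.integrable_bound)
    show "integrable lborel (\<lambda>x. complex_of_real (1 / cB) * (complex_of_real (wt x) * D x))"
      by (intro integrable_mult_right uloc_integrable_wt D)
    have "norm (D x * indicator B x) \<le> norm (complex_of_real (1 / cB) * (complex_of_real (wt x) * D x))" for x
    proof -
      have "norm (D x * indicator B x) = norm (D x) * indicator B x" by (simp add: norm_mult split: split_indicator)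
      also have "\<dots> \<le> norm (D x) * (wt x / cB)" by (intro mult_left_mono ind_le) simp
      finally show ?thesis using cB by (simp add: norm_mult norm_divide mult_ac)
    qed
    then show "AE x in lborel. norm (D x * indicator B x) \<le> norm (complex_of_real (1 / cB) * (complex_of_real (wt x) * D x))" by simp
  qed measurable
  then show "integrable lborel (\<lambda>x. D x * indicator (box l u) x)" by (simp add: B_def)
  \<comment> \<open>The indicator function convolved with the kernel at scale e, after a
    substitution that leaves e only in the argument of the indicator.\<close>
  define T where "T e x = (\<integral>z. \<Phi> z * indicator B (x - e *\<^sub>R z) \<partial>lborel)" for e and x :: "real^'n"
  have T_meas [measurable]: "T e \<in> borel_measurable borel" for e
  proof -
    have "(\<lambda>x. \<integral>z. \<Phi> z * indicator B (x - e *\<^sub>R z) \<partial>lborel) \<in> borel_measurable lborel"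
      by (rule lborel.borel_measurable_lebesgue_integral) measurable
    then show ?thesis by (simp add: T_def[abs_def])
  qed
  have T_pair: "(\<integral>x. D x * T e x \<partial>lborel) = 0" if e: "e > 0" for e
  proof -
    \<comment> \<open>The symbol of the dilated kernel is again a test function, so
      \<open>zero\<close> applies at every scale.\<close>
    define b where "b \<xi> = a (e *\<^sub>R \<xi>)" for \<xi>
    have b: "test_function b" unfolding b_def using test_function_affine[OF a, of e 0] e by simp
    have [measurable]: "FT b \<in> borel_measurable borel" by (rule FT_measurable[OF b])
    have "(\<integral>y. FT b (x - y) * indicator B y \<partial>lborel) = T e x" for x
    proof -
      have "(\<integral>y. FT b (x - y) * indicator B y \<partial>lborel)
          = (\<bar>- e\<bar> ^ DIM(real^'n)) *\<^sub>R (\<integral>z. FT b (x - (x + (- e) *\<^sub>R z)) * indicator B (x + (- e) *\<^sub>R z) \<partial>lborel)"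
        by (rule integral_lborel_affine) (use e in auto)
      also have "\<dots> = (\<integral>z. (e ^ CARD('n)) *\<^sub>R (FT b (e *\<^sub>R z) * indicator B (x - e *\<^sub>R z)) \<partial>lborel)"
        using e by simp
      also have "\<dots> = T e x"
        unfolding T_def \<Phi>_def b_def by (subst FT_dilation[OF a e]) simp
      finally show ?thesis .
    qed
    then show ?thesis
      using filt_pairing[OF D b intB] by (simp add: zero[OF b])
  qed
  define W where "W = (\<integral>z. wt (z :: real^'n) \<partial>lborel)"
  define K where "K = C * (2 ^ CARD('n) / cB) * W"
  have T_bound: "norm (T e x) \<le> K * wt x" if e: "0 < e" "e \<le> 1" for e x
  proof -
    have pt: "norm (\<Phi> z * indicator B (x - e *\<^sub>R z)) \<le> (C * (2 ^ CARD('n) / cB) * wt x) * wt z" for z :: "real^'n"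
    proof -
      have "norm (\<Phi> z * indicator B (x - e *\<^sub>R z)) = norm (\<Phi> z) * indicator B (x - e *\<^sub>R z)"
        by (simp add: norm_mult split: split_indicator)
      also have "\<dots> \<le> (C * (wt z)\<^sup>2) * (wt (x - e *\<^sub>R z) / cB)"
        by (intro mult_mono C ind_le) (use C in auto)
      \<comment> \<open>One factor \<open>wt z\<close> is kept for integration in z. The other
        combines with \<open>wt (x - e *\<^sub>R z)\<close> by Peetre's inequality, where e <= 1
        allows replacing z by e z.\<close>
      also have "\<dots> = (C / cB * wt z) * (wt z * wt (x - e *\<^sub>R z))" by (simp add: power2_eq_square)
      also have "\<dots> \<le> (C / cB * wt z) * (wt (e *\<^sub>R z) * wt (x - e *\<^sub>R z))"
        using C cB e by (intro mult_left_mono mult_right_mono wt_scale) auto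
      also have "\<dots> \<le> (C / cB * wt z) * (2 ^ CARD('n) * wt x)"
        using wt_Peetre[of "e *\<^sub>R z" "x - e *\<^sub>R z"] C cB by (intro mult_left_mono) auto
      finally show ?thesis by (simp add: mult_ac)
    qed
    have "norm (T e x) \<le> (\<integral>z. (C * (2 ^ CARD('n) / cB) * wt x) * wt (z :: real^'n) \<partial>lborel)"
      unfolding T_def
    proof (rule Bochner_Integration.integral_norm_bound_integral)
      show "integrable lborel (\<lambda>z. (C * (2 ^ CARD('n) / cB) * wt x) * wt (z :: real^'n))"
        by (intro integrable_mult_right integrable_wt)
      then show "integrable lborel (\<lambda>z. \<Phi> z * indicator B (x - e *\<^sub>R z))"
      proof (rule Bochner_Integration.integrable_bound)
        show "AE z in lborel. norm (\<Phi> z * indicator B (x - e *\<^sub>R z))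
            \<le> norm ((C * (2 ^ CARD('n) / cB) * wt x) * wt (z :: real^'n))"
          unfolding real_norm_def by (intro AE_I2 order_trans[OF pt] abs_ge_self)
      qed measurable
    qed (rule pt)
    also have "\<dots> = K * wt x" by (simp add: K_def W_def mult_ac)
    finally show ?thesis .
  qed
  define e where "e n = inverse (real (Suc n))" for n
  have e: "0 < e n" "e n \<le> 1" for n by (auto simp: e_def inverse_le_1_iff)
  have e0: "e \<longlonglongrightarrow> 0" unfolding e_def by (rule LIMSEQ_inverse_real_of_nat)
  \<comment> \<open>Away from the boundary \<open>x\<close> is an inner point of the box or of its
    complement, so the indicator is eventually constant along x - e z.\<close>
  have T_lim: "(\<lambda>n. T (e n) x) \<longlonglongrightarrow> indicator B x * (\<integral>z. \<Phi> z \<partial>lborel)" if x: "x \<notin> cbox l u - box l u" for x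
  proof -
    have "(\<lambda>n. T (e n) x) \<longlonglongrightarrow> (\<integral>z. \<Phi> z * indicator B x \<partial>lborel)"
      unfolding T_def
    proof (rule integral_dominated_convergence[where w = "\<lambda>z. norm (\<Phi> z)"])
      show "integrable lborel (\<lambda>z. norm (\<Phi> z))" unfolding \<Phi>_def by (intro integrable_norm FT_integrable a)
      show "AE z in lborel. (\<lambda>n. \<Phi> z * indicator B (x - e n *\<^sub>R z)) \<longlonglongrightarrow> \<Phi> z * indicator B x"
      proof (intro AE_I2 tendsto_mult tendsto_const)
        fix z
        have lim: "(\<lambda>n. x - e n *\<^sub>R z) \<longlonglongrightarrow> x"
          using tendsto_diff[OF tendsto_const tendsto_scaleR[OF e0 tendsto_const], of x z] by simp
        have "\<forall>\<^sub>F n in sequentially. indicator B (x - e n *\<^sub>R z) = (indicator B x :: complex)"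
        proof (cases "x \<in> B")
          case True
          then have "\<forall>\<^sub>F n in sequentially. x - e n *\<^sub>R z \<in> B"
            by (intro topological_tendstoD[OF lim]) (auto simp: B_def)
          then show ?thesis by eventually_elim (use True in simp)
        next
          case False
          then have "x \<in> - cbox l u" using x by (auto simp: B_def)
          then have "\<forall>\<^sub>F n in sequentially. x - e n *\<^sub>R z \<in> - cbox l u"
            by (intro topological_tendstoD[OF lim]) (auto simp: open_Compl closed_cbox)
          then show ?thesis
            by eventually_elim (use False box_subset_cbox[of l u] in \<open>auto simp: B_def indicator_def\<close>)
        qed
        then show "(\<lambda>n. indicator B (x - e n *\<^sub>R z) :: complex) \<longlonglongrightarrow> indicator B x"
          by (rule tendsto_eventually)
      qed
    qed (auto simp: norm_mult split: split_indicator)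
    then show ?thesis by (simp add: mult.commute)
  qed
  have ae: "AE x in lborel. x \<notin> cbox l u - box l u"
  proof -
    have "cbox l u - box l u \<in> null_sets lebesgue"
      using negligible_frontier_interval negligible_iff_null_sets by blast
    then have "AE x in lebesgue. x \<notin> cbox l u - box l u" by (rule AE_not_in)
    then show ?thesis by (simp add: AE_completion_iff)
  qed
  have "(\<lambda>n. \<integral>x. D x * T (e n) x \<partial>lborel) \<longlonglongrightarrow> (\<integral>x. D x * (indicator B x * (\<integral>z. \<Phi> z \<partial>lborel)) \<partial>lborel)"
  proof (rule integral_dominated_convergence[where w = "\<lambda>x. K * norm (complex_of_real (wt x) * D x)"])
    show "integrable lborel (\<lambda>x. K * norm (complex_of_real (wt x) * D x))"
      by (intro integrable_mult_right integrable_norm uloc_integrable_wt D)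
    show "AE x in lborel. (\<lambda>n. D x * T (e n) x) \<longlonglongrightarrow> D x * (indicator B x * (\<integral>z. \<Phi> z \<partial>lborel))"
      using ae by eventually_elim (intro tendsto_mult tendsto_const T_lim)
    show "AE x in lborel. norm (D x * T (e n) x) \<le> K * norm (complex_of_real (wt x) * D x)" for n
    proof (rule AE_I2)
      fix x
      have "norm (D x * T (e n) x) \<le> norm (D x) * (K * wt x)"
        unfolding norm_mult by (intro mult_left_mono T_bound e) simp
      then show "norm (D x * T (e n) x) \<le> K * norm (complex_of_real (wt x) * D x)"
        by (simp add: norm_mult mult_ac)
    qed
  qed measurable
  then have "(\<lambda>n. 0) \<longlonglongrightarrow> (\<integral>x. D x * (indicator B x * (\<integral>z. \<Phi> z \<partial>lborel)) \<partial>lborel)"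
    by (simp only: T_pair[OF e(1)])
  from LIMSEQ_unique[OF this tendsto_const]
  \<comment> \<open>The kernel has integral (2 pi)^n \<open>a 0\<close>, which is nonzero and can be
    cancelled.\<close>
  have "0 = (\<integral>x. D x * indicator B x \<partial>lborel) * (\<integral>z. \<Phi> z \<partial>lborel)"
    by (simp add: mult.assoc flip: integral_mult_left_zero)
  moreover have "(\<integral>z. \<Phi> z \<partial>lborel) = complex_of_real ((2 * pi) ^ CARD('n)) * a 0"
    using FT_inversion[OF a, of 0] by (simp add: \<Phi>_def)
  ultimately show "(\<integral>x. D x * indicator (box l u) x \<partial>lborel) = 0"
    using a0 by (simp add: B_def)
qed

section \<open>The partition of unity\<close>

lemma lattice_vec_component [simp]: "lattice_vec k $ i = real_of_int (k $ i)"
  by (simp add: lattice_vec_def)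

lemma lattice_vec_add: "lattice_vec (k + l) = lattice_vec k + lattice_vec l"
  and lattice_vec_zero [simp]: "lattice_vec 0 = 0"
  by (simp_all add: vec_eq_iff)

lemma finite_lattice_box: "finite {m :: int^'n::finite. \<forall>i. \<bar>m $ i\<bar> \<le> N}"
proof (rule finite_subset)
  have "finite {f :: 'n \<Rightarrow> int. \<forall>i. f i \<in> {-N..N}}"
    using finite_set_of_finite_funs[of "UNIV :: 'n set" "{-N..N}" 0] by simp
  then show "finite (vec_lambda ` {f :: 'n \<Rightarrow> int. \<forall>i. f i \<in> {-N..N}})" by (rule finite_imageI)
  show "{m :: int^'n. \<forall>i. \<bar>m $ i\<bar> \<le> N} \<subseteq> vec_lambda ` {f :: 'n \<Rightarrow> int. \<forall>i. f i \<in> {-N..N}}"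
  proof
    fix m :: "int^'n" assume m: "m \<in> {m. \<forall>i. \<bar>m $ i\<bar> \<le> N}"
    have "vec_nth m \<in> {f. \<forall>i. f i \<in> {-N..N}}"
    proof (intro CollectI allI)
      fix i
      have "\<bar>m $ i\<bar> \<le> N" using m by simp
      then show "m $ i \<in> {-N..N}" unfolding atLeastAtMost_iff by linarith
    qed
    then show "m \<in> vec_lambda ` {f. \<forall>i. f i \<in> {-N..N}}" by (intro image_eqI[of _ _ "vec_nth m"]) simp_all
  qed
qed

lemma FT_translate:
  fixes a :: "real^'n::finite \<Rightarrow> complex"
  assumes a: "test_function a"
  shows "norm (FT (\<lambda>\<xi>. a (\<xi> - y)) x) = norm (FT a x)"
proof -
  have [measurable]: "a \<in> borel_measurable borel" by (rule test_function_measurable[OF a])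
  have "FT (\<lambda>\<xi>. a (\<xi> - y)) x = (\<integral>\<xi>. a \<xi> * mexp (x \<bullet> (\<xi> + y)) \<partial>lborel)"
    unfolding FT_def
    using integral_lborel_shift(1)[of "\<lambda>\<xi>. a (\<xi> - y) * mexp (x \<bullet> \<xi>)" y] by simp
  also have "\<dots> = (\<integral>\<xi>. mexp (x \<bullet> y) * (a \<xi> * mexp (x \<bullet> \<xi>)) \<partial>lborel)"
    by (intro Bochner_Integration.integral_cong refl) (simp add: inner_add_right algebra_simps exp_add[symmetric])
  also have "\<dots> = mexp (x \<bullet> y) * FT a x"
    unfolding FT_def by (rule integral_mult_right_zero)
  finally show ?thesis by (simp add: norm_mult)
qed

locale unit_partition =
  fixes \<rho> :: "real^'n::finite \<Rightarrow> real"
  assumes smooth_rho: "smooth \<rho>"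
    and rho_nonneg: "\<And>x. 0 \<le> \<rho> x"
    and rho_support: "\<And>x i. \<rho> x \<noteq> 0 \<Longrightarrow> \<bar>x $ i\<bar> \<le> 1"
    and rho_one: "\<And>x. (\<And>i. \<bar>x $ i\<bar> \<le> 1/2) \<Longrightarrow> \<rho> x = 1"
begin

definition total :: "real^'n \<Rightarrow> real" where
  "total \<xi> = (\<Sum>\<^sub>\<infinity>m\<in>UNIV. \<rho> (\<xi> - lattice_vec m))"

lemma sigma_eq: "sigma \<rho> k \<xi> = \<rho> (\<xi> - lattice_vec k) * inverse (total \<xi>)"
  by (simp add: sigma_def total_def)

lemma total_eq_sum:
  assumes "finite L" "\<And>m. \<rho> (\<xi> - lattice_vec m) \<noteq> 0 \<Longrightarrow> m \<in> L"
  shows "total \<xi> = (\<Sum>m\<in>L. \<rho> (\<xi> - lattice_vec m))"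
proof -
  have "total \<xi> = (\<Sum>\<^sub>\<infinity>m\<in>L. \<rho> (\<xi> - lattice_vec m))"
    unfolding total_def using assms by (intro infsum_cong_neutral) auto
  then show ?thesis using assms by simp
qed

lemma finite_lattice_near:
  obtains L where "finite L" "\<And>m \<xi>. norm \<xi> \<le> R \<Longrightarrow> \<rho> (\<xi> - lattice_vec m) \<noteq> 0 \<Longrightarrow> m \<in> L"
proof
  show "finite {m :: int^'n. \<forall>i. \<bar>m $ i\<bar> \<le> \<lceil>R\<rceil> + 1}" by (rule finite_lattice_box)
  fix m \<xi> assume *: "norm \<xi> \<le> R" "\<rho> (\<xi> - lattice_vec m) \<noteq> 0"
  have "\<bar>m $ i\<bar> \<le> \<lceil>R\<rceil> + 1" for i
    using rho_support[OF *(2), of i] component_le_norm_cart[of \<xi> i] *(1) by (simp add: abs_le_iff) linarith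
  then show "m \<in> {m. \<forall>i. \<bar>m $ i\<bar> \<le> \<lceil>R\<rceil> + 1}" by simp
qed

lemma total_ge_1: "total \<xi> \<ge> 1"
proof -
  obtain L where L: "finite L" "\<And>m \<eta>. norm \<eta> \<le> norm \<xi> \<Longrightarrow> \<rho> (\<eta> - lattice_vec m) \<noteq> 0 \<Longrightarrow> m \<in> L"
    using finite_lattice_near by blast
  \<comment> \<open>Rounding the coordinates puts \<open>\<xi> - lattice_vec m\<close> into the cube
    where \<open>\<rho>\<close> is 1, so a single term already contributes 1.\<close>
  define m where "m = (\<chi> i. round (\<xi> $ i))"
  have "\<bar>(\<xi> - lattice_vec m) $ i\<bar> \<le> 1/2" for i
    using of_int_round_abs_le[of "\<xi> $ i"] by (simp add: m_def abs_minus_commute)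
  then have one: "\<rho> (\<xi> - lattice_vec m) = 1" by (rule rho_one)
  have "\<rho> (\<xi> - lattice_vec m) \<le> (\<Sum>m\<in>L. \<rho> (\<xi> - lattice_vec m))"
    using L(1) L(2)[OF order_refl, of m] one rho_nonneg by (intro member_le_sum) auto
  also have "\<dots> = total \<xi>" using L by (intro total_eq_sum[symmetric]) auto
  finally show ?thesis using one by simp
qed

lemma smooth_rho_shift: "smooth (\<lambda>\<xi>. \<rho> (\<xi> - lattice_vec m))"
  using smooth_affine[OF smooth_rho, of 1 "- lattice_vec m"] by simp

lemma smooth_total: "smooth total"
proof (rule smooth_local)
  fix x :: "real^'n"
  obtain L where L: "finite L" "\<And>m \<eta>. norm \<eta> \<le> norm x + 1 \<Longrightarrow> \<rho> (\<eta> - lattice_vec m) \<noteq> 0 \<Longrightarrow> m \<in> L"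
    using finite_lattice_near by blast
  show "\<exists>U g. open U \<and> x \<in> U \<and> smooth g \<and> (\<forall>y\<in>U. total y = g y)"
  proof (intro exI conjI ballI)
    show "open (ball 0 (norm x + 1) :: (real^'n) set)" "x \<in> ball 0 (norm x + 1)" by auto
    show "smooth (\<lambda>\<xi>. \<Sum>m\<in>L. \<rho> (\<xi> - lattice_vec m))" by (intro smooth_sum L smooth_rho_shift)
    show "total y = (\<Sum>m\<in>L. \<rho> (y - lattice_vec m))" if "y \<in> ball 0 (norm x + 1)" for y
      using L(2)[of y] that by (intro total_eq_sum L(1)) auto
  qed
qed

lemma total_periodic: "total (\<xi> - lattice_vec k) = total \<xi>"
proof -
  have "total (\<xi> - lattice_vec k) = (\<Sum>\<^sub>\<infinity>m\<in>UNIV. \<rho> (\<xi> - lattice_vec (k + m)))"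
    by (simp add: total_def lattice_vec_add algebra_simps)
  also have "\<dots> = total \<xi>"
    unfolding total_def
    by (rule infsum_reindex_bij_betw[where g = "\<lambda>m. k + m"]) (auto intro!: bij_betwI[where g = "\<lambda>m. m - k"])
  finally show ?thesis .
qed

lemma sigma_shift: "sigma \<rho> k \<xi> = sigma \<rho> 0 (\<xi> - lattice_vec k)"
  by (simp add: sigma_eq total_periodic)

definition sg :: "int^'n \<Rightarrow> real^'n \<Rightarrow> complex" where
  "sg k \<xi> = complex_of_real (sigma \<rho> k \<xi>)"

text \<open>Doubling the scale of \<open>\<rho>\<close> makes \<open>cut k\<close> equal to 1 on the
  cube |xi_i - k_i| <= 1, which contains the support of \<open>sg k\<close>. It is the symbol of the
  reproducing kernel.\<close>

definition cut :: "int^'n \<Rightarrow> real^'n \<Rightarrow> complex" where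
  "cut k \<xi> = complex_of_real (\<rho> ((1/2) *\<^sub>R (\<xi> - lattice_vec k)))"

lemma norm_le_if_components_le:
  assumes "\<And>i. \<bar>x $ i\<bar> \<le> 1" shows "norm (x :: real^'n) \<le> real CARD('n)"
proof -
  have "norm x \<le> (\<Sum>i\<in>UNIV. \<bar>x $ i\<bar>)" by (rule norm_le_l1_cart)
  also have "\<dots> \<le> (\<Sum>i\<in>(UNIV :: 'n set). 1)" by (intro sum_mono assms)
  finally show ?thesis by simp
qed

lemma test_function_rho: "test_function (\<lambda>\<xi>. complex_of_real (\<rho> \<xi>))"
  unfolding test_function_def
  by (intro conjI smooth_of_real smooth_rho exI[of _ "real CARD('n)"]) (auto intro!: norm_le_if_components_le rho_support)

lemma test_function_cut: "test_function (cut k)"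
  unfolding cut_def using test_function_affine[OF test_function_rho, of "1/2" "- ((1/2) *\<^sub>R lattice_vec k)"]
  by (simp add: scaleR_diff_right)

lemma test_function_sg: "test_function (sg k)"
proof -
  have "smooth (\<lambda>\<xi>. complex_of_real (inverse (total \<xi>)))"
  proof (intro smooth_of_real smooth_inverse smooth_total)
    show "total \<xi> \<noteq> 0" for \<xi> using total_ge_1[of \<xi>] by linarith
  qed
  moreover have "test_function (\<lambda>\<xi>. complex_of_real (\<rho> (\<xi> - lattice_vec k)))"
    using test_function_affine[OF test_function_rho, of 1 "- lattice_vec k"] by simp
  ultimately have "test_function (\<lambda>\<xi>. complex_of_real (\<rho> (\<xi> - lattice_vec k)) * complex_of_real (inverse (total \<xi>)))"
    by (rule test_function_mult[rotated])
  then show ?thesis by (simp add: sg_def[abs_def] sigma_eq)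
qed

lemma sg_support: "sg k \<xi> \<noteq> 0 \<Longrightarrow> \<bar>\<xi> $ i - real_of_int (k $ i)\<bar> \<le> 1"
  using rho_support[of "\<xi> - lattice_vec k" i] by (auto simp: sg_def sigma_eq)

lemma cut_sg: "cut k \<xi> * sg k \<xi> = sg k \<xi>"
proof (cases "sg k \<xi> = 0")
  case False
  have "cut k \<xi> = 1"
    unfolding cut_def using sg_support[OF False] by (subst rho_one) (auto simp: abs_mult)
  then show ?thesis by simp
qed simp

lemma sum_sg:
  assumes "finite L" "\<And>m. \<rho> (\<xi> - lattice_vec m) \<noteq> 0 \<Longrightarrow> m \<in> L"
  shows "(\<Sum>k\<in>L. sg k \<xi>) = 1"
proof -
  have t: "(\<Sum>k\<in>L. \<rho> (\<xi> - lattice_vec k)) = total \<xi>" by (rule total_eq_sum[OF assms, symmetric])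
  have "(\<Sum>k\<in>L. sigma \<rho> k \<xi>) = total \<xi> * inverse (total \<xi>)"
    unfolding sigma_eq sum_distrib_right[symmetric] t ..
  also have "\<dots> = 1" using total_ge_1[of \<xi>] by simp
  finally show ?thesis by (simp add: sg_def flip: of_real_sum)
qed

lemma norm_FT_sg: "norm (FT (sg k) x) = norm (FT (sg 0) x)"
proof -
  have "sg k = (\<lambda>\<xi>. sg 0 (\<xi> - lattice_vec k))" by (simp add: sg_def fun_eq_iff flip: sigma_shift)
  then show ?thesis using FT_translate[OF test_function_sg[of 0]] by metis
qed

lemma norm_FT_cut: "norm (FT (cut k) x) = norm (FT (cut 0) x)"
proof -
  have "cut k = (\<lambda>\<xi>. cut 0 (\<xi> - lattice_vec k))" by (simp add: cut_def fun_eq_iff)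
  then show ?thesis using FT_translate[OF test_function_cut[of 0]] by metis
qed

end

section \<open>Integrals with respect to the completed measure\<close>

lemma Lp_norm_eq_eLp:
  assumes [measurable]: "f \<in> borel_measurable borel" and p: "1 \<le> p"
  shows "Lp_norm p f = pnorm p f"
proof (cases "p = \<infinity>")
  case True
  have m: "(\<lambda>x. ennreal (norm (f x))) \<in> borel_measurable lborel" by measurable
  have m': "(\<lambda>x. ennreal (norm (f x))) \<in> borel_measurable lebesgue" by (rule measurable_completion[OF m])
  have "esssup lebesgue (\<lambda>x. ennreal (norm (f x))) = esssup lborel (\<lambda>x. ennreal (norm (f x)))"
  proof (rule antisym)
    show "esssup lebesgue (\<lambda>x. ennreal (norm (f x))) \<le> esssup lborel (\<lambda>x. ennreal (norm (f x)))"
      by (rule esssup_I[OF m']) (rule AE_completion[OF esssup_AE])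
    have "AE x in lebesgue. ennreal (norm (f x)) \<le> esssup lebesgue (\<lambda>x. ennreal (norm (f x)))" by (rule esssup_AE)
    then show "esssup lborel (\<lambda>x. ennreal (norm (f x))) \<le> esssup lebesgue (\<lambda>x. ennreal (norm (f x)))"
      by (intro esssup_I[OF m]) (simp only: AE_completion_iff)
  qed
  then show ?thesis using True by (simp add: Lp_norm_def eLp_def)
next
  case False
  then show ?thesis by (simp add: Lp_norm_def eLp_def nn_integral_completion ennreal_powr_ennreal)
qed

lemma Lp_norm_cong_AE:
  assumes "f \<in> borel_measurable lebesgue" "g \<in> borel_measurable lebesgue" "AE x in lebesgue. f x = g x"
  shows "Lp_norm p f = Lp_norm p g"
proof -
  have "esssup lebesgue (\<lambda>x. ennreal (norm (f x))) = esssup lebesgue (\<lambda>x. ennreal (norm (g x)))"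
    using assms(3) by (intro esssup_AE_cong) (use assms in auto)
  moreover have "(\<integral>\<^sup>+x. ennreal (norm (f x) powr r) \<partial>lebesgue) = (\<integral>\<^sup>+x. ennreal (norm (g x) powr r) \<partial>lebesgue)" for r
    by (rule nn_integral_cong_AE) (use assms(3) in auto)
  ultimately show ?thesis by (simp add: Lp_norm_def)
qed

lemma dist_of_cong_AE:
  assumes "f \<in> borel_measurable lebesgue" "g \<in> borel_measurable lebesgue" "AE x in lebesgue. f x = g x"
    and "\<phi> \<in> borel_measurable lebesgue"
  shows "dist_of f \<phi> = dist_of g \<phi>"
  unfolding dist_of_def by (rule integral_cong_AE) (use assms in auto)

text \<open>Members of \<open>Lp\<close> are Lebesgue measurable, whereas the kernel calculus is set
  up for Borel functions; this lemma mediates between the two.\<close>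

lemma borel_representative:
  fixes f :: "'a::euclidean_space \<Rightarrow> complex"
  assumes "f \<in> borel_measurable lebesgue"
  obtains g where "g \<in> borel_measurable borel" "AE x in lebesgue. f x = g x"
proof -
  have "(\<lambda>x. Re (f x)) \<in> borel_measurable (completion lborel)" "(\<lambda>x. Im (f x)) \<in> borel_measurable (completion lborel)"
    using assms by measurable
  then obtain u v where u: "u \<in> borel_measurable lborel" "AE x in lborel. Re (f x) = u x"
    and v: "v \<in> borel_measurable lborel" "AE x in lborel. Im (f x) = v x"
    using completion_ex_borel_measurable_real by metis
  show thesis
  proof
    show "(\<lambda>x. Complex (u x) (v x)) \<in> borel_measurable borel"
      using u v by (simp add: borel_measurable_complex_iff)
    have "AE x in lborel. f x = Complex (u x) (v x)" using u(2) v(2) by eventually_elim (simp add: complex_eq_iff)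
    then show "AE x in lebesgue. f x = Complex (u x) (v x)" by (rule AE_completion)
  qed
qed

lemma schwartz_measurable: "\<phi> \<in> schwartz \<Longrightarrow> \<phi> \<in> borel_measurable borel"
  by (auto simp: schwartz_def intro!: borel_measurable_continuous_onI smooth_continuous_on)

text \<open>The inverse of \<open>wt\<close> expands into squares of monomials, one for each set of
  coordinates. Schwartz bounds for these finitely many monomials give decay like
  \<open>wt\<close>.\<close>

lemma schwartz_integrable:
  fixes \<phi> :: "real^'n::finite \<Rightarrow> complex"
  assumes \<phi>: "\<phi> \<in> schwartz"
  shows "integrable lborel \<phi>"
proof -
  have "\<exists>B. \<forall>x. norm ((\<Prod>i\<in>A. (x $ i)\<^sup>2) *\<^sub>R \<phi> x) \<le> B" for A :: "'n set"
  proof -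
    have "bounded (range (\<lambda>x. (\<Prod>i\<in>UNIV. (x $ i) ^ \<beta> i) *\<^sub>R partial_derivs js \<phi> x))" for \<beta> js
      using \<phi> by (simp add: schwartz_def)
    \<comment> \<open>The exponents that produce the monomial of the set \<open>A\<close>, with no
      derivative taken.\<close>
    from this[of "\<lambda>i. if i \<in> A then 2 else 0" "[]"]
    have "bounded (range (\<lambda>x. (\<Prod>i\<in>UNIV. (x $ i) ^ (if i \<in> A then 2 else 0)) *\<^sub>R partial_derivs [] \<phi> x))" .
    moreover have "(\<Prod>i\<in>UNIV. (x $ i) ^ (if i \<in> A then 2 else 0)) = (\<Prod>i\<in>A. (x $ i)\<^sup>2)" for x :: "real^'n"
      by (rule prod.mono_neutral_cong_right) auto
    ultimately show ?thesis by (auto simp: bounded_iff)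
  qed
  then obtain B where B: "\<And>A x. norm ((\<Prod>i\<in>A. (x $ i)\<^sup>2) *\<^sub>R \<phi> x) \<le> B A" by metis
  have decay: "norm (\<phi> x) \<le> (\<Sum>A\<in>Pow UNIV. B A) * wt x" for x
  proof -
    have w: "inverse (wt x) = (\<Prod>i\<in>UNIV. (x $ i)\<^sup>2 + 1)"
      by (simp add: wt_def prod_inversef[symmetric] o_def add.commute)
    have "inverse (wt x) * norm (\<phi> x) = (\<Sum>A\<in>Pow UNIV. (\<Prod>i\<in>A. (x $ i)\<^sup>2) * norm (\<phi> x))"
      unfolding w by (simp add: prod_add sum_distrib_right)
    also have "\<dots> = (\<Sum>A\<in>Pow UNIV. norm ((\<Prod>i\<in>A. (x $ i)\<^sup>2) *\<^sub>R \<phi> x))"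
      by (intro sum.cong refl) (simp add: abs_of_nonneg prod_nonneg)
    also have "\<dots> \<le> (\<Sum>A\<in>Pow UNIV. B A)" by (intro sum_mono B)
    finally show ?thesis using wt_pos[of x] by (simp add: field_simps)
  qed
  show ?thesis
  proof (rule Bochner_Integration.integrable_bound)
    show "integrable lborel (\<lambda>x :: real^'n. (\<Sum>A\<in>Pow (UNIV :: 'n set). B A) * wt x)"
      by (intro integrable_mult_right integrable_wt)
    show "AE x in lborel. norm (\<phi> x) \<le> norm ((\<Sum>A\<in>Pow (UNIV :: 'n set). B A) * wt x)"
      unfolding real_norm_def by (intro AE_I2 order_trans[OF decay] abs_ge_self)
  qed (use schwartz_measurable[OF \<phi>] in simp)
qed

section \<open>The frequency-uniform decomposition operators as multipliers\<close>

context unit_partition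
begin

text \<open>The function that represents \<open>Box\<close>. Its factor is the product of the
  normalising factors of the two Fourier transforms.\<close>

definition Bx :: "int^'n \<Rightarrow> (real^'n \<Rightarrow> complex) \<Rightarrow> real^'n \<Rightarrow> complex" where
  "Bx k f x = complex_of_real (inverse ((2 * pi) ^ CARD('n))) * filt (sg k) f x"

lemma norm_const_square: "((2 * pi) powr (- (real CARD('n) / 2))) * ((2 * pi) powr (- (real CARD('n) / 2))) = inverse ((2 * pi) ^ CARD('n))"
proof -
  have "((2 * pi) powr (- (real CARD('n) / 2))) * ((2 * pi) powr (- (real CARD('n) / 2))) = (2 * pi) powr (- real CARD('n))"
    unfolding powr_add[symmetric] by simp
  also have "\<dots> = inverse ((2 * pi) ^ CARD('n))"
    by (subst powr_minus, subst powr_realpow) simp_all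
  finally show ?thesis .
qed

text \<open>\<open>Box\<close> is defined by transposition, so what it does to \<open>\<phi>\<close>
  has to be computed. Fubini's theorem turns it into a convolution, with the argument
  \<open>x - y\<close> opposite to that in \<open>filt\<close>.\<close>

lemma fourier_sg_inv_fourier:
  assumes \<phi>: "integrable lborel \<phi>"
  shows "fourier (\<lambda>\<xi>. complex_of_real (sigma \<rho> k \<xi>) * inv_fourier \<phi> \<xi>) x
    = complex_of_real (inverse ((2 * pi) ^ CARD('n))) * (\<integral>y. FT (sg k) (x - y) * \<phi> y \<partial>lborel)"
proof -
  define c where "c = complex_of_real ((2 * pi) powr (- (real CARD('n) / 2)))"
  have cc: "c * c = complex_of_real (inverse ((2 * pi) ^ CARD('n)))"
    unfolding c_def of_real_mult[symmetric] norm_const_square ..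
  have [measurable]: "\<phi> \<in> borel_measurable borel" using \<phi> by auto
  have [measurable]: "sg k \<in> borel_measurable borel" by (rule test_function_measurable[OF test_function_sg])
  have inv: "inv_fourier \<phi> \<xi> = c * (\<integral>y. \<phi> y * iexp (\<xi> \<bullet> y) \<partial>lborel)" for \<xi>
    unfolding inv_fourier_def c_def by (subst integral_completion) auto
  have [measurable]: "(\<lambda>\<xi>. \<integral>y. \<phi> y * iexp (\<xi> \<bullet> y) \<partial>lborel) \<in> borel_measurable borel"
  proof -
    have "(\<lambda>\<xi>. \<integral>y. \<phi> y * iexp (\<xi> \<bullet> y) \<partial>lborel) \<in> borel_measurable lborel"
      by (rule lborel.borel_measurable_lebesgue_integral) measurable
    then show ?thesis by simp
  qed
  have "fourier (\<lambda>\<xi>. complex_of_real (sigma \<rho> k \<xi>) * inv_fourier \<phi> \<xi>) x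
      = c * (\<integral>\<xi>. sg k \<xi> * inv_fourier \<phi> \<xi> * mexp (x \<bullet> \<xi>) \<partial>lborel)"
  proof -
    have meas: "(\<lambda>\<xi>. sg k \<xi> * inv_fourier \<phi> \<xi> * mexp (\<xi> \<bullet> x)) \<in> borel_measurable lborel"
      unfolding inv by measurable
    show ?thesis
      unfolding fourier_def c_def[symmetric] sg_def[symmetric] integral_completion[OF meas]
      by (simp only: inner_commute)
  qed
  also have "\<dots> = c * (\<integral>\<xi>. c * (\<integral>y. sg k \<xi> * \<phi> y * mexp ((x - y) \<bullet> \<xi>) \<partial>lborel) \<partial>lborel)"
  proof (rule arg_cong[where f = "(*) c"], rule Bochner_Integration.integral_cong[OF refl])
    fix \<xi>
    have "mexp ((x - y) \<bullet> \<xi>) = iexp (\<xi> \<bullet> y) * mexp (x \<bullet> \<xi>)" for y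
      unfolding exp_add[symmetric] by (simp add: inner_diff_left inner_commute algebra_simps)
    then have "(\<integral>y. sg k \<xi> * \<phi> y * mexp ((x - y) \<bullet> \<xi>) \<partial>lborel)
        = (\<integral>y. (sg k \<xi> * mexp (x \<bullet> \<xi>)) * (\<phi> y * iexp (\<xi> \<bullet> y)) \<partial>lborel)"
      by (simp only: mult_ac)
    also have "\<dots> = (sg k \<xi> * mexp (x \<bullet> \<xi>)) * (\<integral>y. \<phi> y * iexp (\<xi> \<bullet> y) \<partial>lborel)"
      by (rule integral_mult_right_zero)
    finally show "sg k \<xi> * inv_fourier \<phi> \<xi> * mexp (x \<bullet> \<xi>)
        = c * (\<integral>y. sg k \<xi> * \<phi> y * mexp ((x - y) \<bullet> \<xi>) \<partial>lborel)"
      unfolding inv by (simp only: mult_ac)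
  qed
  also have "\<dots> = (c * c) * (\<integral>\<xi>. \<integral>y. sg k \<xi> * \<phi> y * mexp ((x - y) \<bullet> \<xi>) \<partial>lborel \<partial>lborel)"
    unfolding integral_mult_right_zero mult.assoc ..
  also have "(\<integral>\<xi>. \<integral>y. sg k \<xi> * \<phi> y * mexp ((x - y) \<bullet> \<xi>) \<partial>lborel \<partial>lborel)
      = (\<integral>y. \<integral>\<xi>. sg k \<xi> * \<phi> y * mexp ((x - y) \<bullet> \<xi>) \<partial>lborel \<partial>lborel)"
    by (rule Fubini_swap_product_bound[OF _ test_function_integrable[OF test_function_sg[of k]] \<phi>]) (auto simp: norm_mult)
  also have "\<dots> = (\<integral>y. (\<integral>\<xi>. (sg k \<xi> * mexp ((x - y) \<bullet> \<xi>)) * \<phi> y \<partial>lborel) \<partial>lborel)"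
    by (simp only: mult_ac)
  also have "\<dots> = (\<integral>y. FT (sg k) (x - y) * \<phi> y \<partial>lborel)"
    unfolding integral_mult_left_zero FT_def ..
  finally show ?thesis unfolding cc .
qed

lemma uloc_Bx: "uloc f \<Longrightarrow> uloc (Bx k f)"
proof -
  assume f: "uloc f"
  obtain C where C: "\<And>x. norm (filt (sg k) f x) \<le> C" using filt_bounded[OF f test_function_sg] by blast
  have [measurable]: "filt (sg k) f \<in> borel_measurable borel" by (rule filt_measurable[OF f test_function_sg])
  show "uloc (Bx k f)"
  proof (rule uloc_bounded)
    show "Bx k f \<in> borel_measurable borel" unfolding Bx_def[abs_def] by measurable
    show "norm (Bx k f x) \<le> inverse ((2 * pi) ^ CARD('n)) * C" for x
      unfolding Bx_def norm_mult using C by (intro mult_mono) (auto simp: norm_inverse norm_power norm_mult)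
  qed
qed

lemma Bx_measurable: "uloc f \<Longrightarrow> Bx k f \<in> borel_measurable borel"
  using uloc_Bx uloc_measurable by blast

text \<open>The transposed kernel is moved back from \<open>\<phi>\<close> to \<open>f\<close> by
  \<open>filt_pairing\<close>.\<close>

lemma Box_eq_Bx:
  assumes f: "uloc f" and \<phi>: "\<phi> \<in> schwartz"
  shows "Box \<rho> k f \<phi> = (\<integral>y. Bx k f y * \<phi> y \<partial>lborel)"
proof -
  define c where "c = complex_of_real (inverse ((2 * pi) ^ CARD('n)))"
  have [measurable]: "f \<in> borel_measurable borel" "\<phi> \<in> borel_measurable borel" "FT (sg k) \<in> borel_measurable borel"
    using uloc_measurable[OF f] schwartz_measurable[OF \<phi>] FT_measurable[OF test_function_sg] by auto
  have [measurable]: "(\<lambda>x. \<integral>y. FT (sg k) (x - y) * \<phi> y \<partial>lborel) \<in> borel_measurable borel"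
  proof -
    have "(\<lambda>x. \<integral>y. FT (sg k) (x - y) * \<phi> y \<partial>lborel) \<in> borel_measurable lborel"
      by (rule lborel.borel_measurable_lebesgue_integral) measurable
    then show ?thesis by simp
  qed
  have "Box \<rho> k f \<phi> = (\<integral>x. f x * (c * (\<integral>y. FT (sg k) (x - y) * \<phi> y \<partial>lborel)) \<partial>lebesgue)"
    unfolding Box_def dist_inv_fourier_def dist_mult_def dist_fourier_def dist_of_def
      fourier_sg_inv_fourier[OF schwartz_integrable[OF \<phi>]] c_def ..
  also have "\<dots> = (\<integral>x. c * (f x * (\<integral>y. FT (sg k) (x - y) * \<phi> y \<partial>lborel)) \<partial>lborel)"
    by (subst integral_completion) (simp_all only: mult_ac, measurable)
  also have "\<dots> = c * (\<integral>y. filt (sg k) f y * \<phi> y \<partial>lborel)"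
    unfolding integral_mult_right_zero filt_pairing[OF f test_function_sg schwartz_integrable[OF \<phi>]] ..
  also have "\<dots> = (\<integral>y. Bx k f y * \<phi> y \<partial>lborel)"
    unfolding Bx_def c_def[symmetric] integral_mult_right_zero[symmetric] mult.assoc ..
  finally show ?thesis .
qed

section \<open>Blocks as functions against norms of distributions\<close>

lemma dist_Lp_norm_Box_le:
  assumes f: "uloc f" and p: "1 \<le> p"
  shows "dist_Lp_norm p (Box \<rho> k f) \<le> pnorm p (Bx k f)"
proof (cases "pnorm p (Bx k f) = \<infinity>")
  case False
  have m [measurable]: "Bx k f \<in> borel_measurable borel" by (rule Bx_measurable[OF f])
  have norm: "Lp_norm p (Bx k f) = pnorm p (Bx k f)"
    by (rule Lp_norm_eq_eLp[OF m p])
  have "Bx k f \<in> Lp p"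
    using False norm by (auto simp: Lp_def less_top intro!: measurable_completion)
  moreover have "Box \<rho> k f \<phi> = dist_of (Bx k f) \<phi>" if "\<phi> \<in> schwartz" for \<phi>
    unfolding Box_eq_Bx[OF f that] dist_of_def
    using schwartz_measurable[OF that] by (intro integral_completion[symmetric]) simp
  ultimately show ?thesis
    unfolding dist_Lp_norm_def norm[symmetric] by (intro Inf_lower) blast
qed simp

text \<open>Since \<open>cut k\<close> is 1 on the support of \<open>sg k\<close>, filtering by it
  reproduces the block. That filter at x is a pairing with a Schwartz function, so it can be
  evaluated on any representative \<open>h\<close>, here through a Borel version
  \<open>g\<close>.\<close>

lemma Bx_eq_filt_cut:
  assumes f: "uloc f" and p: "1 \<le> p" and h: "h \<in> Lp p" and rep: "\<And>\<phi>. \<phi> \<in> schwartz \<Longrightarrow> Box \<rho> k f \<phi> = dist_of h \<phi>"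
  obtains g where "uloc g" "Lp_norm p h = pnorm p g"
    "\<And>x. Bx k f x = complex_of_real (inverse ((2 * pi) ^ CARD('n))) * filt (cut k) g x"
proof -
  have hm: "h \<in> borel_measurable lebesgue" using h by (simp add: Lp_def)
  obtain g where g: "g \<in> borel_measurable borel" "AE x in lebesgue. h x = g x"
    using borel_representative[OF hm] by blast
  have gm: "g \<in> borel_measurable lebesgue" using g by (intro measurable_completion) simp
  have norm: "Lp_norm p h = pnorm p g"
    using Lp_norm_cong_AE[OF hm gm g(2)] Lp_norm_eq_eLp[OF g(1) p] by simp
  have ug: "uloc g"
    using uloc_Lp[OF p g(1)] h norm by (simp add: Lp_def)
  have "Bx k f x = complex_of_real (inverse ((2 * pi) ^ CARD('n))) * filt (cut k) g x" for x
  proof -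
    \<comment> \<open>A translate of \<open>FT (cut k)\<close> is the transform of the modulated
      symbol, which is again a test function; hence it is Schwartz.\<close>
    define \<phi> where "\<phi> y = FT (cut k) (y - x)" for y
    have "\<phi> = FT (\<lambda>\<xi>. cut k \<xi> * iexp (\<xi> \<bullet> x))"
    proof
      fix y
      have "mexp ((y - x) \<bullet> \<xi>) = iexp (\<xi> \<bullet> x) * mexp (y \<bullet> \<xi>)" for \<xi>
        unfolding exp_add[symmetric] by (simp add: inner_diff_left inner_commute algebra_simps)
      then show "\<phi> y = FT (\<lambda>\<xi>. cut k \<xi> * iexp (\<xi> \<bullet> x)) y"
        unfolding \<phi>_def FT_def mult.assoc by (simp only:)
    qed
    then have \<phi>: "\<phi> \<in> schwartz"
      using FT_schwartz[OF test_function_mult[OF test_function_cut smooth_exp_inner]] by simp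
    have \<phi>m: "\<phi> \<in> borel_measurable borel" by (rule schwartz_measurable[OF \<phi>])
    have "filt (cut k) (Bx k f) x = Box \<rho> k f \<phi>"
      unfolding Box_eq_Bx[OF f \<phi>] filt_def \<phi>_def ..
    also have "\<dots> = dist_of g \<phi>"
      unfolding rep[OF \<phi>] using \<phi>m by (intro dist_of_cong_AE hm gm g measurable_completion) simp
    also have "\<dots> = filt (cut k) g x"
      unfolding dist_of_def filt_def \<phi>_def[symmetric] using g(1) \<phi>m by (intro integral_completion) simp
    finally have "filt (cut k) (Bx k f) x = filt (cut k) g x" .
    moreover have "filt (cut k) (Bx k f) x = filt (sg k) f x"
      unfolding Bx_def[abs_def] filt_cmult filt_filt[OF f test_function_sg test_function_cut] cut_sg
      by (simp add: field_simps)
    ultimately show ?thesis unfolding Bx_def by simp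
  qed
  then show thesis using that ug norm by blast
qed

text \<open>The infimum is taken after dividing by \<open>K\<close>. If nothing represents
  \<open>T\<close>, it is infinite, and positivity of \<open>K\<close> keeps the right-hand side
  infinite.\<close>

lemma le_dist_Lp_normI:
  fixes K :: real
  assumes K: "K > 0" and le: "\<And>h. h \<in> Lp p \<Longrightarrow> (\<And>\<phi>. \<phi> \<in> schwartz \<Longrightarrow> T \<phi> = dist_of h \<phi>) \<Longrightarrow> A \<le> ennreal K * Lp_norm p h"
  shows "A \<le> ennreal K * dist_Lp_norm p T"
proof -
  have "A / ennreal K \<le> dist_Lp_norm p T"
    unfolding dist_Lp_norm_def
  proof (rule Inf_greatest)
    fix t assume "t \<in> {Lp_norm p g | g. g \<in> Lp p \<and> (\<forall>\<phi>\<in>schwartz. T \<phi> = dist_of g \<phi>)}"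
    then obtain h where "t = Lp_norm p h" "h \<in> Lp p" "\<And>\<phi>. \<phi> \<in> schwartz \<Longrightarrow> T \<phi> = dist_of h \<phi>" by blast
    then show "A / ennreal K \<le> t"
      using le[of h] K by (simp add: divide_le_posI_ennreal mult.commute)
  qed
  then have "ennreal K * (A / ennreal K) \<le> ennreal K * dist_Lp_norm p T" by (rule mult_left_mono) simp
  then show ?thesis
    using K by (simp add: ennreal_times_divide mult_divide_eq_ennreal mult.commute[of "ennreal K" A])
qed

text \<open>The first bound is Young's inequality for the reproducing kernel, the second the
  Bernstein inequality. One \<open>K\<close> serves all p, f and k because
  |\<open>FT (cut k)\<close>| does not depend on k.\<close>

lemma Bx_bounds:
  obtains K :: real where "K > 0"
    "\<And>p f k. 1 \<le> p \<Longrightarrow> uloc f \<Longrightarrow>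
      pnorm p (Bx k f) \<le> ennreal K * dist_Lp_norm p (Box \<rho> k f)"
    "\<And>p f k x. 1 \<le> p \<Longrightarrow> uloc f \<Longrightarrow> ennreal (norm (Bx k f x)) \<le> ennreal K * dist_Lp_norm p (Box \<rho> k f)"
proof -
  obtain C where C: "C \<ge> 0" "\<And>x. norm (FT (cut 0) x) \<le> C * wt x" using FT_bound_wt[OF test_function_cut] by blast
  define c where "c = inverse ((2 * pi) ^ CARD('n))"
  have c: "c > 0" by (simp add: c_def)
  define J where "J = (\<integral>t. norm (FT (cut 0) t) \<partial>lborel)"
  define W where "W = C * max 1 (\<integral>y. wt (y :: real^'n) \<partial>lborel)"
  \<comment> \<open>The sum dominates both constants, and the added 1 makes \<open>K\<close>
    positive.\<close>
  define K where "K = c * (J + W) + 1"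
  have J: "J \<ge> 0" unfolding J_def by simp
  have W: "W \<ge> 0" unfolding W_def using C by simp
  have K: "c * J \<le> K" "c * W \<le> K" "K > 0"
    using mult_nonneg_nonneg[OF less_imp_le[OF c] J] mult_nonneg_nonneg[OF less_imp_le[OF c] W]
    unfolding K_def distrib_left by linarith+
  have normc: "ennreal (norm (complex_of_real c * z)) = ennreal c * ennreal (norm z)" for z
    using c by (simp add: norm_mult ennreal_mult)
  show thesis
  proof
    show "K > 0" by fact
    fix p f k assume p: "(1 :: ennreal) \<le> p" and f: "uloc (f :: real^'n \<Rightarrow> complex)"
    show "pnorm p (Bx k f) \<le> ennreal K * dist_Lp_norm p (Box \<rho> k f)"
    proof (rule le_dist_Lp_normI[OF K(3)])
      fix h assume h: "h \<in> Lp p" "\<And>\<phi>. \<phi> \<in> schwartz \<Longrightarrow> Box \<rho> k f \<phi> = dist_of h \<phi>"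
      obtain g where g: "uloc g" "Lp_norm p h = pnorm p g"
        "\<And>x. Bx k f x = complex_of_real (inverse ((2 * pi) ^ CARD('n))) * filt (cut k) g x"
        by (rule Bx_eq_filt_cut[OF f p h], assumption) (rule that)
      note g = g(1,2) g(3)[folded c_def]
      have [measurable]: "filt (cut k) g \<in> borel_measurable borel" by (rule filt_measurable[OF g(1) test_function_cut])
      have "pnorm p (Bx k f) \<le> ennreal c * pnorm p (filt (cut k) g)"
        unfolding g(3) normc by (rule eLp_cmult_le[OF p]) measurable
      also have "\<dots> \<le> ennreal c * (ennreal J * Lp_norm p h)"
        unfolding g(2) J_def norm_FT_cut[of k, symmetric] by (intro mult_left_mono eLp_filt p g test_function_cut) simp
      also have "\<dots> = ennreal (c * J) * Lp_norm p h" using c J by (simp add: ennreal_mult mult.assoc)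
      also have "\<dots> \<le> ennreal K * Lp_norm p h" by (intro mult_right_mono ennreal_leI K) simp
      finally show "pnorm p (Bx k f) \<le> ennreal K * Lp_norm p h" .
    qed
    fix x
    show "ennreal (norm (Bx k f x)) \<le> ennreal K * dist_Lp_norm p (Box \<rho> k f)"
    proof (rule le_dist_Lp_normI[OF K(3)])
      fix h assume h: "h \<in> Lp p" "\<And>\<phi>. \<phi> \<in> schwartz \<Longrightarrow> Box \<rho> k f \<phi> = dist_of h \<phi>"
      obtain g where g: "uloc g" "Lp_norm p h = pnorm p g"
        "\<And>x. Bx k f x = complex_of_real (inverse ((2 * pi) ^ CARD('n))) * filt (cut k) g x"
        by (rule Bx_eq_filt_cut[OF f p h], assumption) (rule that)
      note g = g(1,2) g(3)[folded c_def]
      have "ennreal (norm (Bx k f x)) \<le> ennreal c * (ennreal W * Lp_norm p h)"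
        unfolding g(2,3) normc W_def
        by (rule mult_left_mono[OF norm_filt_le_eLp[OF p g(1) test_function_cut C(1)]])
          (simp_all add: norm_FT_cut[of k] C(2))
      also have "\<dots> = ennreal (c * W) * Lp_norm p h" using c W by (simp add: ennreal_mult mult.assoc)
      also have "\<dots> \<le> ennreal K * Lp_norm p h" by (intro mult_right_mono ennreal_leI K) simp
      finally show "ennreal (norm (Bx k f x)) \<le> ennreal K * Lp_norm p h" .
    qed
  qed
qed

end

section \<open>Series of functions\<close>

text \<open>It holds for every \<open>f\<close> because the integral of a nonintegrable function is
  0 by convention.\<close>

lemma norm_integral_le_nn_integral:
  fixes f :: "'a \<Rightarrow> 'b::{banach, second_countable_topology}"
  shows "ennreal (norm (\<integral>x. f x \<partial>M)) \<le> (\<integral>\<^sup>+x. ennreal (norm (f x)) \<partial>M)"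
  by (cases "integrable M f") (auto simp: integral_norm_bound_ennreal not_integrable_integral_eq)

text \<open>The majorant \<open>\<beta> l\<close> is uniform in y, so its sum times the L^1 norm of
  \<open>u\<close> bounds the double integral.\<close>

lemma Fubini_series:
  fixes B :: "'i::countable \<Rightarrow> 'a::euclidean_space \<Rightarrow> complex"
  assumes B [measurable]: "\<And>l. B l \<in> borel_measurable borel" and \<beta>: "\<And>l y. ennreal (norm (B l y)) \<le> \<beta> l"
    and sum: "(\<integral>\<^sup>+l. \<beta> l \<partial>counting) < \<infinity>" and u: "integrable lborel u"
  shows "(\<integral>y. (\<integral>l. B l y \<partial>counting) * u y \<partial>lborel) = (\<integral>l. \<integral>y. B l y * u y \<partial>lborel \<partial>counting)"
proof -
  have [measurable]: "u \<in> borel_measurable borel" using u by auto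
  have "(\<integral>y. (\<integral>l. B l y \<partial>counting) * u y \<partial>lborel) = (\<integral>y. \<integral>l. B l y * u y \<partial>counting \<partial>lborel)"
    by simp
  also have "\<dots> = (\<integral>l. \<integral>y. B l y * u y \<partial>lborel \<partial>counting)"
  proof (rule Fubini_swap)
    show "(\<lambda>(y, l). B l y * u y) \<in> borel_measurable (lborel \<Otimes>\<^sub>M counting)"
      by (rule borel_measurable_count_space_pair2) measurable
    have "(\<integral>\<^sup>+y. \<integral>\<^sup>+l. ennreal (norm (B l y * u y)) \<partial>counting \<partial>lborel)
        \<le> (\<integral>\<^sup>+y. \<integral>\<^sup>+l. \<beta> l * ennreal (norm (u y)) \<partial>counting \<partial>lborel)"
      by (intro nn_integral_mono) (simp add: norm_mult ennreal_mult mult_right_mono \<beta>)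
    also have "\<dots> = (\<integral>\<^sup>+l. \<beta> l \<partial>counting) * (\<integral>\<^sup>+y. ennreal (norm (u y)) \<partial>lborel)"
      by (simp add: nn_integral_multc nn_integral_cmult)
    also have "\<dots> < \<infinity>"
      using sum nn_integral_norm_finite[OF u] by (simp add: ennreal_mult_less_top)
    finally show "(\<integral>\<^sup>+y. \<integral>\<^sup>+l. ennreal (norm (B l y * u y)) \<partial>counting \<partial>lborel) < \<infinity>" .
  qed (auto intro: lborel.sigma_finite_measure_axioms sigma_finite_count_space_UNIV)
  finally show ?thesis .
qed

lemma uloc_series:
  fixes B :: "'i::countable \<Rightarrow> real^'n::finite \<Rightarrow> complex"
  assumes B [measurable]: "\<And>l. B l \<in> borel_measurable borel" and \<beta>: "\<And>l y. ennreal (norm (B l y)) \<le> \<beta> l"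
    and sum: "(\<integral>\<^sup>+l. \<beta> l \<partial>counting) < \<infinity>"
  shows "uloc (\<lambda>y. \<integral>l. B l y \<partial>counting)"
    "ennreal (norm (\<integral>l. B l y \<partial>counting)) \<le> (\<integral>\<^sup>+l. \<beta> l \<partial>counting)"
proof -
  show le: "ennreal (norm (\<integral>l. B l y \<partial>counting)) \<le> (\<integral>\<^sup>+l. \<beta> l \<partial>counting)" for y
    by (rule order_trans[OF norm_integral_le_nn_integral nn_integral_mono]) (rule \<beta>)
  obtain S where S: "(\<integral>\<^sup>+l. \<beta> l \<partial>counting) = ennreal S" "S \<ge> 0"
    using sum by (cases "\<integral>\<^sup>+l. \<beta> l \<partial>counting") auto
  show "uloc (\<lambda>y. \<integral>l. B l y \<partial>counting)"
  proof (rule uloc_bounded)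
    have "(\<lambda>y. \<integral>l. B l y \<partial>counting) \<in> borel_measurable lborel"
    proof (rule sigma_finite_measure.borel_measurable_lebesgue_integral[OF sigma_finite_count_space_UNIV])
      show "(\<lambda>(y, l). B l y) \<in> borel_measurable (lborel \<Otimes>\<^sub>M counting)"
        by (rule borel_measurable_count_space_pair2) measurable
    qed
    then show "(\<lambda>y. \<integral>l. B l y \<partial>counting) \<in> borel_measurable borel" by simp
    show "norm (\<integral>l. B l y \<partial>counting) \<le> S" for y
      using le[of y] S by (simp add: ennreal_le_iff)
  qed
qed

lemma integral_count_space_eq_sum:
  fixes f :: "'i \<Rightarrow> complex"
  assumes "finite L" "\<And>l. l \<notin> L \<Longrightarrow> f l = 0"
  shows "(\<integral>l. f l \<partial>counting) = (\<Sum>l\<in>L. f l)"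
proof -
  have "finite {l. f l \<noteq> 0}" using assms by (auto intro: finite_subset)
  then have "(\<integral>l. f l \<partial>counting) = (\<Sum>l | f l \<noteq> 0. f l)"
    by (subst lebesgue_integral_count_space_finite_support) auto
  also have "\<dots> = (\<Sum>l\<in>L. f l)"
    using assms by (intro sum.mono_neutral_left) auto
  finally show ?thesis .
qed

lemma FT_sum: "finite L \<Longrightarrow> (\<And>l. l \<in> L \<Longrightarrow> integrable lborel (a l)) \<Longrightarrow> FT (\<lambda>\<xi>. \<Sum>l\<in>L. a l \<xi>) x = (\<Sum>l\<in>L. FT (a l) x)"
  unfolding FT_def sum_distrib_right by (intro Bochner_Integration.integral_sum integrable_FT_integrand)

lemma filt_sum:
  assumes "finite L" "\<And>l. l \<in> L \<Longrightarrow> test_function (a l)" "uloc f"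
  shows "filt (\<lambda>\<xi>. \<Sum>l\<in>L. a l \<xi>) f x = (\<Sum>l\<in>L. filt (a l) f x)"
  unfolding filt_def using assms
  by (simp add: FT_sum test_function_integrable sum_distrib_left Bochner_Integration.integral_sum filt_integrable)

text \<open>Two transpositions, first of the filter on \<open>g\<close> and then of that on
  \<open>f\<close>, leave the kernel integral that \<open>FT_triple_zero\<close> evaluates.\<close>

lemma filt_product_zero:
  fixes f g :: "real^'n::finite \<Rightarrow> complex"
  assumes f: "uloc f" and g: "uloc g" and a: "test_function a" and b: "test_function b" and c: "test_function c"
    and zero: "\<And>\<xi> \<eta>. a \<xi> * b \<eta> * c (\<xi> - \<eta>) = 0"
  shows "(\<integral>y. filt b f y * (filt c g y * FT a (y - x)) \<partial>lborel) = 0"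
proof -
  have [measurable]: "FT a \<in> borel_measurable borel" "FT b \<in> borel_measurable borel" "filt c g \<in> borel_measurable borel"
    using FT_measurable a b filt_measurable[OF g c] by blast+
  have inta: "integrable lborel (\<lambda>y. FT a (y - x))"
    using integrable_lborel_shift(1)[OF FT_integrable[OF a], of "- x"] by simp
  obtain C where C: "\<And>x. norm (filt c g x) \<le> C" using filt_bounded[OF g c] by blast
  have int1: "integrable lborel (\<lambda>y. filt c g y * FT a (y - x))"
    by (rule Bochner_Integration.integrable_bound[OF integrable_mult_right[OF integrable_norm[OF inta], of C]])
      (use C order_trans[OF norm_ge_zero C] in \<open>auto simp: norm_mult intro!: AE_I2 mult_right_mono\<close>)
  have int2: "integrable lborel (\<lambda>y. FT b (z - y) * FT a (y - x))" for z
    by (rule Bochner_Integration.integrable_bound[OF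
          integrable_mult_right[OF integrable_norm[OF inta], of "\<integral>\<xi>. norm (b \<xi>) \<partial>lborel"]])
      (use FT_bound[OF test_function_integrable[OF b]] in \<open>auto simp: norm_mult intro!: mult_right_mono\<close>)
  have inner: "(\<integral>y. FT b (z - y) * (filt c g y * FT a (y - x)) \<partial>lborel) = 0" for z
  proof -
    have "(\<integral>y. FT b (z - y) * (filt c g y * FT a (y - x)) \<partial>lborel) = (\<integral>y. filt c g y * (FT b (z - y) * FT a (y - x)) \<partial>lborel)"
      by (simp only: mult_ac)
    also have "\<dots> = (\<integral>w. g w * (\<integral>y. FT c (w - y) * (FT b (z - y) * FT a (y - x)) \<partial>lborel) \<partial>lborel)"
      by (rule filt_pairing[OF g c int2])
    also have "\<dots> = (\<integral>w. g w * (\<integral>y. FT a (y - x) * (FT b (z - y) * FT c (w - y)) \<partial>lborel) \<partial>lborel)"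
      by (simp only: mult_ac)
    also have "\<dots> = 0" unfolding FT_triple_zero[OF a b c zero] by simp
    finally show ?thesis .
  qed
  show ?thesis unfolding filt_pairing[OF f b int1] inner by simp
qed

section \<open>Reconstruction and products\<close>

context unit_partition
begin

lemma filt_Bx:
  assumes f: "uloc f" and a: "test_function a"
  shows "filt a (Bx k f) x = filt (\<lambda>\<xi>. a \<xi> * sg k \<xi>) f x"
  unfolding Bx_def[abs_def] filt_cmult filt_filt[OF f test_function_sg a] by (simp add: field_simps)

text \<open>The series of the blocks of \<open>f\<close>, once it converges uniformly, has the same convolutions as \<open>f\<close>
  with all band-limited kernels.\<close>

lemma AE_eq_series_Bx:
  assumes f: "uloc f" and \<beta>: "\<And>l y. ennreal (norm (Bx l f y)) \<le> \<beta> l"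
    and sum: "(\<integral>\<^sup>+l. \<beta> l \<partial>counting) < \<infinity>"
  shows "AE x in lborel. f x = (\<integral>l. Bx l f x \<partial>counting)"
proof -
  note m = Bx_measurable[OF f]
  define F where "F y = (\<integral>l. Bx l f y \<partial>counting)" for y
  have F: "uloc F" unfolding F_def using m \<beta> sum by (rule uloc_series(1))
  have eq: "filt a F x = filt a f x" if a: "test_function a" for a x
  proof -
    obtain R where R: "\<And>\<xi>. a \<xi> \<noteq> 0 \<Longrightarrow> norm \<xi> \<le> R" using a unfolding test_function_def by blast
    \<comment> \<open>Only the finitely many symbols in \<open>L\<close> meet the support of
      \<open>a\<close>, and there they add up to 1; tested with \<open>a\<close>, the series becomes
      a finite sum.\<close>
    obtain L where L: "finite L" "\<And>m \<xi>. norm \<xi> \<le> R \<Longrightarrow> \<rho> (\<xi> - lattice_vec m) \<noteq> 0 \<Longrightarrow> m \<in> L"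
      using finite_lattice_near by blast
    have zero: "a \<xi> * sg l \<xi> = 0" if "l \<notin> L" for l \<xi>
      using L(2)[of \<xi> l] R[of \<xi>] that by (auto simp: sg_def sigma_eq)
    have one: "(\<Sum>l\<in>L. a \<xi> * sg l \<xi>) = a \<xi>" for \<xi>
    proof (cases "a \<xi> = 0")
      case False
      have "(\<Sum>l\<in>L. sg l \<xi>) = 1" using L(2)[OF R[OF False]] by (intro sum_sg L(1))
      then show ?thesis by (simp flip: sum_distrib_left)
    qed simp
    have "integrable lborel (\<lambda>y. FT a (y - x))"
      using integrable_lborel_shift(1)[OF FT_integrable[OF a], of "- x"] by simp
    then have "filt a F x = (\<integral>l. filt a (Bx l f) x \<partial>counting)"
      unfolding filt_def F_def using m \<beta> sum by (intro Fubini_series)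
    also have "\<dots> = (\<integral>l. filt (\<lambda>\<xi>. a \<xi> * sg l \<xi>) f x \<partial>counting)"
      unfolding filt_Bx[OF f a] ..
    also have "\<dots> = (\<Sum>l\<in>L. filt (\<lambda>\<xi>. a \<xi> * sg l \<xi>) f x)"
      by (rule integral_count_space_eq_sum[OF L(1)]) (simp add: zero filt_def FT_def)
    also have "\<dots> = filt (\<lambda>\<xi>. \<Sum>l\<in>L. a \<xi> * sg l \<xi>) f x"
      by (rule filt_sum[symmetric]) (auto intro!: L f test_function_mult a test_function_smooth test_function_sg)
    finally show ?thesis by (simp add: one)
  qed
  have "AE x in lborel. f x - F x = 0"
  proof (rule filt_zero_imp_AE_zero[OF uloc_diff[OF f F] test_function_rho])
    show "complex_of_real (\<rho> 0) \<noteq> 0" using rho_one[of 0] by simp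
    show "filt b (\<lambda>x. f x - F x) x = 0" if "test_function b" for b x
      using that by (simp add: filt_diff f F eq)
  qed
  then show ?thesis by (simp add: F_def)
qed

text \<open>The 3 adds up three unit cubes: one each for the frequencies of the output block and of
  the two factors.\<close>

definition near :: "int^'n \<Rightarrow> bool" where
  "near j \<longleftrightarrow> (\<forall>i. \<bar>j $ i\<bar> \<le> 3)"

lemma sg_product_zero:
  assumes "\<not> near (k - l - m)"
  shows "sg k \<xi> * sg l \<eta> * sg m (\<xi> - \<eta>) = 0"
proof (rule ccontr)
  assume "\<not> ?thesis"
  then have nz: "sg k \<xi> \<noteq> 0" "sg l \<eta> \<noteq> 0" "sg m (\<xi> - \<eta>) \<noteq> 0" by auto
  have "\<bar>(k - l - m) $ i\<bar> \<le> 3" for i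
  proof -
    have "\<bar>real_of_int (k $ i) - real_of_int (l $ i) - real_of_int (m $ i)\<bar> \<le> 3"
      using sg_support[OF nz(1), of i] sg_support[OF nz(2), of i] sg_support[OF nz(3), of i]
      unfolding vector_minus_component by linarith
    then have "real_of_int \<bar>(k - l - m) $ i\<bar> \<le> real_of_int 3" by simp
    then show ?thesis unfolding of_int_le_iff .
  qed
  then show False using assms by (simp add: near_def)
qed

text \<open>The blocks of \<open>g\<close> enter through their suprema, those of \<open>f\<close>
  through their L^p norms. The factors of \<open>H\<close> are the series themselves, which are
  Borel, bounded and defined everywhere.\<close>

lemma eLp_Bx_product:
  fixes f g :: "real^'n \<Rightarrow> complex"
  assumes p: "1 \<le> p" and f: "uloc f" and g: "uloc g"
    and \<beta>: "\<And>l y. ennreal (norm (Bx l f y)) \<le> \<beta> l" and sum\<beta>: "(\<integral>\<^sup>+l. \<beta> l \<partial>counting) < \<infinity>"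
    and \<gamma>: "\<And>m y. ennreal (norm (Bx m g y)) \<le> \<gamma> m" and sum\<gamma>: "(\<integral>\<^sup>+m. \<gamma> m \<partial>counting) < \<infinity>"
  defines "H \<equiv> \<lambda>y. (\<integral>l. Bx l f y \<partial>counting) * (\<integral>m. Bx m g y \<partial>counting)"
  shows "uloc H"
    and "pnorm p (Bx k H)
      \<le> ennreal (inverse ((2 * pi) ^ CARD('n)) * (\<integral>t. norm (FT (sg 0) t) \<partial>lborel)) *
        (\<integral>\<^sup>+l. (\<integral>\<^sup>+m. (if near (k - l - m) then \<gamma> m else 0) \<partial>counting) *
          pnorm p (Bx l f) \<partial>counting)"
proof -
  note mf [measurable] = Bx_measurable[OF f] and mg [measurable] = Bx_measurable[OF g]
  define F where "F y = (\<integral>l. Bx l f y \<partial>counting)" for y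
  define G where "G y = (\<integral>m. Bx m g y \<partial>counting)" for y
  have F: "uloc F" "\<And>y. ennreal (norm (F y)) \<le> (\<integral>\<^sup>+l. \<beta> l \<partial>counting)"
    unfolding F_def using uloc_series[OF mf \<beta> sum\<beta>] by auto
  have G: "uloc G" "\<And>y. ennreal (norm (G y)) \<le> (\<integral>\<^sup>+m. \<gamma> m \<partial>counting)"
    unfolding G_def using uloc_series[OF mg \<gamma> sum\<gamma>] by auto
  have [measurable]: "F \<in> borel_measurable borel" "G \<in> borel_measurable borel"
    using F G uloc_measurable by blast+
  obtain S where S: "(\<integral>\<^sup>+l. \<beta> l \<partial>counting) = ennreal S" "S \<ge> 0"
    using sum\<beta> by (cases "\<integral>\<^sup>+l. \<beta> l \<partial>counting") auto
  obtain T where T: "(\<integral>\<^sup>+l. \<gamma> l \<partial>counting) = ennreal T" "T \<ge> 0"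
    using sum\<gamma> by (cases "\<integral>\<^sup>+l. \<gamma> l \<partial>counting") auto
  have nF: "norm (F y) \<le> S" and nG: "norm (G y) \<le> T" for y
    using F(2)[of y] G(2)[of y] S T by (simp_all add: ennreal_le_iff)
  have H: "H = (\<lambda>y. F y * G y)" by (simp add: H_def F_def G_def)
  show uH: "uloc H"
    unfolding H by (rule uloc_bounded[where C = "S * T"]) (auto simp: norm_mult S T intro!: mult_mono nF nG)
  define c where "c = inverse ((2 * pi) ^ CARD('n))"
  have c: "c > 0" by (simp add: c_def)
  define W where "W = (\<integral>t. norm (FT (sg 0) t) \<partial>lborel)"
  define V where "V l = (\<integral>\<^sup>+m. (if near (k - l - m) then \<gamma> m else 0) \<partial>counting)" for l
  define P where "P l x = (\<integral>\<^sup>+y. ennreal (norm (Bx l f y) * norm (FT (sg k) (y - x))) \<partial>lborel)" for l x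
  have FTk [measurable]: "FT (sg k) \<in> borel_measurable borel" by (rule FT_measurable[OF test_function_sg])
  have P_meas [measurable]: "P l \<in> borel_measurable borel" for l
  proof -
    have "(\<lambda>x. \<integral>\<^sup>+y. ennreal (norm (Bx l f y) * norm (FT (sg k) (y - x))) \<partial>lborel) \<in> borel_measurable lborel"
      by (rule lborel.borel_measurable_nn_integral) measurable
    then show ?thesis by (simp add: P_def[abs_def])
  qed
  have intk: "integrable lborel (\<lambda>y. FT (sg k) (y - x))" for x
    using integrable_lborel_shift(1)[OF FT_integrable[OF test_function_sg[of k]], of "- x"] by simp
  have pt: "ennreal (norm (filt (sg k) H x)) \<le> (\<integral>\<^sup>+l. V l * P l x \<partial>counting)" for x
  proof -
    \<comment> \<open>Supplies the integrable function that \<open>Fubini_series\<close> demands,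
      when the series is expanded first in l and then in m.\<close>
    have bounded_int: "integrable lborel (\<lambda>y. h y * FT (sg k) (y - x))"
      if [measurable]: "h \<in> borel_measurable borel" and h: "\<And>y. norm (h y) \<le> C" for h and C :: real
      by (rule Bochner_Integration.integrable_bound[OF integrable_mult_right[OF integrable_norm[OF intk[of x]], of C]])
        (use h order_trans[OF norm_ge_zero h] in \<open>auto simp: norm_mult intro!: AE_I2 mult_right_mono\<close>)
    define I where "I l m = (\<integral>y. Bx m g y * (Bx l f y * FT (sg k) (y - x)) \<partial>lborel)" for l m
    have "filt (sg k) H x = (\<integral>y. F y * (G y * FT (sg k) (y - x)) \<partial>lborel)"
      unfolding filt_def H by (simp only: mult.assoc)
    also have "\<dots> = (\<integral>l. \<integral>y. Bx l f y * (G y * FT (sg k) (y - x)) \<partial>lborel \<partial>counting)"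
      unfolding F_def by (rule Fubini_series[OF mf \<beta> sum\<beta> bounded_int[OF _ nG]]) measurable
    also have "\<dots> = (\<integral>l. \<integral>y. G y * (Bx l f y * FT (sg k) (y - x)) \<partial>lborel \<partial>counting)"
      by (simp only: mult_ac)
    also have "\<dots> = (\<integral>l. \<integral>m. I l m \<partial>counting \<partial>counting)"
    proof (rule Bochner_Integration.integral_cong[OF refl])
      fix l
      obtain C where "\<And>y. norm (filt (sg l) f y) \<le> C" using filt_bounded[OF f test_function_sg] by blast
      then have C: "norm (Bx l f y) \<le> c * C" for y
        using c unfolding Bx_def c_def[symmetric] norm_mult by (intro mult_mono) auto
      show "(\<integral>y. G y * (Bx l f y * FT (sg k) (y - x)) \<partial>lborel) = (\<integral>m. I l m \<partial>counting)"
        unfolding G_def I_def by (rule Fubini_series[OF mg \<gamma> sum\<gamma> bounded_int[OF _ C]]) measurable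
    qed
    finally have "ennreal (norm (filt (sg k) H x)) \<le> (\<integral>\<^sup>+l. \<integral>\<^sup>+m. ennreal (norm (I l m)) \<partial>counting \<partial>counting)"
      by (simp only:) (intro order_trans[OF norm_integral_le_nn_integral] nn_integral_mono norm_integral_le_nn_integral)
    \<comment> \<open>Pairs outside \<open>near\<close> vanish by the location of the spectra; in
      the remaining ones \<open>Bx m g\<close> is replaced by its supremum.\<close>
    also have "\<dots> \<le> (\<integral>\<^sup>+l. \<integral>\<^sup>+m. (if near (k - l - m) then \<gamma> m else 0) * P l x \<partial>counting \<partial>counting)"
    proof (intro nn_integral_mono)
      fix l m
      show "ennreal (norm (I l m)) \<le> (if near (k - l - m) then \<gamma> m else 0) * P l x"
      proof (cases "near (k - l - m)")
        case True
        have "ennreal (norm (I l m)) \<le> (\<integral>\<^sup>+y. ennreal (norm (Bx m g y * (Bx l f y * FT (sg k) (y - x)))) \<partial>lborel)"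
          unfolding I_def by (rule norm_integral_le_nn_integral)
        also have "\<dots> \<le> (\<integral>\<^sup>+y. \<gamma> m * ennreal (norm (Bx l f y) * norm (FT (sg k) (y - x))) \<partial>lborel)"
          by (intro nn_integral_mono) (simp add: norm_mult ennreal_mult mult_right_mono \<gamma>)
        also have "\<dots> = \<gamma> m * P l x" unfolding P_def by (rule nn_integral_cmult) measurable
        finally show ?thesis using True by simp
      next
        case False
        have "I l m = (\<integral>y. complex_of_real c * complex_of_real c * (filt (sg l) f y * (filt (sg m) g y * FT (sg k) (y - x))) \<partial>lborel)"
          unfolding I_def Bx_def c_def[symmetric] by (simp only: mult_ac)
        also have "\<dots> = 0"
          unfolding integral_mult_right_zero
            filt_product_zero[OF f g test_function_sg test_function_sg test_function_sg sg_product_zero[OF False]] by simp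
        finally show ?thesis by simp
      qed
    qed
    also have "\<dots> = (\<integral>\<^sup>+l. V l * P l x \<partial>counting)" unfolding V_def by (simp add: nn_integral_multc)
    finally show ?thesis .
  qed
  have [measurable]: "filt (sg k) H \<in> borel_measurable borel" by (rule filt_measurable[OF uH test_function_sg])
  have series_meas: "(\<lambda>x. \<integral>\<^sup>+l. V l * P l x \<partial>counting) \<in> borel_measurable lborel"
  proof (rule sigma_finite_measure.borel_measurable_nn_integral[OF sigma_finite_count_space_UNIV])
    show "(\<lambda>(x, l). V l * P l x) \<in> borel_measurable (lborel \<Otimes>\<^sub>M counting)"
      by (rule borel_measurable_count_space_pair2) measurable
  qed
  have eP: "eLp lborel p (P l) \<le> ennreal W * pnorm p (Bx l f)" for l
  proof -
    have "(\<integral>\<^sup>+t. ennreal (norm (FT (sg k) t)) \<partial>lborel) \<le> ennreal W"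
      unfolding W_def norm_FT_sg[of k] using FT_integrable[OF test_function_sg[of 0]]
      by (simp add: nn_integral_eq_integral)
    then show ?thesis unfolding P_def by (intro eLp_filt_abs p) auto
  qed
  have "pnorm p (Bx k H) \<le> ennreal c * pnorm p (filt (sg k) H)"
  proof -
    have "ennreal (norm (Bx k H x)) = ennreal c * ennreal (norm (filt (sg k) H x))" for x
      unfolding Bx_def c_def[symmetric] using c by (simp add: norm_mult ennreal_mult)
    then show ?thesis by (simp only:) (rule eLp_cmult_le[OF p], measurable)
  qed
  also have "\<dots> \<le> ennreal c * eLp lborel p (\<lambda>x. \<integral>\<^sup>+l. V l * P l x \<partial>counting)"
    by (intro mult_left_mono eLp_mono p pt series_meas) auto
  \<comment> \<open>Minkowski's inequality over l; Young's inequality \<open>eP\<close> then applies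
    to each block.\<close>
  also have "\<dots> \<le> ennreal c * (\<integral>\<^sup>+l. eLp lborel p (\<lambda>x. V l * P l x) \<partial>counting)"
    by (intro mult_left_mono eLp_Minkowski_countable p lborel.sigma_finite_measure_axioms) auto
  also have "\<dots> \<le> ennreal c * (\<integral>\<^sup>+l. ennreal W * (V l * pnorm p (Bx l f)) \<partial>counting)"
  proof (intro mult_left_mono nn_integral_mono)
    fix l
    have "eLp lborel p (\<lambda>x. V l * P l x) \<le> V l * eLp lborel p (P l)" by (rule eLp_cmult_le[OF p]) measurable
    also have "\<dots> \<le> V l * (ennreal W * pnorm p (Bx l f))" by (intro mult_left_mono eP) simp
    finally show "eLp lborel p (\<lambda>x. V l * P l x) \<le> ennreal W * (V l * pnorm p (Bx l f))"
      by (simp only: mult_ac)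
  qed simp
  also have "\<dots> = ennreal (c * W) * (\<integral>\<^sup>+l. V l * pnorm p (Bx l f) \<partial>counting)"
    using c by (simp add: nn_integral_cmult ennreal_mult' mult.assoc)
  finally show "pnorm p (Bx k H)
      \<le> ennreal (inverse ((2 * pi) ^ CARD('n)) * (\<integral>t. norm (FT (sg 0) t) \<partial>lborel)) *
        (\<integral>\<^sup>+l. (\<integral>\<^sup>+m. (if near (k - l - m) then \<gamma> m else 0) \<partial>counting) *
          pnorm p (Bx l f) \<partial>counting)"
    unfolding c_def W_def V_def .
qed

end

section \<open>Weights on the lattice\<close>

text \<open>By homogeneity with t = y/x this is (1 + t)^r <= 1 + r t^r. Concavity gives 1 + r t, and
  t <= t^r because t is at most 1.\<close>

lemma powr_add_le_gain:
  fixes x y r :: real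
  assumes r: "0 < r" "r < 1" and "0 \<le> y" "y \<le> x"
  shows "(x + y) powr r \<le> x powr r + y powr r - (1 - r) * y powr r"
proof (cases "y = 0")
  case False
  then have y: "0 < y" and x: "0 < x" using assms by auto
  define t where "t = y / x"
  have t: "0 < t" "t \<le> 1" "y = t * x" using x y assms by (auto simp: t_def)
  have ln: "ln (1 + t) \<le> t" using t by (intro ln_add_one_self_le_self) auto
  have bern: "(1 + t) powr r \<le> 1 + r * t"
  proof -
    have "((1 + t) / 1) powr r \<le> r * ((1 + t) / 1) + (1 - r) * 1"
      using Youngs_inequality_0[of r "1 - r" "1 + t" 1] r t by simp
    then show ?thesis by (simp add: algebra_simps)
  qed
  have tr: "t \<le> t powr r"
    using powr_mono'[of r 1 t] r t by simp
  have "(x + y) powr r = x powr r * (1 + t) powr r"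
    using x t by (simp add: powr_mult[symmetric] algebra_simps)
  also have "\<dots> \<le> x powr r * (1 + r * t)" by (intro mult_left_mono bern) simp
  also have "\<dots> \<le> x powr r * (1 + r * t powr r)"
    using tr r by (intro mult_left_mono add_left_mono) auto
  also have "\<dots> = x powr r + r * y powr r"
    using x t by (simp add: powr_mult algebra_simps)
  finally show ?thesis by (simp add: algebra_simps)
qed (use assms in simp)

lemma powr_add_le:
  fixes x y r :: real
  assumes r: "0 < r" "r < 1" and "0 \<le> x" "0 \<le> y"
  shows "(x + y) powr r \<le> x powr r + y powr r"
proof -
  have nn: "(1 - r) * y powr r \<ge> 0" "(1 - r) * x powr r \<ge> 0" using r by auto
  show ?thesis
  proof (cases "y \<le> x")
    case True
    then show ?thesis using powr_add_le_gain[OF r assms(4)] nn by fastforce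
  next
    case False
    then have "(y + x) powr r \<le> y powr r + x powr r"
      using powr_add_le_gain[OF r assms(3), of y] nn by fastforce
    then show ?thesis by (simp add: add.commute)
  qed
qed

text \<open>\<open>J\<close> allows for the bounded displacement of the output frequency. Replacing
  the exponential of the minimum by a sum over both variables yields two terms, each with its gain
  on a fixed index.\<close>

lemma exp_weight_le:
  fixes x y z J r :: real
  assumes r: "0 < r" "r < 1" and "0 \<le> x" "0 \<le> y" "0 \<le> J" "0 \<le> z" and z: "z \<le> x + y + J"
  shows "exp (z powr r) \<le> exp (J powr r) * (exp (x powr r) * exp (y powr r) *
    (exp (- ((1 - r) * x powr r)) + exp (- ((1 - r) * y powr r))))"
proof -
  have *: "exp (z powr r) \<le> exp (J powr r) * (exp (x powr r) * exp (y powr r) * exp (- ((1 - r) * min x y powr r)))"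
  proof -
    have "z powr r \<le> (x + y + J) powr r" using assms by (intro powr_mono2) auto
    also have "\<dots> \<le> (x + y) powr r + J powr r" using assms by (intro powr_add_le) auto
    also have "(x + y) powr r \<le> x powr r + y powr r - (1 - r) * min x y powr r"
      using powr_add_le_gain[OF r, of y x] powr_add_le_gain[OF r, of x y] assms
      by (cases "y \<le> x") (auto simp: min_def add.commute)
    finally show ?thesis unfolding exp_add[symmetric] exp_le_cancel_iff by simp
  qed
  also have "\<dots> \<le> exp (J powr r) * (exp (x powr r) * exp (y powr r) *
    (exp (- ((1 - r) * x powr r)) + exp (- ((1 - r) * y powr r))))"
    by (intro mult_left_mono) (auto simp: min_def)
  finally show ?thesis .
qed

section \<open>Sums over countable sets and finiteness of lattice sums\<close>

lemma SUP_sum_eq_nn_integral: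
  fixes f :: "'i::countable \<Rightarrow> ennreal"
  shows "(SUP F\<in>{F. finite F \<and> F \<subseteq> UNIV}. sum f F) = (\<integral>\<^sup>+k. f k \<partial>counting)"
proof (rule antisym)
  show "(SUP F\<in>{F. finite F \<and> F \<subseteq> UNIV}. sum f F) \<le> (\<integral>\<^sup>+k. f k \<partial>counting)"
  proof (rule SUP_least)
    fix F assume "F \<in> {F :: 'i set. finite F \<and> F \<subseteq> UNIV}"
    then have "sum f F = (\<integral>\<^sup>+k. f k * indicator F k \<partial>counting)"
      by (simp add: nn_integral_count_space_finite flip: nn_integral_count_space_indicator)
    also have "\<dots> \<le> (\<integral>\<^sup>+k. f k \<partial>counting)"
      by (intro nn_integral_mono) (simp split: split_indicator)
    finally show "sum f F \<le> (\<integral>\<^sup>+k. f k \<partial>counting)" .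
  qed
  \<comment> \<open>Finite sets that exhaust the countable type along its enumeration, for monotone
    convergence.\<close>
  define U where "U n = {k :: 'i. to_nat k < n}" for n
  have fin: "finite (U n)" for n
    unfolding U_def by (rule finite_imageD[of to_nat]) (auto intro: finite_subset[of _ "{..<n}"] inj_on_subset[OF inj_to_nat])
  have "(\<integral>\<^sup>+k. f k \<partial>counting) = (\<integral>\<^sup>+k. (SUP n. f k * indicator (U n) k) \<partial>counting)"
  proof (rule nn_integral_cong)
    fix k
    show "f k = (SUP n. f k * indicator (U n) k)"
    proof (rule antisym)
      show "f k \<le> (SUP n. f k * indicator (U n) k)"
        by (rule SUP_upper2[of "Suc (to_nat k)"]) (auto simp: U_def)
    qed (auto intro!: SUP_least split: split_indicator)
  qed
  also have "\<dots> = (SUP n. \<integral>\<^sup>+k. f k * indicator (U n) k \<partial>counting)"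
    by (rule nn_integral_monotone_convergence_SUP)
      (auto simp: incseq_def le_fun_def U_def split: split_indicator)
  also have "\<dots> = (SUP n. sum f (U n))"
    using fin by (simp add: nn_integral_count_space_finite flip: nn_integral_count_space_indicator)
  also have "\<dots> \<le> (SUP F\<in>{F. finite F \<and> F \<subseteq> UNIV}. sum f F)"
    using fin by (intro SUP_least SUP_upper) auto
  finally show "(\<integral>\<^sup>+k. f k \<partial>counting) \<le> (SUP F\<in>{F. finite F \<and> F \<subseteq> UNIV}. sum f F)" .
qed

lemma infsum_ennreal_eq_nn_integral:
  fixes f :: "'i::countable \<Rightarrow> ennreal"
  shows "(\<Sum>\<^sub>\<infinity>k\<in>UNIV. f k) = (\<integral>\<^sup>+k. f k \<partial>counting)"
  unfolding SUP_sum_eq_nn_integral[symmetric] by (rule nonneg_infsum_complete) simp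

text \<open>A finite set of lattice points lies in a product of copies of the set \<open>T\<close>
  of all its coordinates, over which the sum factorises.\<close>

lemma nn_integral_lattice_prod_finite:
  fixes h :: "int \<Rightarrow> real"
  assumes h: "\<And>t. 0 \<le> h t" and bound: "\<And>T. finite T \<Longrightarrow> (\<Sum>t\<in>T. h t) \<le> C"
  shows "(\<integral>\<^sup>+l. ennreal (\<Prod>i\<in>UNIV. h (l $ i)) \<partial>count_space (UNIV :: (int^'n::finite) set)) \<le> ennreal (C ^ CARD('n))"
  unfolding SUP_sum_eq_nn_integral[symmetric]
proof (rule SUP_least)
    fix F assume "F \<in> {F :: (int^'n) set. finite F \<and> F \<subseteq> UNIV}"
    then have F: "finite F" by simp
    define T where "T = (\<Union>l\<in>F. range (vec_nth l))"
    have T: "finite T" using F by (auto simp: T_def)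
    have fin: "finite (PiE (UNIV :: 'n set) (\<lambda>_. T))" using T by (intro finite_PiE) auto
    have "(\<Sum>l\<in>F. \<Prod>i\<in>UNIV. h (l $ i)) = (\<Sum>g\<in>vec_nth ` F. \<Prod>i\<in>UNIV. h (g i))"
      by (subst sum.reindex) (auto simp: inj_on_def vec_nth_inject)
    also have "\<dots> \<le> (\<Sum>g\<in>PiE (UNIV :: 'n set) (\<lambda>_. T). \<Prod>i\<in>UNIV. h (g i))"
      by (intro sum_mono2 fin prod_nonneg h) (auto simp: T_def PiE_def)
    also have "\<dots> = (\<Prod>i\<in>(UNIV :: 'n set). \<Sum>t\<in>T. h t)"
      by (rule prod_sum_PiE[symmetric]) (use T in auto)
    also have "\<dots> \<le> C ^ CARD('n)"
      using bound[OF T] by (simp add: power_mono sum_nonneg h)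
    finally have "(\<Sum>l\<in>F. \<Prod>i\<in>UNIV. h (l $ i)) \<le> C ^ CARD('n)" .
    then show "(\<Sum>l\<in>F. ennreal (\<Prod>i\<in>UNIV. h (l $ i))) \<le> ennreal (C ^ CARD('n))"
      by (subst sum_ennreal) (auto intro!: prod_nonneg h ennreal_leI)
qed

lemma summable_exp_powr:
  fixes c r :: real
  assumes "c > 0" "r > 0"
  shows "summable (\<lambda>n. exp (- (c * real n powr r)))"
proof (rule summable_comparison_test_bigo)
  show "summable (\<lambda>n. norm (inverse (real n ^ 2)))"
    using inverse_power_summable[of 2, where 'a = real] by simp
  show "(\<lambda>n. exp (- (c * real n powr r))) \<in> O(\<lambda>n. inverse (real n ^ 2))"
    using assms by real_asymp
qed

lemma nn_integral_exp_lattice_finite: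
  fixes c r :: real
  assumes c: "c > 0" and r: "r > 0"
  shows "(\<integral>\<^sup>+l. ennreal (exp (- (c * norm (lattice_vec l) powr r))) \<partial>count_space (UNIV :: (int^'n::finite) set)) < \<infinity>"
proof -
  \<comment> \<open>Each |l_i| is at most |l|, so the decay rate is shared equally among the
    coordinates to dominate the exponential by a product.\<close>
  define d where "d = c / real CARD('n)"
  have d: "d > 0" using c by (simp add: d_def)
  define h where "h t = exp (- (d * \<bar>real_of_int t\<bar> powr r))" for t
  define s where "s n = exp (- (d * real n powr r))" for n
  have s: "summable s" unfolding s_def by (rule summable_exp_powr[OF d r])
  have bound: "(\<Sum>t\<in>T. h t) \<le> 2 * suminf s" if T: "finite T" for T
  proof -
    have part: "(\<Sum>t\<in>T'. h t) \<le> suminf s" if T': "finite T'" "inj_on (\<lambda>t. nat \<bar>t\<bar>) T'" for T'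
    proof -
      have "(\<Sum>t\<in>T'. h t) = (\<Sum>t\<in>T'. s (nat \<bar>t\<bar>))" by (intro sum.cong) (auto simp: h_def s_def)
      also have "\<dots> = (\<Sum>n\<in>(\<lambda>t. nat \<bar>t\<bar>) ` T'. s n)" by (simp add: sum.reindex[OF T'(2)])
      also have "\<dots> \<le> suminf s" by (intro sum_le_suminf s) (use T' in \<open>auto simp: s_def\<close>)
      finally show ?thesis .
    qed
    \<comment> \<open>On nonnegative and on negative integers the absolute value is injective, so
      each half is bounded by the series over the natural numbers.\<close>
    have "(\<Sum>t\<in>T. h t) = (\<Sum>t\<in>T \<inter> {0..}. h t) + (\<Sum>t\<in>T - {0..}. h t)" by (rule sum.Int_Diff[OF T])
    also have "\<dots> \<le> suminf s + suminf s"
      using T by (intro add_mono part) (auto simp: inj_on_def)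
    finally show ?thesis by simp
  qed
  have "exp (- (c * norm (lattice_vec l) powr r)) \<le> (\<Prod>i\<in>UNIV. h (l $ i))" for l :: "int^'n"
  proof -
    have "(\<Sum>i\<in>(UNIV :: 'n set). d * \<bar>real_of_int (l $ i)\<bar> powr r) \<le> (\<Sum>i\<in>(UNIV :: 'n set). d * norm (lattice_vec l) powr r)"
      using component_le_norm_cart[of "lattice_vec l"] d r by (intro sum_mono mult_left_mono powr_mono2) auto
    also have "\<dots> = c * norm (lattice_vec l) powr r" by (simp add: d_def)
    finally show ?thesis by (simp add: h_def sum_negf flip: exp_sum)
  qed
  then have "(\<integral>\<^sup>+l. ennreal (exp (- (c * norm (lattice_vec l) powr r))) \<partial>count_space (UNIV :: (int^'n) set))
      \<le> (\<integral>\<^sup>+l. ennreal (\<Prod>i\<in>UNIV. h (l $ i)) \<partial>count_space (UNIV :: (int^'n) set))"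
    by (intro nn_integral_mono ennreal_leI)
  also have "\<dots> \<le> ennreal ((2 * suminf s) ^ CARD('n))"
    by (rule nn_integral_lattice_prod_finite[OF _ bound]) (simp_all add: h_def)
  also have "\<dots> < \<infinity>" by simp
  finally show ?thesis .
qed

section \<open>Sequence spaces\<close>

text \<open>The embedding of l^q into l^infinity lets one weighted norm be pulled out of the product
  estimate as a constant.\<close>

lemma le_eLp_count_space:
  assumes q: "1 \<le> q" shows "a t \<le> eLp counting q a"
proof (cases "q = \<infinity>")
  case True
  have "AE t in counting. a t \<le> esssup counting a" by (rule esssup_AE)
  then show ?thesis using True by (simp add: eLp_def AE_count_space)
next
  case False
  have "ennreal_powr (a t) (enn2real q) \<le> (\<integral>\<^sup>+k. ennreal_powr (a k) (enn2real q) \<partial>counting)"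
    by (rule nn_integral_ge_point) simp
  then show ?thesis
    using False enn2real_ge_one[OF q] by (simp add: eLp_def flip: ennreal_powr_le_iff)
qed

lemma eLp_count_space_infinity: "eLp counting \<infinity> a = (SUP t. a t)"
proof (rule antisym)
  show "(SUP t. a t) \<le> eLp counting \<infinity> a" by (intro SUP_least le_eLp_count_space) simp
  show "eLp counting \<infinity> a \<le> (SUP t. a t)"
    unfolding eLp_def by (auto intro!: esssup_I SUP_upper simp: AE_count_space)
qed

lemma eLp_count_space_reindex:
  assumes q: "1 \<le> q" and f: "bij f"
  shows "eLp counting q (\<lambda>t. a (f t)) \<le> eLp counting q a"
proof -
  have *: "eLp counting q a \<le> eLp counting q a" by simp
  show ?thesis
  proof (cases "q = \<infinity>")
    case True
    show ?thesis unfolding True eLp_count_space_infinity by (intro SUP_least SUP_upper) simp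
  next
    case False
    have "(\<integral>\<^sup>+t. ennreal_powr (a (f t)) (enn2real q) \<partial>counting) = (\<integral>\<^sup>+t. ennreal_powr (a t) (enn2real q) \<partial>counting)"
      by (rule nn_integral_bij_count_space) (use f in \<open>simp add: bij_betw_def\<close>)
    then show ?thesis using False by (simp add: eLp_def)
  qed
qed

text \<open>Minkowski's inequality for the index type \<open>bool\<close>.\<close>

lemma eLp_add_le:
  assumes M: "sigma_finite_measure M" and p: "1 \<le> p" and [measurable]: "u \<in> borel_measurable M" "v \<in> borel_measurable M"
  shows "eLp M p (\<lambda>x. u x + v x) \<le> eLp M p u + eLp M p v"
proof -
  define w where "w x t = (if t then u x else v x)" for x t
  have [measurable]: "(\<lambda>x. w x t) \<in> borel_measurable M" for t by (cases t) (simp_all add: w_def)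
  have "eLp M p (\<lambda>x. \<integral>\<^sup>+t. w x t \<partial>counting) \<le> (\<integral>\<^sup>+t. eLp M p (\<lambda>x. w x t) \<partial>counting)"
    by (intro eLp_Minkowski_countable M p) measurable
  then show ?thesis
    by (simp add: nn_integral_count_space_finite UNIV_bool w_def add.commute)
qed

text \<open>With m = k - l - j the inner sum runs over the finite set of \<open>near\<close> vectors
  j. What remains are two nested mixtures of translates of \<open>b\<close>, with masses
  \<open>card {j. near j}\<close> and at most \<open>E\<close>.\<close>

lemma eLp_lattice_convolution:
  fixes e b :: "'k::{countable, ab_group_add} \<Rightarrow> ennreal"
  assumes q: "1 \<le> q" and E: "(\<integral>\<^sup>+l. e l \<partial>counting) \<le> ennreal E" and J: "finite {j. near j}"
  shows "eLp counting q (\<lambda>k. \<integral>\<^sup>+l. \<integral>\<^sup>+m. (if near (k - l - m) then e l * b m else 0) \<partial>counting \<partial>counting)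
    \<le> ennreal E * (ennreal (real (card {j. near j})) * eLp counting q b)"
proof -
  define Z where "Z k l = (\<integral>\<^sup>+j. indicator {j. near j} j * b (k - l - j) \<partial>counting)" for k l
  have "(\<integral>\<^sup>+m. (if near (k - l - m) then e l * b m else 0) \<partial>counting) = e l * Z k l" for k l
  proof -
    have "bij_betw (\<lambda>j. k - l - j) UNIV UNIV" by (rule bij_betwI[where g = "\<lambda>m. k - l - m"]) auto
    from nn_integral_bij_count_space[OF this, of "\<lambda>m. if near (k - l - m) then e l * b m else 0"]
    have "(\<integral>\<^sup>+m. (if near (k - l - m) then e l * b m else 0) \<partial>counting)
        = (\<integral>\<^sup>+j. (if near j then e l * b (k - l - j) else 0) \<partial>counting)" by simp
    also have "\<dots> = (\<integral>\<^sup>+j. e l * (indicator {j. near j} j * b (k - l - j)) \<partial>counting)"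
      by (intro nn_integral_cong) (simp split: split_indicator)
    also have "\<dots> = e l * Z k l" unfolding Z_def by (rule nn_integral_cmult) simp
    finally show ?thesis .
  qed
  moreover have "eLp counting q (\<lambda>k. Z k l) \<le> ennreal (real (card {j. near j})) * eLp counting q b" for l
    unfolding Z_def
  proof (rule eLp_mixture_le[OF sigma_finite_count_space_UNIV sigma_finite_count_space_UNIV q])
    show "(\<integral>\<^sup>+j. indicator {j. near j} j \<partial>counting) \<le> ennreal (real (card {j. near j}))"
      using J by (simp add: ennreal_of_nat_eq_real_of_nat)
    show "eLp counting q (\<lambda>k. b (k - l - j)) \<le> eLp counting q b" for j
      by (rule eLp_count_space_reindex[OF q, where f = "\<lambda>k. k - l - j"])
        (auto intro!: bij_betwI[where g = "\<lambda>k. k + j + l"] simp: algebra_simps)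
  qed (auto intro!: borel_measurable_count_space_pair2)
  ultimately show ?thesis
    by (simp only:) (rule eLp_mixture_le[OF sigma_finite_count_space_UNIV sigma_finite_count_space_UNIV q _ _ E],
      auto intro!: borel_measurable_count_space_pair2)
qed

lemma nn_integral_count_space_swap:
  fixes f :: "'i::countable \<Rightarrow> 'j::countable \<Rightarrow> ennreal"
  shows "(\<integral>\<^sup>+l. \<integral>\<^sup>+m. f l m \<partial>counting \<partial>counting) = (\<integral>\<^sup>+m. \<integral>\<^sup>+l. f l m \<partial>counting \<partial>counting)"
proof -
  interpret A: sigma_finite_measure "count_space (UNIV :: 'i set)" by (rule sigma_finite_count_space_UNIV)
  interpret B: sigma_finite_measure "count_space (UNIV :: 'j set)" by (rule sigma_finite_count_space_UNIV)
  interpret pair_sigma_finite "count_space (UNIV :: 'i set)" "count_space (UNIV :: 'j set)" ..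
  show ?thesis
    by (rule Fubini'[symmetric]) (auto intro!: borel_measurable_count_space_pair2)
qed

lemma GM_norm_eq_eLp:
  assumes q: "1 \<le> q"
  shows "GM_norm \<rho> s p q f
    = eLp counting q (\<lambda>k. ennreal (exp (norm (lattice_vec k) powr (1 / s))) * dist_Lp_norm p (Box \<rho> k f))"
proof (cases "q = \<infinity>")
  case True
  show ?thesis unfolding GM_norm_def True eLp_count_space_infinity by simp
next
  case False
  have "ennreal (exp (enn2real q * t)) * ennreal_powr d (enn2real q) = ennreal_powr (ennreal (exp t) * d) (enn2real q)" for t d
    by (simp add: ennreal_powr_mult ennreal_powr_ennreal exp_powr_real mult.commute)
  then show ?thesis using False by (simp add: GM_norm_def eLp_def infsum_ennreal_eq_nn_integral)
qed

section \<open>Gevrey-modulation spaces as algebras\<close>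

lemma dist_Lp_norm_cong:
  "(\<And>\<phi>. \<phi> \<in> schwartz \<Longrightarrow> T \<phi> = T' \<phi>) \<Longrightarrow> dist_Lp_norm p T = dist_Lp_norm p T'"
  unfolding dist_Lp_norm_def by simp

context unit_partition
begin

section \<open>Passage to Borel representatives\<close>

lemma Box_cong_AE:
  assumes f: "f \<in> borel_measurable lebesgue" and g: "g \<in> borel_measurable lebesgue"
    and ae: "AE x in lebesgue. f x = g x" and \<phi>: "\<phi> \<in> schwartz"
  shows "Box \<rho> k f \<phi> = Box \<rho> k g \<phi>"
proof -
  have [measurable]: "\<phi> \<in> borel_measurable borel" "FT (sg k) \<in> borel_measurable borel"
    using schwartz_measurable[OF \<phi>] FT_measurable[OF test_function_sg] by auto
  have "(\<lambda>x. complex_of_real (inverse ((2 * pi) ^ CARD('n))) * (\<integral>y. FT (sg k) (x - y) * \<phi> y \<partial>lborel)) \<in> borel_measurable lborel"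
    by (intro borel_measurable_times borel_measurable_const lborel.borel_measurable_lebesgue_integral) measurable
  then show ?thesis
    unfolding Box_def dist_inv_fourier_def dist_mult_def dist_fourier_def
      fourier_sg_inv_fourier[OF schwartz_integrable[OF \<phi>], abs_def]
    by (intro dist_of_cong_AE f g ae measurable_completion)
qed

lemma GM_norm_cong_AE:
  assumes "f \<in> borel_measurable lebesgue" "g \<in> borel_measurable lebesgue" "AE x in lebesgue. f x = g x"
  shows "GM_norm \<rho> s p q f = GM_norm \<rho> s p q g"
proof -
  have "dist_Lp_norm p (Box \<rho> k f) = dist_Lp_norm p (Box \<rho> k g)" for k
    by (intro dist_Lp_norm_cong Box_cong_AE assms)
  then show ?thesis by (simp add: GM_norm_def)
qed

lemma finite_near: "finite {j. near j}"
  unfolding near_def by (rule finite_lattice_box)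

lemma near_norm_le:
  assumes "near j" shows "norm (lattice_vec j) \<le> 3 * real CARD('n)"
proof -
  have "norm (lattice_vec j) \<le> (\<Sum>i\<in>UNIV. \<bar>lattice_vec j $ i\<bar>)" by (rule norm_le_l1_cart)
  also have "\<dots> \<le> (\<Sum>i\<in>(UNIV :: 'n set). 3)"
  proof (rule sum_mono)
    fix i
    have "real_of_int \<bar>j $ i\<bar> \<le> real_of_int 3" using assms unfolding near_def of_int_le_iff by blast
    then show "\<bar>lattice_vec j $ i\<bar> \<le> 3" by simp
  qed
  finally show ?thesis by simp
qed

lemma GM_algebra:
  assumes p: "1 \<le> p" and q: "1 \<le> q" and s: "s > 1"
  shows "\<exists>C\<^sub>1::real. C\<^sub>1 > 0 \<and>
    (\<forall>f \<in> GM \<rho> s p q. \<forall>g \<in> GM \<rho> s p q.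
       (\<lambda>x. f x * g x) \<in> GM \<rho> s p q \<and>
       GM_norm \<rho> s p q (\<lambda>x. f x * g x) \<le> ennreal C\<^sub>1 * GM_norm \<rho> s p q f * GM_norm \<rho> s p q g)"
proof -
  define r where "r = 1 / s"
  have r: "0 < r" "r < 1" using s by (simp_all add: r_def)
  obtain K where K: "K > 0"
    "\<And>p f k. 1 \<le> p \<Longrightarrow> uloc f \<Longrightarrow>
      pnorm p (Bx k f) \<le> ennreal K * dist_Lp_norm p (Box \<rho> k f)"
    "\<And>p f k x. 1 \<le> p \<Longrightarrow> uloc f \<Longrightarrow> ennreal (norm (Bx k f x)) \<le> ennreal K * dist_Lp_norm p (Box \<rho> k f)"
    by (rule Bx_bounds) blast
  define K1 where "K1 = inverse ((2 * pi) ^ CARD('n)) * (\<integral>t. norm (FT (sg 0) t) \<partial>lborel)"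
  have K1: "K1 \<ge> 0" by (simp add: K1_def)
  define N :: "int^'n \<Rightarrow> real" where "N k = norm (lattice_vec k) powr r" for k
  define w where "w k = ennreal (exp (N k))" for k
  define e where "e k = ennreal (exp (- ((1 - r) * N k)))" for k
  have w: "ennreal (exp (- N k)) * w k = 1" for k
    by (simp add: w_def ennreal_mult[symmetric] exp_add[symmetric])
  have "(\<integral>\<^sup>+l. e l \<partial>counting) < \<infinity>"
    unfolding e_def N_def by (rule nn_integral_exp_lattice_finite) (use r in auto)
  then obtain E where E: "(\<integral>\<^sup>+l. e l \<partial>counting) = ennreal E" "E \<ge> 0"
    by (cases "\<integral>\<^sup>+l. e l \<partial>counting") auto
  define W0 where "W0 = exp ((3 * real CARD('n)) powr r)"
  define c where "c = real (card {j. near j})"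
  have weight: "w k \<le> ennreal W0 * (w l * w m * (e l + e m))" if "near (k - l - m)" for k l m
  proof -
    have "lattice_vec k = lattice_vec l + lattice_vec m + lattice_vec (k - l - m)"
      by (simp add: lattice_vec_add[symmetric])
    then have "norm (lattice_vec k) \<le> norm (lattice_vec l) + norm (lattice_vec m) + norm (lattice_vec (k - l - m))"
      using norm_triangle_le[OF add_right_mono[OF norm_triangle_ineq]] by (metis order_refl)
    then have "norm (lattice_vec k) \<le> norm (lattice_vec l) + norm (lattice_vec m) + 3 * real CARD('n)"
      using near_norm_le[OF that] by linarith
    from exp_weight_le[OF r _ _ _ _ this] have "exp (N k) \<le> W0 * (exp (N l) * exp (N m) * (exp (- ((1 - r) * N l)) + exp (- ((1 - r) * N m))))"
      unfolding N_def W0_def by simp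
    then have "ennreal (exp (N k)) \<le> ennreal (W0 * (exp (N l) * exp (N m) * (exp (- ((1 - r) * N l)) + exp (- ((1 - r) * N m)))))"
      by (rule ennreal_leI)
    also have "\<dots> = ennreal W0 * (w l * w m * (e l + e m))"
      unfolding w_def e_def by (simp add: ennreal_mult W0_def)
    finally show ?thesis unfolding w_def .
  qed
  define K2 where "K2 = K1 * K * K * W0"
  have K2: "K2 \<ge> 0" using K1 K(1) by (simp add: K2_def W0_def)
  \<comment> \<open>The 2 counts the two convolutions \<open>X\<close> and \<open>Y\<close>; the
    added 1 makes the constant positive.\<close>
  define C where "C = K2 * (2 * E * c) + 1"
  have C: "C > 0" using K2 E by (simp add: C_def c_def add_nonneg_pos)
  have GM_eq: "GM_norm \<rho> s p q f = eLp counting q (\<lambda>k. w k * dist_Lp_norm p (Box \<rho> k f))" for f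
    unfolding GM_norm_eq_eLp[OF q] w_def N_def r_def ..
  have main: "(\<lambda>x. f x * g x) \<in> GM \<rho> s p q \<and>
      GM_norm \<rho> s p q (\<lambda>x. f x * g x) \<le> ennreal C * GM_norm \<rho> s p q f * GM_norm \<rho> s p q g"
    if f: "f \<in> GM \<rho> s p q" and g: "g \<in> GM \<rho> s p q" for f g
  proof -
    define Mf where "Mf = GM_norm \<rho> s p q f"
    define Mg where "Mg = GM_norm \<rho> s p q g"
    have M: "Mf < \<infinity>" "Mg < \<infinity>" using f g by (simp_all add: GM_def Mf_def Mg_def)
    have fm: "f \<in> borel_measurable lebesgue" and gm: "g \<in> borel_measurable lebesgue"
      using f g by (simp_all add: GM_def Lp_def)
    obtain f' where f': "f' \<in> borel_measurable borel" "AE x in lebesgue. f x = f' x" by (rule borel_representative[OF fm])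
    obtain g' where g': "g' \<in> borel_measurable borel" "AE x in lebesgue. g x = g' x" by (rule borel_representative[OF gm])
    have fm': "f' \<in> borel_measurable lebesgue" and gm': "g' \<in> borel_measurable lebesgue"
      using f' g' by (auto intro: measurable_completion)
    have Lf: "pnorm p f' < \<infinity>" and Lg: "pnorm p g' < \<infinity>"
      using f g Lp_norm_cong_AE[OF fm fm' f'(2)] Lp_norm_cong_AE[OF gm gm' g'(2)] Lp_norm_eq_eLp[OF f'(1) p] Lp_norm_eq_eLp[OF g'(1) p]
      by (simp_all add: GM_def Lp_def)
    have uf: "uloc f'" and ug: "uloc g'"
      using uloc_Lp[OF p f'(1) Lf] uloc_Lp[OF p g'(1) Lg] by auto
    define df where "df l = dist_Lp_norm p (Box \<rho> l f')" for l
    define dg where "dg l = dist_Lp_norm p (Box \<rho> l g')" for l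
    define a where "a l = w l * df l" for l
    define b where "b l = w l * dg l" for l
    have Mf: "Mf = eLp counting q a" and Mg: "Mg = eLp counting q b"
      unfolding Mf_def Mg_def GM_norm_cong_AE[OF fm fm' f'(2)] GM_norm_cong_AE[OF gm gm' g'(2)] GM_eq a_def b_def df_def dg_def
      by auto
    have ab: "a l \<le> Mf" "b l \<le> Mg" for l
      unfolding Mf Mg by (rule le_eLp_count_space[OF q])+
    \<comment> \<open>The inverse weight exp(-N) is at most exp(-(1-r)N), so the summable sequence
      \<open>e\<close> also controls the unweighted norms of the blocks.\<close>
    have dominate: "d l \<le> e l * M" if "w l * d l \<le> M" for d M l
    proof -
      have "d l = ennreal (exp (- N l)) * (w l * d l)" by (simp add: w mult.assoc[symmetric])
      also have "\<dots> \<le> e l * M"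
        unfolding e_def using r that by (intro mult_mono ennreal_leI) (auto simp: N_def mult_left_le_one_le)
      finally show ?thesis .
    qed
    have sumf: "(\<integral>\<^sup>+l. ennreal K * df l \<partial>counting) < \<infinity>"
    proof -
      have "(\<integral>\<^sup>+l. ennreal K * df l \<partial>counting) \<le> (\<integral>\<^sup>+l. ennreal K * (e l * Mf) \<partial>counting)"
        using ab by (intro nn_integral_mono mult_left_mono dominate) (auto simp: a_def)
      also have "\<dots> < \<infinity>" using M by (simp add: nn_integral_cmult nn_integral_multc E ennreal_mult_less_top)
      finally show ?thesis .
    qed
    have sumg: "(\<integral>\<^sup>+l. ennreal K * dg l \<partial>counting) < \<infinity>"
    proof -
      have "(\<integral>\<^sup>+l. ennreal K * dg l \<partial>counting) \<le> (\<integral>\<^sup>+l. ennreal K * (e l * Mg) \<partial>counting)"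
        using ab by (intro nn_integral_mono mult_left_mono dominate) (auto simp: b_def)
      also have "\<dots> < \<infinity>" using M by (simp add: nn_integral_cmult nn_integral_multc E ennreal_mult_less_top)
      finally show ?thesis .
    qed
    have bf: "ennreal (norm (Bx l f' y)) \<le> ennreal K * df l" and bg: "ennreal (norm (Bx l g' y)) \<le> ennreal K * dg l" for l y
      unfolding df_def dg_def by (intro K p uf ug)+
    define F where "F y = (\<integral>l. Bx l f' y \<partial>counting)" for y
    define G where "G y = (\<integral>m. Bx m g' y \<partial>counting)" for y
    \<comment> \<open>This agrees almost everywhere with the given product and replaces it from here
      on.\<close>
    define H where "H y = F y * G y" for y
    have uF: "uloc F" unfolding F_def by (rule uloc_series(1)[OF Bx_measurable[OF uf] bf sumf])
    have uG: "uloc G" unfolding G_def by (rule uloc_series(1)[OF Bx_measurable[OF ug] bg sumg])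
    have aef: "AE x in lborel. f' x = F x" unfolding F_def by (rule AE_eq_series_Bx[OF uf bf sumf])
    have aeg: "AE x in lborel. g' x = G x" unfolding G_def by (rule AE_eq_series_Bx[OF ug bg sumg])
    have uH: "uloc H"
      using eLp_Bx_product(1)[OF p uf ug bf sumf bg sumg] unfolding H_def[abs_def] F_def G_def .
    have Fm [measurable]: "F \<in> borel_measurable borel" and Gm [measurable]: "G \<in> borel_measurable borel"
      and Hm [measurable]: "H \<in> borel_measurable borel"
      using uloc_measurable uF uG uH by blast+
    have Hm': "H \<in> borel_measurable lebesgue" using Hm by (intro measurable_completion) simp
    have fgm: "(\<lambda>x. f x * g x) \<in> borel_measurable lebesgue" using fm gm by measurable
    have aeH: "AE x in lebesgue. f x * g x = H x"
      using f'(2) g'(2) AE_completion[OF aef] AE_completion[OF aeg] by eventually_elim (simp add: H_def)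
    \<comment> \<open>One factor is bounded by the sum of the suprema of its blocks, the other one
      lies in L^p.\<close>
    have fgLp: "(\<lambda>x. f x * g x) \<in> Lp p"
    proof -
      define \<Gamma> where "\<Gamma> = (\<integral>\<^sup>+l. ennreal K * dg l \<partial>counting)"
      have G: "ennreal (norm (G y)) \<le> \<Gamma>" for y
        unfolding G_def \<Gamma>_def by (rule uloc_series(2)[OF Bx_measurable[OF ug] bg sumg])
      have "AE x in lborel. ennreal (norm (H x)) \<le> \<Gamma> * ennreal (norm (f' x))"
        using aef
      proof eventually_elim
        case (elim x)
        have "ennreal (norm (H x)) = ennreal (norm (G x)) * ennreal (norm (f' x))"
          by (simp add: H_def elim norm_mult ennreal_mult mult.commute)
        also have "\<dots> \<le> \<Gamma> * ennreal (norm (f' x))" by (intro mult_right_mono G) simp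
        finally show ?case .
      qed
      then have "pnorm p H \<le> eLp lborel p (\<lambda>x. \<Gamma> * ennreal (norm (f' x)))"
        using f'(1) by (intro eLp_mono_AE p) auto
      also have "\<dots> \<le> \<Gamma> * pnorm p f'"
        using f'(1) by (intro eLp_cmult_le p) auto
      also have "\<dots> < \<infinity>" using Lf sumg by (simp add: \<Gamma>_def ennreal_mult_less_top)
      finally show ?thesis
        using fgm Lp_norm_cong_AE[OF fgm Hm' aeH] Lp_norm_eq_eLp[OF Hm p] by (simp add: Lp_def)
    qed
    \<comment> \<open>\<open>X\<close> has the gain on the index of \<open>f\<close> and keeps the
      sequence of \<open>g\<close>; \<open>Y\<close> has the roles exchanged, with its sums ordered
      to fit \<open>eLp_lattice_convolution\<close>.\<close>
    define X where "X k = (\<integral>\<^sup>+l. \<integral>\<^sup>+m. (if near (k - l - m) then e l * b m else 0) \<partial>counting \<partial>counting)" for k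
    define Y where "Y k = (\<integral>\<^sup>+m. \<integral>\<^sup>+l. (if near (k - m - l) then e m * a l else 0) \<partial>counting \<partial>counting)" for k
    have X: "eLp counting q X \<le> ennreal E * (ennreal c * Mg)"
      unfolding X_def Mg c_def by (rule eLp_lattice_convolution[OF q _ finite_near]) (simp add: E)
    have Y: "eLp counting q Y \<le> ennreal E * (ennreal c * Mf)"
      unfolding Y_def Mf c_def by (rule eLp_lattice_convolution[OF q _ finite_near]) (simp add: E)
    have Y_swap: "Y k = (\<integral>\<^sup>+l. \<integral>\<^sup>+m. (if near (k - l - m) then e m * a l else 0) \<partial>counting \<partial>counting)" for k
    proof -
      have "Y k = (\<integral>\<^sup>+l. \<integral>\<^sup>+m. (if near (k - m - l) then e m * a l else 0) \<partial>counting \<partial>counting)"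
        unfolding Y_def by (rule nn_integral_count_space_swap)
      also have "\<dots> = (\<integral>\<^sup>+l. \<integral>\<^sup>+m. (if near (k - l - m) then e m * a l else 0) \<partial>counting \<partial>counting)"
      proof (intro nn_integral_cong)
        fix l m
        have "k - m - l = k - l - m" by (simp add: algebra_simps)
        then show "(if near (k - m - l) then e m * a l else 0) = (if near (k - l - m) then e m * a l else 0)"
          by (rule arg_cong)
      qed
      finally show ?thesis .
    qed
    have pt: "w k * dist_Lp_norm p (Box \<rho> k H) \<le> ennreal K2 * (Mf * X k + Mg * Y k)" for k
    proof -
      have "dist_Lp_norm p (Box \<rho> k H) \<le> pnorm p (Bx k H)"
        by (rule dist_Lp_norm_Box_le[OF uH p])
      also have "\<dots> \<le> ennreal K1 * (\<integral>\<^sup>+l. (\<integral>\<^sup>+m. (if near (k - l - m) then ennreal K * dg m else 0) \<partial>counting) *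
          pnorm p (Bx l f') \<partial>counting)"
        using eLp_Bx_product(2)[OF p uf ug bf sumf bg sumg] unfolding H_def[abs_def] F_def G_def K1_def .
      also have "\<dots> \<le> ennreal K1 * (\<integral>\<^sup>+l. (\<integral>\<^sup>+m. (if near (k - l - m) then ennreal K * dg m else 0) \<partial>counting) *
          (ennreal K * df l) \<partial>counting)"
        unfolding df_def by (intro mult_left_mono nn_integral_mono K(2) p uf) auto
      also have "\<dots> = ennreal K1 * (\<integral>\<^sup>+l. \<integral>\<^sup>+m. (if near (k - l - m) then ennreal K * dg m else 0) * (ennreal K * df l) \<partial>counting \<partial>counting)"
        by (simp add: nn_integral_multc)
      finally have "w k * dist_Lp_norm p (Box \<rho> k H)
          \<le> w k * (ennreal K1 * (\<integral>\<^sup>+l. \<integral>\<^sup>+m. (if near (k - l - m) then ennreal K * dg m else 0) * (ennreal K * df l) \<partial>counting \<partial>counting))"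
        by (rule mult_left_mono) simp
      also have "\<dots> = (\<integral>\<^sup>+l. \<integral>\<^sup>+m. w k * (ennreal K1 * ((if near (k - l - m) then ennreal K * dg m else 0) * (ennreal K * df l))) \<partial>counting \<partial>counting)"
        by (simp add: nn_integral_cmult)
      also have "\<dots> \<le> (\<integral>\<^sup>+l. \<integral>\<^sup>+m. ennreal K2 * (Mf * (if near (k - l - m) then e l * b m else 0) + Mg * (if near (k - l - m) then e m * a l else 0)) \<partial>counting \<partial>counting)"
      proof (intro nn_integral_mono)
        fix l m
        show "w k * (ennreal K1 * ((if near (k - l - m) then ennreal K * dg m else 0) * (ennreal K * df l)))
            \<le> ennreal K2 * (Mf * (if near (k - l - m) then e l * b m else 0) + Mg * (if near (k - l - m) then e m * a l else 0))"
        proof (cases "near (k - l - m)")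
          case True
          have KK: "ennreal K2 = ennreal K1 * ennreal K * ennreal K * ennreal W0"
            using K1 K(1) by (simp add: K2_def ennreal_mult W0_def)
          have "w k * (ennreal K1 * ((ennreal K * dg m) * (ennreal K * df l)))
              \<le> (ennreal W0 * (w l * w m * (e l + e m))) * (ennreal K1 * ((ennreal K * dg m) * (ennreal K * df l)))"
            by (intro mult_right_mono weight True) simp
          also have "\<dots> = ennreal K2 * (a l * (e l * b m) + b m * (e m * a l))"
            unfolding KK a_def b_def by (simp only: distrib_left distrib_right mult_ac)
          \<comment> \<open>In each term the weighted norm that shares its index with the gain is
            bounded by the full norm. Convolutions of \<open>e\<close> in l^1 with a sequence in l^q
            remain.\<close>
          also have "\<dots> \<le> ennreal K2 * (Mf * (e l * b m) + Mg * (e m * a l))"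
            by (intro mult_left_mono add_mono mult_right_mono ab) auto
          finally show ?thesis using True by simp
        qed simp
      qed
      also have "\<dots> = ennreal K2 * (Mf * X k + Mg * Y k)"
        unfolding X_def Y_swap by (simp add: nn_integral_cmult nn_integral_add)
      finally show ?thesis .
    qed
    have "GM_norm \<rho> s p q (\<lambda>x. f x * g x) = eLp counting q (\<lambda>k. w k * dist_Lp_norm p (Box \<rho> k H))"
      unfolding GM_norm_cong_AE[OF fgm Hm' aeH] GM_eq ..
    also have "\<dots> \<le> eLp counting q (\<lambda>k. ennreal K2 * (Mf * X k + Mg * Y k))"
      by (rule eLp_mono[OF q]) (auto intro: pt)
    also have "\<dots> \<le> ennreal K2 * eLp counting q (\<lambda>k. Mf * X k + Mg * Y k)"
      by (rule eLp_cmult_le[OF q]) simp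
    also have "\<dots> \<le> ennreal K2 * (eLp counting q (\<lambda>k. Mf * X k) + eLp counting q (\<lambda>k. Mg * Y k))"
      by (intro mult_left_mono eLp_add_le sigma_finite_count_space_UNIV q) auto
    also have "\<dots> \<le> ennreal K2 * (Mf * eLp counting q X + Mg * eLp counting q Y)"
      by (intro mult_left_mono add_mono eLp_cmult_le q) auto
    also have "\<dots> \<le> ennreal K2 * (Mf * (ennreal E * (ennreal c * Mg)) + Mg * (ennreal E * (ennreal c * Mf)))"
      by (intro mult_left_mono add_mono X Y) auto
    also have "\<dots> = ennreal (K2 * (2 * E * c)) * Mf * Mg"
    proof -
      have "ennreal (K2 * (2 * E * c)) = ennreal K2 * (2 * (ennreal E * ennreal c))"
        using K2 E by (simp add: c_def ennreal_mult mult.assoc)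
      then show ?thesis unfolding mult_2[of "ennreal E * _"] by (simp only: distrib_left distrib_right mult_ac)
    qed
    also have "\<dots> \<le> ennreal C * Mf * Mg"
      by (intro mult_right_mono ennreal_leI) (simp_all add: C_def)
    finally have le: "GM_norm \<rho> s p q (\<lambda>x. f x * g x) \<le> ennreal C * Mf * Mg" .
    also have "ennreal C * Mf * Mg < \<infinity>" using M by (simp add: ennreal_mult_less_top)
    finally show ?thesis using fgLp le by (simp add: GM_def Mf_def Mg_def)
  qed
  then show ?thesis using C by blast
qed

end

theorem corollary2p17:
  fixes \<rho> :: "real^'n::finite \<Rightarrow> real" and p q :: ennreal and s :: real
  assumes "smooth \<rho>"
    and "compact (tsupport \<rho>)"
    and "range \<rho> \<subseteq> {0..1}"
    and "tsupport \<rho> \<subseteq> cbox (\<chi> i. -1) (\<chi> i. 1)"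
    and "\<forall>\<xi> \<in> cbox (\<chi> i. -1/2) (\<chi> i. 1/2). \<rho> \<xi> = 1"
    and "1 \<le> p" and "1 \<le> q"
    and "s > 1"
  shows "\<exists>C\<^sub>1::real. C\<^sub>1 > 0 \<and>
    (\<forall>f \<in> GM \<rho> s p q. \<forall>g \<in> GM \<rho> s p q.
       (\<lambda>x. f x * g x) \<in> GM \<rho> s p q \<and>
       GM_norm \<rho> s p q (\<lambda>x. f x * g x) \<le> ennreal C\<^sub>1 * GM_norm \<rho> s p q f * GM_norm \<rho> s p q g)"
proof -
  interpret unit_partition \<rho>
  proof
    show "smooth \<rho>" by fact
    show "0 \<le> \<rho> x" for x
    proof -
      have "\<rho> x \<in> {0..1}" using assms(3) by blast
      then show ?thesis by simp
    qed
    show "\<bar>x $ i\<bar> \<le> 1" if "\<rho> x \<noteq> 0" for x i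
    proof -
      have "x \<in> support_on UNIV \<rho>" using that by (simp add: support_on_def)
      then have "x \<in> cbox (\<chi> i. -1) (\<chi> i. 1)" using assms(4) closure_subset unfolding tsupport_def by blast
      then have "- 1 \<le> x $ i" "x $ i \<le> 1" by (simp_all add: mem_box_cart)
      then show ?thesis by linarith
    qed
    show "\<rho> x = 1" if "\<And>i. \<bar>x $ i\<bar> \<le> 1/2" for x
    proof -
      have "- 1/2 \<le> x $ i \<and> x $ i \<le> 1/2" for i using that[of i] by linarith
      then have "x \<in> cbox (\<chi> i. -1/2) (\<chi> i. 1/2)" by (simp add: mem_box_cart)
      then show ?thesis using assms(5) by blast
    qed
  qed
  show ?thesis by (rule GM_algebra) fact+
qed

end
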